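(* Let $H$ be a connected graph on at least $3$ vertices and let $t\geq e(H)$ be an integer. Then, as $n\to\infty$, $\operatorname{sat}_t(n,\mathfrak{R}(H))$ equals: (i) $\Theta(n^2)$ if $H$ is a star; (ii) $\Theta(n\log n)$ if $H$ has a conical vertex but is not a star; (iii) $\Theta(n\log n)$ if every edge of $H$ lies in a triangle; (iv) $\Theta(n)$ if $H$ contains a non-pendant edge which does not belong to any triangle; (v) $\Theta(n)$ if $H$ is $K_r$ with a rotated edge for some even $r\geq 4$.
   Context: A $t$-edge-coloured graph is a graph $G$ with a function $c:E(G)\to\{1,\dots,t\}$ (not necessarily proper). A copy of $H$ is rainbow if all its edges receive distinct colours; $\mathfrak{R}(H)$ denotes the family of rainbow copies of $H$. A $t$-edge-coloured graph is $\mathfrak{R}(H)$-saturated if it contains no rainbow copy of $H$ but adding any non-edge in any colour from $\{1,\dots,t\}$ creates a rainbow copy of $H$. $\operatorname{sat}_t(n,\mathfrak{R}(H))$ is the minimum number of edges of such a graph on $n$ vertices. $e(H)$ is the number of edges of $H$. A vertex of $H$ is conical if its degree is $|H|-1$. An edge is pendant if one of its endpoints has degree $1$. A star is $K_{1,k}$. For $r\geq 4$, "$K_r$ with a rotated edge" is obtained from a copy of $K_r$ by adding one new vertex and replacing one edge $uv$ of the clique by the edge $uw$, where $w$ is the new vertex. Logarithms are base 2. *)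

theory Defs
  imports Complex_Main "HOL-Library.Ramsey" "HOL-Library.Landau_Symbols"
begin

text \<open>
  A graph is a pair of a vertex set and an edge set; edges are 2-element sets of vertices.
  \<open>nsets V k\<close> (from \<open>HOL-Library.Ramsey\<close>) is the set of \<open>k\<close>-element subsets of \<open>V\<close>.
\<close>

type_synonym 'a graph = "'a set \<times> 'a set set"

abbreviation verts :: "'a graph \<Rightarrow> 'a set" where "verts \<equiv> fst"
abbreviation edges :: "'a graph \<Rightarrow> 'a set set" where "edges \<equiv> snd"

definition simple_graph :: "'a graph \<Rightarrow> bool" where
  "simple_graph G \<longleftrightarrow> finite (verts G) \<and> edges G \<subseteq> nsets (verts G) 2"

definition connected_graph :: "'a graph \<Rightarrow> bool" where
  "connected_graph G \<longleftrightarrow> verts G \<noteq> {} \<and>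
     (\<forall>u\<in>verts G. \<forall>v\<in>verts G. (u, v) \<in> {(x, y). {x, y} \<in> edges G}\<^sup>*)"

definition degree :: "'a graph \<Rightarrow> 'a \<Rightarrow> nat" where
  "degree G v = card {e \<in> edges G. v \<in> e}"

definition conical :: "'a graph \<Rightarrow> 'a \<Rightarrow> bool" where
  "conical G v \<longleftrightarrow> v \<in> verts G \<and> degree G v = card (verts G) - 1"

definition pendant :: "'a graph \<Rightarrow> 'a set \<Rightarrow> bool" where
  "pendant G e \<longleftrightarrow> e \<in> edges G \<and> (\<exists>v\<in>e. degree G v = 1)"

definition in_triangle :: "'a graph \<Rightarrow> 'a set \<Rightarrow> bool" where
  "in_triangle G e \<longleftrightarrow> (\<exists>T\<in>nsets (verts G) 3. nsets T 2 \<subseteq> edges G \<and> e \<in> nsets T 2)"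

definition is_star :: "'a graph \<Rightarrow> bool" where
  "is_star G \<longleftrightarrow> (\<exists>x L. finite L \<and> L \<noteq> {} \<and> x \<notin> L \<and>
     verts G = insert x L \<and> edges G = {{x, y} | y. y \<in> L})"

definition is_clique_rotated_edge :: "nat \<Rightarrow> 'a graph \<Rightarrow> bool" where
  "is_clique_rotated_edge r G \<longleftrightarrow> (\<exists>K u v w. finite K \<and> card K = r \<and>
     u \<in> K \<and> v \<in> K \<and> u \<noteq> v \<and> w \<notin> K \<and>
     verts G = insert w K \<and> edges G = insert {u, w} (nsets K 2 - {{u, v}}))"

definition subgraph :: "'a graph \<Rightarrow> 'a graph \<Rightarrow> bool" where
  "subgraph F G \<longleftrightarrow> simple_graph F \<and> verts F \<subseteq> verts G \<and> edges F \<subseteq> edges G"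

definition isomorphic :: "'a graph \<Rightarrow> 'b graph \<Rightarrow> bool" where
  "isomorphic G H \<longleftrightarrow> (\<exists>f. bij_betw f (verts G) (verts H) \<and>
     (\<forall>u\<in>verts G. \<forall>v\<in>verts G. {u, v} \<in> edges G \<longleftrightarrow> {f u, f v} \<in> edges H))"

text \<open>Copies of \<open>H\<close> are subgraphs isomorphic to \<open>H\<close>, not necessarily induced.\<close>

definition has_rainbow_copy :: "'b graph \<Rightarrow> 'a graph \<Rightarrow> ('a set \<Rightarrow> nat) \<Rightarrow> bool" where
  "has_rainbow_copy H G c \<longleftrightarrow>
     (\<exists>F. subgraph F G \<and> isomorphic F H \<and> inj_on c (edges F))"

text \<open>The colouring is a total function; only its values on the edges matter.\<close>

definition edge_coloured :: "nat \<Rightarrow> 'a graph \<Rightarrow> ('a set \<Rightarrow> nat) \<Rightarrow> bool" where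
  "edge_coloured t G c \<longleftrightarrow> simple_graph G \<and> (\<forall>e\<in>edges G. c e \<in> {1..t})"

definition rainbow_saturated :: "nat \<Rightarrow> 'b graph \<Rightarrow> 'a graph \<Rightarrow> ('a set \<Rightarrow> nat) \<Rightarrow> bool" where
  "rainbow_saturated t H G c \<longleftrightarrow> edge_coloured t G c \<and> \<not> has_rainbow_copy H G c \<and>
     (\<forall>e \<in> nsets (verts G) 2 - edges G. \<forall>i\<in>{1..t}.
        has_rainbow_copy H (verts G, insert e (edges G)) (c(e := i)))"

text \<open>
  By isomorphism invariance it suffices to consider graphs with vertex set \<open>{..<n}\<close>.
  The minimum exists whenever \<open>H\<close> has an edge, see \<open>rainbow_saturated_exists\<close> below.
\<close>

definition rainbow_sat :: "nat \<Rightarrow> nat \<Rightarrow> 'b graph \<Rightarrow> nat" where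
  "rainbow_sat t n H = (LEAST m. \<exists>(G :: nat graph) c.
     verts G = {..<n} \<and> rainbow_saturated t H G c \<and> card (edges G) = m)"

lemma rainbow_saturated_exists:
  fixes H :: "'b graph"
  assumes H: "simple_graph H" "edges H \<noteq> {}"
  shows "\<exists>(G :: nat graph) c. verts G = {..<n} \<and> rainbow_saturated t H G c"
proof -
  define P where "P = (\<lambda>m. \<exists>(G :: nat graph) c. verts G = {..<n} \<and> edge_coloured t G c \<and>
    \<not> has_rainbow_copy H G c \<and> card (edges G) = m)"
  obtain a b where ab: "{a, b} \<in> edges H" "a \<in> verts H" "b \<in> verts H"
    using H unfolding simple_graph_def nsets_def
    by (auto simp: card_2_iff subset_iff) (metis insertCI)
  have "\<not> has_rainbow_copy H ({..<n}, {} :: nat set set) c" for c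
  proof
    assume "has_rainbow_copy H ({..<n}, {} :: nat set set) c"
    then obtain F where "subgraph F ({..<n}, {})" and "isomorphic F H"
      unfolding has_rainbow_copy_def by blast
    then obtain f where F: "edges F = {}" and f: "bij_betw f (verts F) (verts H)"
      and e: "\<forall>u\<in>verts F. \<forall>v\<in>verts F. {u, v} \<in> edges F \<longleftrightarrow> {f u, f v} \<in> edges H"
      unfolding subgraph_def isomorphic_def by auto
    obtain u v where "u \<in> verts F" "v \<in> verts F" "f u = a" "f v = b"
      using f ab unfolding bij_betw_def by (metis imageE)
    with e F ab show False by auto
  qed
  then have P0: "P 0"
    unfolding P_def edge_coloured_def simple_graph_def
    by (intro exI[of _ "({..<n}, {})"]) auto
  have fin: "finite (nsets {..<n} 2)"
    by (simp add: finite_imp_finite_nsets)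
  have bound: "m \<le> card (nsets {..<n} 2)" if "P m" for m
    using that card_mono[OF fin] unfolding P_def edge_coloured_def simple_graph_def
    by metis
  obtain m where m: "P m" "\<And>k. P k \<Longrightarrow> k \<le> m"
    using Nat.ex_has_greatest_nat[of P 0 "card (nsets {..<n} 2)"] P0 bound by blast
  then obtain G :: "nat graph" and c where G: "verts G = {..<n}" "edge_coloured t G c"
    "\<not> has_rainbow_copy H G c" "card (edges G) = m"
    unfolding P_def by blast
  have finE: "finite (edges G)"
    using G fin unfolding edge_coloured_def simple_graph_def by (metis finite_subset)
  have "has_rainbow_copy H (verts G, insert e (edges G)) (c(e := i))"
    if e: "e \<in> nsets (verts G) 2 - edges G" and i: "i \<in> {1..t}" for e i
  proof (rule ccontr)
    assume *: "\<not> ?thesis"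
    have "P (card (insert e (edges G)))"
      unfolding P_def using * G(1,2) e i
      by (intro exI[of _ "(verts G, insert e (edges G))"] exI[of _ "c(e := i)"])
         (auto simp: edge_coloured_def simple_graph_def)
    with m(2) e finE G(4) show False by fastforce
  qed
  with G show ?thesis unfolding rainbow_saturated_def by blast
qed

end

theory Submission
  imports Defs "HOL-Library.FuncSet" "HOL-Real_Asymp.Real_Asymp"
begin

text \<open>
  Lower bounds. A saturated graph has at most one isolated vertex, so it has linearly many edges. If
  \<open>H\<close> has a conical vertex and two non-adjacent vertices see a common colour \<open>i\<close>, then adding the edge
  between them in colour \<open>i\<close> must use it as an edge of a triangle of \<open>H\<close>: a pendant edge at the
  conical vertex could be moved to the old edge of colour \<open>i\<close>. For stars, the vertices seeing a given
  colour are thus a clique. In the other cases, linearly many vertices are pairwise adjacent or joined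
  by a rainbow path of length two, and averaging over a random colour per vertex gives \<open>n log n\<close> edges.

  Upper bounds. Fix an edge \<open>xy\<close> of \<open>H\<close>. An independent set is joined to disjoint coloured copies of
  \<open>H - {x, y}\<close>, in the role of \<open>x\<close> or \<open>y\<close> or both, such that adding an edge between two of its vertices
  completes a rainbow copy of \<open>H\<close>. If \<open>xy\<close> is in a triangle, the roles are given by the binary digits of
  the vertex, and logarithmically many copies are needed; if it is in no triangle and not pendant, a
  bounded number suffices. For the rotated clique, take disjoint Hamming graphs \<open>[r]\<^sup>r\<^sup>/\<^sup>2\<close> whose lines
  are rainbow cliques and where every vertex sees every colour exactly once, which is possible
  since \<open>K\<^sub>r\<close> has a one-factorization for even \<open>r\<close>.
\<close>

section \<open>Graphs and rainbow embeddings\<close>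

text \<open>The constructions use only the colours 1, ..., e(H). A rainbow copy inside them would
  show each of these exactly once, and this tightness is what makes freeness provable, whatever t
  is; a new edge in a colour above e(H) clashes with nothing. A new edge of colour i \<le> e(H) has
  to be completed without i. Hence the gadget graphs contain gadgets for every i, at the price of a
  constant factor; in the Hamming graph, the edge of colour i at the given vertex is made to fall on
  the missing pair of the clique. The step from n to n log n comes from the two roles. If x and y
  have a common neighbour a, a vertex cannot take both roles in one gadget, as its edge to a would
  have to represent both xa and ya. With one role per gadget, the gadgets must separate all pairs of
  vertices, and n vertices are separated by about log n two-valued functions. In the lower bound, a
  vertex of degree d survives a random choice of colours with probability t^(-d); if most degrees
  are below a small multiple of log n, the survivors are too many for a clique, whose size is at
  most about the square root of twice the number of edges.\<close>

lemma simple_graph_edgeE: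
  assumes "simple_graph G" "e \<in> edges G"
  obtains a b where "e = {a, b}" "a \<noteq> b" "a \<in> verts G" "b \<in> verts G"
proof -
  have "e \<subseteq> verts G" "card e = 2" using assms unfolding simple_graph_def nsets_def by auto
  then show thesis using that by (auto simp: card_2_iff)
qed

lemma simple_graph_edgeD:
  assumes "simple_graph G" "{a, b} \<in> edges G"
  shows "a \<noteq> b" "a \<in> verts G" "b \<in> verts G"
  using assms unfolding simple_graph_def nsets_def by auto

lemma simple_graph_finite_edges: "simple_graph G \<Longrightarrow> finite (edges G)"
  unfolding simple_graph_def by (meson finite_imp_finite_nsets finite_subset)

lemma simple_graph_edge_eq:
  assumes "simple_graph G" "e \<in> edges G" "a \<in> e" "b \<in> e" "a \<noteq> b"
  shows "e = {a, b}"
proof -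
  obtain p q where "e = {p, q}" by (rule simple_graph_edgeE[OF assms(1,2)])
  then show ?thesis using assms(3-5) by auto
qed

lemma in_nsets_2_iff: "{a, b} \<in> nsets V 2 \<longleftrightarrow> a \<noteq> b \<and> a \<in> V \<and> b \<in> V"
  by (auto simp: nsets_def card_2_iff)

lemma nsets_2E:
  assumes "e \<in> nsets V 2"
  obtains a b where "e = {a, b}" "a \<noteq> b" "a \<in> V" "b \<in> V"
  using assms by (auto simp: nsets_def card_2_iff)

text \<open>Copies as maps out of \<open>H\<close> rather than subgraphs of \<open>G\<close>: moving
  a vertex of a copy becomes a function update. Non-edges of \<open>H\<close> are unconstrained,
  since copies need not be induced.\<close>

definition rainbow_emb :: "'b graph \<Rightarrow> 'a graph \<Rightarrow> ('a set \<Rightarrow> nat) \<Rightarrow> ('b \<Rightarrow> 'a) \<Rightarrow> bool" where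
  "rainbow_emb H G c \<psi> \<longleftrightarrow> inj_on \<psi> (verts H) \<and> \<psi> ` verts H \<subseteq> verts G \<and>
     (\<forall>e\<in>edges H. \<psi> ` e \<in> edges G) \<and> inj_on (\<lambda>e. c (\<psi> ` e)) (edges H)"

lemma inj_on_image_edges:
  assumes "simple_graph H" "inj_on \<psi> (verts H)"
  shows "inj_on ((`) \<psi>) (edges H)"
proof (rule inj_onI)
  fix e e' assume "e \<in> edges H" "e' \<in> edges H" "\<psi> ` e = \<psi> ` e'"
  moreover have "e \<subseteq> verts H" "e' \<subseteq> verts H"
    using calculation assms(1) unfolding simple_graph_def nsets_def by auto
  ultimately show "e = e'" using inj_on_image_eq_iff[OF assms(2)] by metis
qed

text \<open>The subgraph belonging to \<open>\<psi>\<close> has only the images of edges of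
  \<open>H\<close> as edges. So the equivalence demanded by \<open>isomorphic\<close> holds although
  \<open>\<psi>\<close> may map non-edges of \<open>H\<close> to edges of \<open>G\<close>.\<close>

lemma has_rainbow_copy_iff:
  assumes H: "simple_graph H"
  shows "has_rainbow_copy H G c \<longleftrightarrow> (\<exists>\<psi>. rainbow_emb H G c \<psi>)"
proof
  assume "has_rainbow_copy H G c"
  then obtain F f where F: "subgraph F G" "inj_on c (edges F)" and f: "bij_betw f (verts F) (verts H)"
    and e: "\<forall>u\<in>verts F. \<forall>v\<in>verts F. {u, v} \<in> edges F \<longleftrightarrow> {f u, f v} \<in> edges H"
    unfolding has_rainbow_copy_def isomorphic_def by blast
  define \<psi> where "\<psi> = inv_into (verts F) f"
  have psi: "bij_betw \<psi> (verts H) (verts F)" unfolding \<psi>_def using f by (rule bij_betw_inv_into)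
  have E: "\<psi> ` x \<in> edges F" if x: "x \<in> edges H" for x
  proof -
    obtain a b where ab: "x = {a, b}" "a \<in> verts H" "b \<in> verts H"
      using simple_graph_edgeE[OF H x] by metis
    have "f (\<psi> a) = a" "f (\<psi> b) = b" "\<psi> a \<in> verts F" "\<psi> b \<in> verts F"
      using ab f psi unfolding \<psi>_def by (auto simp: bij_betw_inv_into_right bij_betwE)
    then show ?thesis using e ab x by auto
  qed
  have inj: "inj_on \<psi> (verts H)" using psi by (rule bij_betw_imp_inj_on)
  have "inj_on (\<lambda>e. c (\<psi> ` e)) (edges H)"
    using inj_on_image_edges[OF H inj] E F(2) by (auto simp: inj_on_def)
  then have "rainbow_emb H G c \<psi>"
    unfolding rainbow_emb_def using inj psi E F(1) unfolding subgraph_def bij_betw_def by blast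
  then show "\<exists>\<psi>. rainbow_emb H G c \<psi>" by blast
next
  assume "\<exists>\<psi>. rainbow_emb H G c \<psi>"
  then obtain \<psi> where p: "inj_on \<psi> (verts H)" "\<psi> ` verts H \<subseteq> verts G"
     "\<forall>e\<in>edges H. \<psi> ` e \<in> edges G" "inj_on (\<lambda>e. c (\<psi> ` e)) (edges H)"
    unfolding rainbow_emb_def by blast
  define F where "F = (\<psi> ` verts H, (`) \<psi> ` edges H)"
  have 1: "\<psi> ` e \<in> nsets (\<psi> ` verts H) 2" if e: "e \<in> edges H" for e
  proof -
    obtain a b where "e = {a, b}" "a \<noteq> b" "a \<in> verts H" "b \<in> verts H"
      using simple_graph_edgeE[OF H e] by metis
    then show ?thesis using p(1) by (simp add: in_nsets_2_iff inj_on_eq_iff)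
  qed
  have "simple_graph F" unfolding simple_graph_def F_def using H 1 by (auto simp: simple_graph_def)
  then have sub: "subgraph F G" unfolding subgraph_def F_def using p by auto
  define f where "f = inv_into (verts H) \<psi>"
  have "bij_betw f (verts F) (verts H)" unfolding f_def F_def
    using p(1) by (simp add: bij_betw_inv_into inj_on_imp_bij_betw)
  moreover have "{u, v} \<in> edges F \<longleftrightarrow> {f u, f v} \<in> edges H" if uv: "u \<in> verts F" "v \<in> verts F" for u v
  proof -
    obtain a b where ab: "u = \<psi> a" "v = \<psi> b" "a \<in> verts H" "b \<in> verts H" using uv unfolding F_def by auto
    have f: "f u = a" "f v = b" using ab p(1) unfolding f_def by simp_all
    have "e = {a, b}" if "e \<in> edges H" "\<psi> ` e = \<psi> ` {a, b}" for e
    proof -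
      have "e \<subseteq> verts H" "{a, b} \<subseteq> verts H" using that ab H unfolding simple_graph_def nsets_def by auto
      then show ?thesis using that inj_on_image_eq_iff[OF p(1)] by blast
    qed
    then have "\<psi> ` {a, b} \<in> edges F \<longleftrightarrow> {a, b} \<in> edges H"
      unfolding F_def snd_conv by blast
    moreover have "{u, v} = \<psi> ` {a, b}" using ab by simp
    ultimately have "{u, v} \<in> edges F \<longleftrightarrow> {a, b} \<in> edges H" by simp
    then show ?thesis using f by simp
  qed
  ultimately have "isomorphic F H" unfolding isomorphic_def by blast
  moreover have "inj_on c (edges F)" unfolding F_def using p(4) by (auto simp: inj_on_def)
  ultimately show "has_rainbow_copy H G c" using sub unfolding has_rainbow_copy_def by blast
qed

lemma rainbow_emb_subgraph:
  assumes "rainbow_emb H (V, E) c \<psi>" "E \<subseteq> E'" "\<And>e. e \<in> E \<Longrightarrow> c' e = c e"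
  shows "rainbow_emb H (V, E') c' \<psi>"
  using assms unfolding rainbow_emb_def inj_on_def by auto

text \<open>A copy avoiding the new edge would already be a copy in the old graph. Only one edge of
  \<open>H\<close> maps to the new edge, because \<open>\<psi>\<close> is injective on
  edges.\<close>

lemma saturated_addE:
  assumes H: "simple_graph H" and G: "rainbow_saturated t H (V, E) c"
    and e: "e \<in> nsets V 2" "e \<notin> E" and i: "i \<in> {1..t}"
  obtains \<psi> e0 where "rainbow_emb H (V, insert e E) (c(e := i)) \<psi>" "e0 \<in> edges H" "\<psi> ` e0 = e"
    "\<And>e'. e' \<in> edges H \<Longrightarrow> e' \<noteq> e0 \<Longrightarrow> \<psi> ` e' \<in> E"
proof -
  have "has_rainbow_copy H (V, insert e E) (c(e := i))"
    using G e i unfolding rainbow_saturated_def by auto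
  then obtain \<psi> where p: "rainbow_emb H (V, insert e E) (c(e := i)) \<psi>"
    using has_rainbow_copy_iff[OF H] by blast
  have no: "\<not> rainbow_emb H (V, E) c \<psi>"
    using G has_rainbow_copy_iff[OF H] unfolding rainbow_saturated_def by blast
  have "\<exists>e0\<in>edges H. \<psi> ` e0 = e"
  proof (rule ccontr)
    assume "\<not> ?thesis"
    then have "rainbow_emb H (V, E) c \<psi>" using p unfolding rainbow_emb_def
      by (auto simp: inj_on_def)
    with no show False by blast
  qed
  then obtain e0 where e0: "e0 \<in> edges H" "\<psi> ` e0 = e" by blast
  show thesis
  proof (rule that[OF p e0])
    fix e' assume e': "e' \<in> edges H" "e' \<noteq> e0"
    have inj: "inj_on ((`) \<psi>) (edges H)" using p H unfolding rainbow_emb_def by (blast intro: inj_on_image_edges)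
    have "\<psi> ` e' \<noteq> e" using inj e' e0 by (metis inj_onD)
    then show "\<psi> ` e' \<in> E" using p e' unfolding rainbow_emb_def by auto
  qed
qed

lemma rainbow_satE:
  assumes "simple_graph H" "edges H \<noteq> {}"
  obtains E c where "rainbow_saturated t H ({..<n}, E :: nat set set) c" "card E = rainbow_sat t n H"
proof -
  obtain G :: "nat graph" and c where G: "verts G = {..<n}" "rainbow_saturated t H G c"
    using rainbow_saturated_exists[OF assms] by blast
  have "\<exists>(G :: nat graph) c. verts G = {..<n} \<and> rainbow_saturated t H G c \<and> card (edges G) = rainbow_sat t n H"
    unfolding rainbow_sat_def by (rule LeastI_ex) (use G in blast)
  then obtain G' :: "nat graph" and c' where "verts G' = {..<n}" "rainbow_saturated t H G' c'"
     "card (edges G') = rainbow_sat t n H" by blast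
  then show thesis using that[of "edges G'" c'] by (metis prod.collapse)
qed

text \<open>A colour-preserving extension of \<open>E0\<close> with as many edges as possible is saturated, and it
  can only contain pairs from \<open>S\<close>.\<close>
lemma rainbow_sat_le:
  fixes E0 :: "nat set set"
  assumes H: "simple_graph H"
    and S: "S \<subseteq> nsets {..<n} 2" "E0 \<subseteq> S"
    and c: "\<And>e. e \<in> E0 \<Longrightarrow> c e \<in> {1..t}"
    and free: "\<nexists>\<psi>. rainbow_emb H ({..<n}, E0) c \<psi>"
    and sat: "\<And>e i. e \<in> nsets {..<n} 2 \<Longrightarrow> e \<notin> S \<Longrightarrow> i \<in> {1..t} \<Longrightarrow>
       \<exists>\<psi>. rainbow_emb H ({..<n}, insert e E0) (c(e := i)) \<psi>"
  shows "rainbow_sat t n H \<le> card S"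
proof -
  define Q where "Q = (\<lambda>E d. E0 \<subseteq> E \<and> E \<subseteq> nsets {..<n} 2 \<and> (\<forall>e\<in>E0. d e = c e) \<and>
    (\<forall>e\<in>E. d e \<in> {1..t}) \<and> (\<nexists>\<psi>. rainbow_emb H ({..<n}, E) d \<psi>))"
  define P where "P = (\<lambda>m. \<exists>E d. Q E d \<and> card E = m)"
  have fin: "finite (nsets {..<n} 2)" by (simp add: finite_imp_finite_nsets)
  have "Q E0 c" unfolding Q_def using assms by auto
  then have P0: "P (card E0)" unfolding P_def by blast
  have bound: "m \<le> card (nsets {..<n} 2)" if "P m" for m
    using that card_mono[OF fin] unfolding P_def Q_def by blast
  obtain m where m: "P m" "\<And>k. P k \<Longrightarrow> k \<le> m"
    using Nat.ex_has_greatest_nat[of P "card E0" "card (nsets {..<n} 2)"] P0 bound by blast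
  then obtain E d where Q: "Q E d" "card E = m" unfolding P_def by blast
  have finE: "finite E" using Q fin unfolding Q_def by (metis finite_subset)
  have "\<exists>\<psi>. rainbow_emb H ({..<n}, insert e E) (d(e := i)) \<psi>"
    if "e \<in> nsets {..<n} 2" "e \<notin> E" "i \<in> {1..t}" for e i
  proof (rule ccontr)
    assume *: "\<not> ?thesis"
    then have "Q (insert e E) (d(e := i))" using Q that unfolding Q_def by auto
    then have "P (card (insert e E))" unfolding P_def by blast
    then show False using m(2) that finE Q(2) by fastforce
  qed
  then have "rainbow_saturated t H ({..<n}, E) d"
    using Q unfolding rainbow_saturated_def Q_def edge_coloured_def simple_graph_def has_rainbow_copy_iff[OF H]
    by auto
  then have "rainbow_sat t n H \<le> card E" unfolding rainbow_sat_def
    by (intro Least_le exI[of _ "({..<n}, E)"] exI[of _ d]) auto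
  also have "E \<subseteq> S"
  proof
    fix e assume e: "e \<in> E"
    show "e \<in> S"
    proof (rule ccontr)
      assume "e \<notin> S"
      moreover have "e \<in> nsets {..<n} 2" "d e \<in> {1..t}" using e Q unfolding Q_def by auto
      \<comment> \<open>With the colour \<open>d e\<close> that it already has, \<open>e\<close>
        completes a rainbow copy with \<open>E0\<close>, and this copy lies inside
        \<open>E\<close>.\<close>
      ultimately obtain \<psi> where "rainbow_emb H ({..<n}, insert e E0) (c(e := d e)) \<psi>" using sat by blast
      then have "rainbow_emb H ({..<n}, E) d \<psi>"
        by (rule rainbow_emb_subgraph) (use e Q in \<open>auto simp: Q_def\<close>)
      then show False using Q unfolding Q_def by blast
    qed
  qed
  then have "card E \<le> card S" using S fin by (meson card_mono finite_subset)
  finally show ?thesis .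
qed

lemma connected_graph_neighbour:
  assumes H: "simple_graph H" "connected_graph H" and S: "S \<subseteq> verts H" "S \<noteq> {}" "S \<noteq> verts H"
  obtains a d where "a \<in> S" "d \<in> verts H - S" "{a, d} \<in> edges H"
proof -
  obtain u v where uv: "u \<in> S" "v \<in> verts H" "v \<notin> S" using S by blast
  have "(u, v) \<in> {(x, y). {x, y} \<in> edges H}\<^sup>*" using H(2) uv S unfolding connected_graph_def by blast
  then have "v \<notin> S \<longrightarrow> (\<exists>a d. a \<in> S \<and> d \<notin> S \<and> {a, d} \<in> edges H)"
    by (induction rule: rtrancl_induct) (use uv in blast)+
  then show thesis using uv that simple_graph_edgeD[OF H(1)] by blast
qed

lemma connected_graph_edge_ex:
  assumes H: "simple_graph H" "connected_graph H" "card (verts H) \<ge> 2" and a: "a \<in> verts H"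
  obtains d where "{a, d} \<in> edges H"
proof -
  have "{a} \<noteq> verts H" using H(3) by (metis One_nat_def card.empty card.insert empty_iff finite.emptyI not_less_eq_eq numeral_2_eq_2 order_refl)
  then show thesis using connected_graph_neighbour[OF H(1,2), of "{a}"] a that by blast
qed

lemma in_triangle_iff:
  assumes H: "simple_graph H" and ab: "a \<noteq> b"
  shows "in_triangle H {a, b} \<longleftrightarrow> (\<exists>d. {a, b} \<in> edges H \<and> {a, d} \<in> edges H \<and> {b, d} \<in> edges H)"
proof
  assume "in_triangle H {a, b}"
  then obtain T where T: "T \<in> nsets (verts H) 3" "nsets T 2 \<subseteq> edges H" "{a, b} \<in> nsets T 2"
    unfolding in_triangle_def by blast
  have ab': "a \<in> T" "b \<in> T" using T(3) by (auto simp: in_nsets_2_iff)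
  have "card (T - {a, b}) = 1" using T(1) ab ab' by (auto simp: nsets_def card_Diff_subset)
  then obtain d where "T - {a, b} = {d}" by (auto simp: card_1_singleton_iff)
  then have "d \<in> T" "d \<noteq> a" "d \<noteq> b" by auto
  then show "\<exists>d. {a, b} \<in> edges H \<and> {a, d} \<in> edges H \<and> {b, d} \<in> edges H" using T(2) ab ab'
    by (metis in_nsets_2_iff subsetD)
next
  assume "\<exists>d. {a, b} \<in> edges H \<and> {a, d} \<in> edges H \<and> {b, d} \<in> edges H"
  then obtain d where d: "{a, b} \<in> edges H" "{a, d} \<in> edges H" "{b, d} \<in> edges H" by blast
  note D = simple_graph_edgeD[OF H d(1)] simple_graph_edgeD[OF H d(2)] simple_graph_edgeD[OF H d(3)]
  have "{a, b, d} \<in> nsets (verts H) 3" using D by (auto simp: nsets_def)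
  moreover have "nsets {a, b, d} 2 \<subseteq> edges H" using d
    by (auto elim!: nsets_2E simp: insert_commute)
  moreover have "{a, b} \<in> nsets {a, b, d} 2" using ab by (auto simp: in_nsets_2_iff)
  ultimately show "in_triangle H {a, b}" unfolding in_triangle_def by blast
qed

text \<open>All edges at \<open>x\<close> are among the pairs of \<open>x\<close> with another
  vertex, and the degree of \<open>x\<close> is the number of these pairs.\<close>

lemma conical_adjacent:
  assumes H: "simple_graph H" and x: "conical H x" and a: "a \<in> verts H" "a \<noteq> x"
  shows "{x, a} \<in> edges H"
proof -
  let ?A = "(\<lambda>b. {x, b}) ` (verts H - {x})"
  have fin: "finite (verts H)" using H unfolding simple_graph_def by blast
  have inj: "inj_on (\<lambda>b. {x, b}) (verts H - {x})" by (auto simp: inj_on_def doubleton_eq_iff)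
  have "{e \<in> edges H. x \<in> e} \<subseteq> ?A" by (auto elim!: simple_graph_edgeE[OF H])
  moreover have "card {e \<in> edges H. x \<in> e} = card ?A"
    using x fin inj unfolding conical_def degree_def by (simp add: card_image)
  ultimately have "{e \<in> edges H. x \<in> e} = ?A" using fin by (intro card_subset_eq) auto
  then show ?thesis using a by blast
qed

section \<open>Lower bounds\<close>

text \<open>The new edge \<open>uv\<close> is the image of an edge of \<open>H\<close>. As
  \<open>H\<close> is connected and has a third vertex, an endpoint of that edge lies on a further
  edge, whose image is an old edge at \<open>u\<close> or \<open>v\<close>.\<close>

lemma saturated_not_both_isolated:
  assumes H: "simple_graph H" "connected_graph H" "card (verts H) \<ge> 3"
    and G: "rainbow_saturated t H (V, E) c" and t: "t \<ge> 1"
    and uv: "u \<in> V" "v \<in> V" "u \<noteq> v"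
  shows "\<exists>w. {u, w} \<in> E \<or> {v, w} \<in> E"
proof (cases "{u, v} \<in> E")
  case False
  have "{u, v} \<in> nsets V 2" using uv by (simp add: in_nsets_2_iff)
  then obtain \<psi> e0 where p: "rainbow_emb H (V, insert {u, v} E) (c({u, v} := t)) \<psi>"
    "e0 \<in> edges H" "\<psi> ` e0 = {u, v}" "\<And>e'. e' \<in> edges H \<Longrightarrow> e' \<noteq> e0 \<Longrightarrow> \<psi> ` e' \<in> E"
    using saturated_addE[OF H(1) G _ False, of t] t by (metis atLeastAtMost_iff order_refl)
  obtain a b where ab: "e0 = {a, b}" "a \<noteq> b" "a \<in> verts H" "b \<in> verts H"
    using simple_graph_edgeE[OF H(1) p(2)] by metis
  have "card {a, b} < card (verts H)" using H(3) ab(2) by simp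
  then have "{a, b} \<noteq> verts H" by auto
  then obtain a' d where d: "a' \<in> {a, b}" "d \<in> verts H - {a, b}" "{a', d} \<in> edges H"
    using connected_graph_neighbour[OF H(1,2), of "{a, b}"] ab by auto
  then have "\<psi> ` {a', d} \<in> E" using p(4)[of "{a', d}"] ab by auto
  moreover have "\<psi> a' \<in> {u, v}" using d(1) p(3) ab by auto
  ultimately show ?thesis by auto
qed blast

text \<open>The witness is the image of the third vertex of the triangle; its edges to
  \<open>u\<close> and \<open>v\<close> are old and keep their colours under
  \<open>c\<close>.\<close>

lemma triangle_edge_rainbow_path:
  assumes H: "simple_graph H" and p: "rainbow_emb H (V, insert {u, v} E) (c({u, v} := i)) \<psi>"
    and e0: "e0 \<in> edges H" "\<psi> ` e0 = {u, v}" "\<And>e'. e' \<in> edges H \<Longrightarrow> e' \<noteq> e0 \<Longrightarrow> \<psi> ` e' \<in> E"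
    and uv: "{u, v} \<notin> E" and tri: "in_triangle H e0"
  shows "\<exists>w. {u, w} \<in> E \<and> {v, w} \<in> E \<and> c {u, w} \<noteq> c {v, w}"
proof -
  obtain a b where ab: "e0 = {a, b}" "a \<noteq> b" using simple_graph_edgeE[OF H e0(1)] by metis
  then obtain d where d: "{a, d} \<in> edges H" "{b, d} \<in> edges H" using tri in_triangle_iff[OF H] by blast
  have ne: "{a, d} \<noteq> e0" "{b, d} \<noteq> e0" "{a, d} \<noteq> {b, d}"
    using ab simple_graph_edgeD[OF H d(1)] simple_graph_edgeD[OF H d(2)] by (auto simp: doubleton_eq_iff)
  have E: "{\<psi> a, \<psi> d} \<in> E" "{\<psi> b, \<psi> d} \<in> E" using e0(3)[OF d(1) ne(1)] e0(3)[OF d(2) ne(2)] by auto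
  have "(c({u, v} := i)) (\<psi> ` {a, d}) \<noteq> (c({u, v} := i)) (\<psi> ` {b, d})"
    using p d ne(3) unfolding rainbow_emb_def by (metis (mono_tags, lifting) inj_onD)
  moreover have "{\<psi> a, \<psi> d} \<noteq> {u, v}" "{\<psi> b, \<psi> d} \<noteq> {u, v}" using E uv by metis+
  ultimately have "c {\<psi> a, \<psi> d} \<noteq> c {\<psi> b, \<psi> d}" by simp
  moreover have "u = \<psi> a \<and> v = \<psi> b \<or> u = \<psi> b \<and> v = \<psi> a"
    using e0(2) ab by (auto simp: doubleton_eq_iff)
  ultimately show ?thesis using E by metis
qed

text \<open>A pendant edge at the conical vertex, embedded as the new edge, can be moved to an old edge
  of the same colour.\<close>
lemma conical_pendant_swap:
  assumes H: "simple_graph H" and x: "conical H x" and xb: "{x, b} \<in> edges H" "\<not> in_triangle H {x, b}"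
    and G: "simple_graph (V, E)"
    and p: "rainbow_emb H (V, insert {u, v} E) (c({u, v} := i)) \<psi>" "\<psi> x = u" "\<psi> b = v"
    and old: "\<And>e'. e' \<in> edges H \<Longrightarrow> e' \<noteq> {x, b} \<Longrightarrow> \<psi> ` e' \<in> E"
    and uv: "{u, v} \<notin> E" and z: "{u, z} \<in> E" "c {u, z} = i"
  shows "\<exists>\<psi>'. rainbow_emb H (V, E) c \<psi>'"
proof -
  define d where "d = c({u, v} := i)"
  have inj: "inj_on \<psi> (verts H)" and rb: "inj_on (\<lambda>e. d (\<psi> ` e)) (edges H)"
    using p(1) unfolding rainbow_emb_def d_def by auto
  have xb': "x \<noteq> b" "x \<in> verts H" "b \<in> verts H" using simple_graph_edgeD[OF H xb(1)] by auto
  \<comment> \<open>A second neighbour of \<open>b\<close> would be adjacent to the conical vertex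
    \<open>x\<close> and put \<open>xb\<close> into a triangle.\<close>
  have leaf: "e = {x, b}" if e: "e \<in> edges H" "b \<in> e" for e
  proof (rule ccontr)
    assume ne: "e \<noteq> {x, b}"
    obtain y where y: "e = {b, y}" "y \<noteq> b" "y \<in> verts H"
      using simple_graph_edgeE[OF H e(1)] e(2) by (metis insertE insert_commute singletonD)
    then have "y \<noteq> x" using ne by auto
    then have "{x, y} \<in> edges H" using conical_adjacent[OF H x] y by blast
    then show False using xb e y in_triangle_iff[OF H xb'(1)] by blast
  qed
  have uz: "u \<noteq> z" "z \<in> V" using simple_graph_edgeD[OF G] z by auto
  have zv: "z \<noteq> v" using uv z by auto
  \<comment> \<open>If \<open>z\<close> were the image of \<open>y\<close>, the edge
    \<open>xy\<close> of \<open>H\<close> would get the colour \<open>i\<close>, which the copy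
    already uses on the new edge.\<close>
  have zn: "z \<notin> \<psi> ` verts H"
  proof
    assume "z \<in> \<psi> ` verts H"
    then obtain y where y: "y \<in> verts H" "z = \<psi> y" by blast
    have "y \<noteq> x" "y \<noteq> b" using y uz zv p by auto
    then have xy: "{x, y} \<in> edges H" using conical_adjacent[OF H x] y by blast
    have "d (\<psi> ` {x, y}) = d (\<psi> ` {x, b})" using p y z uv unfolding d_def by auto
    then have "{x, y} = {x, b}" using rb xy xb(1) by (metis (mono_tags, lifting) inj_onD)
    then show False using \<open>y \<noteq> b\<close> \<open>y \<noteq> x\<close> by (auto simp: doubleton_eq_iff)
  qed
  define \<psi>' where "\<psi>' = \<psi>(b := z)"
  have img: "\<psi>' ` e \<in> E \<and> c (\<psi>' ` e) = d (\<psi> ` e)" if e: "e \<in> edges H" for e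
  proof (cases "e = {x, b}")
    case True
    then have "\<psi>' ` e = {u, z}" "\<psi> ` e = {u, v}" using xb' p unfolding \<psi>'_def by auto
    then show ?thesis using z unfolding d_def by simp
  next
    case False
    then have "b \<notin> e" using leaf e by blast
    then have "\<psi>' ` e = \<psi> ` e" unfolding \<psi>'_def by (intro image_cong) auto
    moreover have "\<psi> ` e \<in> E" using old e False by blast
    ultimately show ?thesis using uv unfolding d_def by auto
  qed
  have "inj_on \<psi>' (verts H)" using inj zn unfolding \<psi>'_def inj_on_def by auto
  moreover have "\<psi>' ` verts H \<subseteq> V" using p(1) uz unfolding \<psi>'_def rainbow_emb_def by auto
  moreover have "inj_on (\<lambda>e. c (\<psi>' ` e)) (edges H)" using rb img by (auto simp: inj_on_def)
  ultimately have "rainbow_emb H (V, E) c \<psi>'" using img unfolding rainbow_emb_def by auto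
  then show ?thesis by blast
qed

text \<open>An edge of \<open>H\<close> in no triangle contains \<open>x\<close>, as otherwise
  \<open>x\<close> would form a triangle with it. If such an edge became the new edge, the swap at
  \<open>u\<close> or \<open>v\<close>, whichever is the image of \<open>x\<close>, would give a
  rainbow copy among the old edges. The first conjunct is what fails for stars.\<close>

lemma conical_common_colour:
  assumes H: "simple_graph H" and x: "conical H x"
    and G: "rainbow_saturated t H (V, E) c"
    and uv: "u \<in> V" "v \<in> V" "u \<noteq> v" "{u, v} \<notin> E"
    and z: "{u, z1} \<in> E" "{v, z2} \<in> E" "c {u, z1} = i" "c {v, z2} = i"
  shows "(\<exists>e\<in>edges H. in_triangle H e) \<and> (\<exists>w. {u, w} \<in> E \<and> {v, w} \<in> E \<and> c {u, w} \<noteq> c {v, w})"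
proof -
  have i: "i \<in> {1..t}" and sG: "simple_graph (V, E)"
    using G z unfolding rainbow_saturated_def edge_coloured_def by auto
  have no: "\<nexists>\<psi>. rainbow_emb H (V, E) c \<psi>"
    using G has_rainbow_copy_iff[OF H] unfolding rainbow_saturated_def by blast
  have "{u, v} \<in> nsets V 2" using uv by (simp add: in_nsets_2_iff)
  then obtain \<psi> e0 where p: "rainbow_emb H (V, insert {u, v} E) (c({u, v} := i)) \<psi>"
    "e0 \<in> edges H" "\<psi> ` e0 = {u, v}" "\<And>e'. e' \<in> edges H \<Longrightarrow> e' \<noteq> e0 \<Longrightarrow> \<psi> ` e' \<in> E"
    using saturated_addE[OF H G _ uv(4) i] by metis
  have "in_triangle H e0"
  proof (rule ccontr)
    assume nt: "\<not> in_triangle H e0"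
    obtain a b where ab: "e0 = {a, b}" "a \<noteq> b" "a \<in> verts H" "b \<in> verts H"
      using simple_graph_edgeE[OF H p(2)] by metis
    have "a = x \<or> b = x"
    proof (rule ccontr)
      assume "\<not> ?thesis"
      then have "{x, a} \<in> edges H" "{x, b} \<in> edges H" using conical_adjacent[OF H x] ab by auto
      then have "{a, b} \<in> edges H \<and> {a, x} \<in> edges H \<and> {b, x} \<in> edges H"
        using p(2) ab by (simp add: insert_commute)
      then show False using nt in_triangle_iff[OF H ab(2)] ab by blast
    qed
    then obtain b' where e0: "e0 = {x, b'}" using ab by auto
    have ps: "\<psi> x = u \<and> \<psi> b' = v \<or> \<psi> x = v \<and> \<psi> b' = u" using p(3) e0 by (auto simp: doubleton_eq_iff)
    then show False
    proof (elim disjE conjE)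
      assume "\<psi> x = u" "\<psi> b' = v"
      with conical_pendant_swap[OF H x _ _ sG p(1) _ _ _ uv(4) z(1,3)] p nt e0 no show False by auto
    next
      assume *: "\<psi> x = v" "\<psi> b' = u"
      have p': "rainbow_emb H (V, insert {v, u} E) (c({v, u} := i)) \<psi>" and vu: "{v, u} \<notin> E"
        using p(1) uv(4) by (simp_all add: insert_commute)
      show False using conical_pendant_swap[OF H x _ _ sG p' _ _ _ vu z(2,4)] p nt e0 no * by auto
    qed
  qed
  then show ?thesis using triangle_edge_rainbow_path[OF H p uv(4)] p(2) by blast
qed

lemma all_triangle_rainbow_path:
  assumes H: "simple_graph H" and tri: "\<forall>e\<in>edges H. in_triangle H e"
    and G: "rainbow_saturated t H (V, E) c" and t: "t \<ge> 1"
    and uv: "u \<in> V" "v \<in> V" "u \<noteq> v" "{u, v} \<notin> E"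
  shows "\<exists>w. {u, w} \<in> E \<and> {v, w} \<in> E \<and> c {u, w} \<noteq> c {v, w}"
proof -
  have "{u, v} \<in> nsets V 2" "t \<in> {1..t}" using uv t by (auto simp: in_nsets_2_iff)
  then obtain \<psi> e0 where "rainbow_emb H (V, insert {u, v} E) (c({u, v} := t)) \<psi>"
    "e0 \<in> edges H" "\<psi> ` e0 = {u, v}" "\<And>e'. e' \<in> edges H \<Longrightarrow> e' \<noteq> e0 \<Longrightarrow> \<psi> ` e' \<in> E"
    using saturated_addE[OF H G _ uv(4)] by metis
  then show ?thesis using triangle_edge_rainbow_path[OF H _ _ _ _ uv(4)] tri by blast
qed

section \<open>Counting edges when non-adjacent vertices are joined by rainbow paths of length
  two\<close>

lemma sum_neighbours_le:
  fixes V :: "'a set"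
  assumes "simple_graph (V, E)"
  shows "(\<Sum>v\<in>V. card {w\<in>V. {v, w} \<in> E}) \<le> 2 * card E"
proof -
  have fin: "finite V" "finite E" using assms simple_graph_finite_edges[OF assms] unfolding simple_graph_def by auto
  define D where "D = (\<lambda>e. {(v, w). {v, w} = (e :: 'a set)})"
  have two: "finite (D e) \<and> card (D e) \<le> 2" if e: "e \<in> E" for e
  proof -
    obtain a b where "e = {a, b}" using simple_graph_edgeE[OF assms, of e] e by (metis snd_conv)
    then have sub: "D e \<subseteq> {(a, b), (b, a)}" unfolding D_def by (auto simp: doubleton_eq_iff)
    have "card (set [(a, b), (b, a)]) \<le> length [(a, b), (b, a)]" by (rule card_length)
    then have "card {(a, b), (b, a)} \<le> 2" by (simp only: list.set list.size One_nat_def numeral_2_eq_2 add_0 add_Suc_right)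
    then show ?thesis using card_mono[OF _ sub] finite_subset[OF sub] le_trans by blast
  qed
  have "(\<Sum>v\<in>V. card {w\<in>V. {v, w} \<in> E}) = card (SIGMA v:V. {w\<in>V. {v, w} \<in> E})"
    using fin by simp
  also have "\<dots> \<le> card (\<Union>e\<in>E. D e)"
    using fin two by (intro card_mono) (auto simp: D_def)
  also have "\<dots> \<le> (\<Sum>e\<in>E. card (D e))" using fin by (intro card_UN_le)
  also have "\<dots> \<le> 2 * card E" using sum_mono[of E "\<lambda>e. card (D e)" "\<lambda>_. 2"] two by simp
  finally show ?thesis .
qed

text \<open>For q = card Q \<ge> 1, (q - 1)^2 \<le> q (q - 1), which is at most twice the number of
  edges.\<close>

lemma clique_size_bound:
  assumes "finite E" "nsets Q 2 \<subseteq> E" "finite Q"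
  shows "real (card Q) \<le> 1 + sqrt (2 * real (card E))"
proof (cases "card Q = 0")
  case False
  have "card Q choose 2 \<le> card E" using assms card_mono[of E "nsets Q 2"] by simp
  then have "card Q * (card Q - 1) div 2 \<le> card E" unfolding choose_two .
  moreover obtain k where "card Q * (card Q - 1) = 2 * k" using evenE[of "card Q * (card Q - 1)"] by auto
  ultimately have "card Q * (card Q - 1) \<le> 2 * card E" by simp
  then have "real (card Q * (card Q - 1)) \<le> 2 * real (card E)" by linarith
  then have "real (card Q) * (real (card Q) - 1) \<le> 2 * real (card E)"
    by (cases "card Q") (auto simp: algebra_simps)
  then have "(real (card Q) - 1)\<^sup>2 \<le> 2 * real (card E)"
    using False by (cases "card Q") (auto simp: power2_eq_square algebra_simps)
  then have "real (card Q) - 1 \<le> sqrt (2 * real (card E))" by (rule real_le_rsqrt)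
  then show ?thesis by simp
qed (simp add: add_nonneg_nonneg)

text \<open>Give every vertex \<open>w\<close> a colour \<open>\<phi> w\<close> and keep those \<open>v \<in> W\<close> all of whose edges \<open>vw\<close> have
  colour \<open>\<phi> w\<close>. The kept vertices form a clique; now average over all \<open>\<phi>\<close>.\<close>
lemma rainbow_path_clique:
  assumes G: "simple_graph (V, E)" and c: "\<And>e. e \<in> E \<Longrightarrow> c e \<in> {1..t}" and W: "W \<subseteq> V"
    and path: "\<And>u v. u \<in> W \<Longrightarrow> v \<in> W \<Longrightarrow> u \<noteq> v \<Longrightarrow> {u, v} \<notin> E \<Longrightarrow>
       \<exists>w. {u, w} \<in> E \<and> {v, w} \<in> E \<and> c {u, w} \<noteq> c {v, w}"
    and s: "\<And>Q. Q \<subseteq> W \<Longrightarrow> nsets Q 2 \<subseteq> E \<Longrightarrow> card Q \<le> s"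
  shows "(\<Sum>v\<in>W. t ^ (card V - card {w\<in>V. {v, w} \<in> E})) \<le> t ^ card V * s"
proof -
  have finV: "finite V" using G unfolding simple_graph_def by simp
  have finW: "finite W" using W finV finite_subset by blast
  define \<Phi> where "\<Phi> = PiE V (\<lambda>_. {1..t})"
  define ok where "ok = (\<lambda>\<phi> v. \<forall>w\<in>V. {v, w} \<in> E \<longrightarrow> \<phi> w = c {v, w})"
  have fin: "finite \<Phi>" unfolding \<Phi>_def using finV by (intro finite_PiE) auto
  have surv: "card {v\<in>W. ok \<phi> v} \<le> s" for \<phi>
  proof (rule s)
    show "nsets {v\<in>W. ok \<phi> v} 2 \<subseteq> E"
    proof
      fix e assume "e \<in> nsets {v\<in>W. ok \<phi> v} 2"
      then obtain u v where uv: "e = {u, v}" "u \<noteq> v" "u \<in> W" "v \<in> W" "ok \<phi> u" "ok \<phi> v"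
        by (auto elim!: nsets_2E)
      show "e \<in> E"
      proof (rule ccontr)
        assume "e \<notin> E"
        \<comment> \<open>The middle vertex of a rainbow path from \<open>u\<close> to
          \<open>v\<close> would need two different values of \<open>\<phi>\<close>.\<close>
        then obtain w where w: "{u, w} \<in> E" "{v, w} \<in> E" "c {u, w} \<noteq> c {v, w}"
          using path uv by metis
        have "w \<in> V" using simple_graph_edgeD[OF G] w by auto
        then show False using uv w unfolding ok_def by metis
      qed
    qed
  qed auto
  have cnt: "card {\<phi>\<in>\<Phi>. ok \<phi> v} = t ^ (card V - card {w\<in>V. {v, w} \<in> E})" if v: "v \<in> W" for v
  proof -
    define B where "B = (\<lambda>w. if {v, w} \<in> E then {c {v, w}} else {1..t})"
    have sub: "B w \<subseteq> {1..t}" for w unfolding B_def using c by simp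
    have "{\<phi>\<in>\<Phi>. ok \<phi> v} = PiE V B"
    proof (intro set_eqI iffI)
      fix \<phi> assume "\<phi> \<in> {\<phi>\<in>\<Phi>. ok \<phi> v}"
      then show "\<phi> \<in> PiE V B" unfolding \<Phi>_def ok_def B_def by (auto simp: PiE_iff)
    next
      fix \<phi> assume a: "\<phi> \<in> PiE V B"
      then have "\<phi> \<in> \<Phi>" unfolding \<Phi>_def PiE_iff using sub by blast
      moreover have "ok \<phi> v" unfolding ok_def
      proof (intro ballI impI)
        fix w assume w: "w \<in> V" "{v, w} \<in> E"
        have "\<phi> w \<in> B w" using a w by (auto simp: PiE_iff)
        then show "\<phi> w = c {v, w}" using w unfolding B_def by simp
      qed
      ultimately show "\<phi> \<in> {\<phi>\<in>\<Phi>. ok \<phi> v}" by blast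
    qed
    then have "card {\<phi>\<in>\<Phi>. ok \<phi> v} = (\<Prod>w\<in>V. card (B w))" using finV by (simp add: card_PiE)
    also have "\<dots> = (\<Prod>w\<in>V. if {v, w} \<in> E then 1 else t)" unfolding B_def by (intro prod.cong) auto
    also have "\<dots> = t ^ card (V - {w\<in>V. {v, w} \<in> E})"
      using finV by (subst prod.If_cases) (auto simp: set_diff_eq Int_def intro!: arg_cong[of _ _ "\<lambda>A. t ^ card A"])
    also have "card (V - {w\<in>V. {v, w} \<in> E}) = card V - card {w\<in>V. {v, w} \<in> E}"
      using finV by (intro card_Diff_subset) auto
    finally show ?thesis .
  qed
  have "(\<Sum>v\<in>W. t ^ (card V - card {w\<in>V. {v, w} \<in> E})) = (\<Sum>v\<in>W. card {\<phi>\<in>\<Phi>. ok \<phi> v})"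
    using cnt by simp
  also have "\<dots> = (\<Sum>v\<in>W. \<Sum>\<phi>\<in>\<Phi>. if ok \<phi> v then 1 else 0)" using fin by (simp add: sum.If_cases Int_def)
  also have "\<dots> = (\<Sum>\<phi>\<in>\<Phi>. \<Sum>v\<in>W. if ok \<phi> v then 1 else 0)" by (rule sum.swap)
  also have "\<dots> = (\<Sum>\<phi>\<in>\<Phi>. card {v\<in>W. ok \<phi> v})" using finW by (simp add: sum.If_cases Int_def)
  also have "\<dots> \<le> (\<Sum>\<phi>\<in>\<Phi>. s)" using surv by (intro sum_mono) auto
  also have "\<dots> = t ^ card V * s" unfolding \<Phi>_def using finV by (simp add: card_PiE)
  finally show ?thesis .
qed

text \<open>Under a random \<open>\<phi>\<close>, a vertex of degree d is kept with probability
  t^(-d), and at most 1 + sqrt (2 m) vertices are kept at once. The factor 1/2 and the exponent come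
  from restricting the expected number to vertices of low degree.\<close>

lemma rainbow_path_edge_bound:
  assumes G: "simple_graph (V, E)" and c: "\<And>e. e \<in> E \<Longrightarrow> c e \<in> {1..t}" and W: "W \<subseteq> V" "W \<noteq> {}"
    and path: "\<And>u v. u \<in> W \<Longrightarrow> v \<in> W \<Longrightarrow> u \<noteq> v \<Longrightarrow> {u, v} \<notin> E \<Longrightarrow>
       \<exists>w. {u, w} \<in> E \<and> {v, w} \<in> E \<and> c {u, w} \<noteq> c {v, w}"
    and t: "t \<ge> 1"
  shows "real (card W) / 2 \<le> (1 + sqrt (2 * real (card E))) * real t powr (4 * real (card E) / real (card W))"
proof -
  have finV: "finite V" using G unfolding simple_graph_def by simp
  have finE: "finite E" using simple_graph_finite_edges[OF G] by simp
  have finW: "finite W" using W finV finite_subset by blast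
  define d where "d = (\<lambda>v. card {w\<in>V. {v, w} \<in> E})"
  define \<omega> where "\<omega> = real (card W)"
  define m where "m = real (card E)"
  have w0: "\<omega> > 0" unfolding \<omega>_def using W finW by (simp add: card_gt_0_iff)
  define s where "s = nat \<lfloor>1 + sqrt (2 * m)\<rfloor>"
  have m0: "m \<ge> 0" unfolding m_def by simp
  have sle: "real s \<le> 1 + sqrt (2 * m)" unfolding s_def using m0 by simp
  have "(\<Sum>v\<in>W. t ^ (card V - d v)) \<le> t ^ card V * s"
    unfolding d_def
  proof (rule rainbow_path_clique[OF G c W(1) path])
    fix Q assume Q: "Q \<subseteq> W" "nsets Q 2 \<subseteq> E"
    have "real (card Q) \<le> 1 + sqrt (2 * m)" unfolding m_def
      by (rule clique_size_bound[OF finE Q(2)]) (use Q finW finite_subset in blast)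
    then show "card Q \<le> s" unfolding s_def by linarith
  qed auto
  then have "real (\<Sum>v\<in>W. t ^ (card V - d v)) \<le> real (t ^ card V * s)" by (rule of_nat_mono)
  then have main: "(\<Sum>v\<in>W. real t ^ (card V - d v)) \<le> real t ^ card V * real s" by simp
  \<comment> \<open>The threshold is twice the bound \<open>2 * m / \<omega>\<close> for the average
    degree in \<open>W\<close>, so by Markov's inequality \<open>L\<close> contains at least half of
    \<open>W\<close>.\<close>
  define L where "L = {v\<in>W. real (d v) \<le> 4 * m / \<omega>}"
  have LW: "L \<subseteq> W" and finL: "finite L" unfolding L_def using finW by auto
  have "(\<Sum>v\<in>W. d v) \<le> (\<Sum>v\<in>V. d v)" using W finV by (intro sum_mono2) auto
  also have "\<dots> \<le> 2 * card E" unfolding d_def by (rule sum_neighbours_le[OF G])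
  finally have hs: "(\<Sum>v\<in>W. real (d v)) \<le> 2 * m" unfolding m_def
    by (metis (mono_tags) of_nat_mono of_nat_mult of_nat_numeral of_nat_sum)
  have big: "real (card L) \<ge> \<omega> / 2"
  proof (cases "m = 0")
    case True
    then have "(\<Sum>v\<in>W. real (d v)) = 0" using hs sum_nonneg[of W "\<lambda>v. real (d v)"] by simp
    then have "L = W" using finW True unfolding L_def by (auto simp: sum_nonneg_eq_0_iff)
    then show ?thesis unfolding \<omega>_def by simp
  next
    case False
    have "real (card (W - L)) * (4 * m / \<omega>) = (\<Sum>v\<in>W - L. 4 * m / \<omega>)" by simp
    also have "\<dots> \<le> (\<Sum>v\<in>W - L. real (d v))" by (intro sum_mono) (auto simp: L_def)
    also have "\<dots> \<le> (\<Sum>v\<in>W. real (d v))" using finW by (intro sum_mono2) auto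
    finally have "real (card (W - L)) * (4 * m / \<omega>) \<le> 2 * m" using hs by simp
    then have "real (card (W - L)) \<le> \<omega> / 2" using False m0 w0 by (simp add: field_simps)
    moreover have "real (card (W - L)) = \<omega> - real (card L)"
      unfolding \<omega>_def using finL LW finW by (simp add: card_Diff_subset card_mono of_nat_diff)
    ultimately show ?thesis by simp
  qed
  have t0: "real t > 0" using t by simp
  have "real t ^ card V * real t powr (- (4 * m / \<omega>)) \<le> real t ^ (card V - d v)" if v: "v \<in> L" for v
  proof -
    have "d v \<le> card V" unfolding d_def using finV by (intro card_mono) auto
    then have "real t ^ (card V - d v) = real t powr (real (card V) - real (d v))"
      using t0 by (simp add: powr_realpow[symmetric] of_nat_diff)
    also have "\<dots> \<ge> real t powr (real (card V) - 4 * m / \<omega>)"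
      using v t unfolding L_def by (intro powr_mono) auto
    finally show ?thesis using t0 by (simp add: powr_diff powr_minus_divide powr_realpow)
  qed
  then have "real (card L) * (real t ^ card V * real t powr (- (4 * m / \<omega>))) \<le> (\<Sum>v\<in>L. real t ^ (card V - d v))"
    using sum_mono[of L "\<lambda>_. real t ^ card V * real t powr (- (4 * m / \<omega>))"] by simp
  also have "\<dots> \<le> (\<Sum>v\<in>W. real t ^ (card V - d v))" using LW finW by (intro sum_mono2) auto
  also note main
  finally have "real (card L) * real t powr (- (4 * m / \<omega>)) \<le> real s"
    using t0 by (simp add: mult.left_commute)
  then have "real (card L) \<le> real s * real t powr (4 * m / \<omega>)"
    using t0 by (simp add: powr_minus field_simps)
  also have "\<dots> \<le> (1 + sqrt (2 * m)) * real t powr (4 * m / \<omega>)"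
    using sle by (intro mult_right_mono) auto
  finally show ?thesis using big unfolding \<omega>_def m_def by linarith
qed

text \<open>Here \<open>\<omega>\<close> is the size of the vertex set to which the averaging is
  applied. If \<open>f n\<close> were below a small multiple of n log n, the right-hand side would
  be about sqrt (n log n) times a small power of n, less than the linear left-hand side.\<close>

lemma nlogn_lower_asymptotics:
  fixes f :: "nat \<Rightarrow> nat" and t :: real
  assumes t: "t \<ge> 2"
    and f: "\<And>n. n \<ge> 2 \<Longrightarrow> \<exists>\<omega>. \<omega> \<ge> (real n - 1) / t \<and>
      \<omega> / 2 \<le> (1 + sqrt (2 * real (f n))) * t powr (4 * real (f n) / \<omega>)"
  shows "(\<lambda>n. real (f n)) \<in> \<Omega>(\<lambda>n. real n * log 2 (real n))"
proof -
  \<comment> \<open>With \<omega> \<ge> n / (2 t), the exponent is at most 8 t \<delta> log 2 n.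
    This \<delta> turns it into (1/8) log t n, so the power of \<open>t\<close> is at most n powr
    (1/8); any exponent below 1/2 would serve.\<close>
  define \<delta> where "\<delta> = 1 / (64 * t * log 2 t)"
  have lt: "log 2 t \<ge> 1" using t by (simp add: le_log_iff)
  have tl: "64 * t * log 2 t \<ge> 1" using t lt mult_mono[of 1 "64 * t" 1 "log 2 t"] by simp
  then have d0: "\<delta> > 0" "\<delta> \<le> 1" unfolding \<delta>_def by (simp_all add: divide_le_eq_1)
  have "eventually (\<lambda>n. (1 + sqrt (2 * (real n * log 2 (real n)))) * real n powr (1/8) < (1/2) * ((real n - 1) / t)) at_top"
    using t by real_asymp
  moreover have "eventually (\<lambda>n. n \<ge> 2) (at_top :: nat filter)" by (rule eventually_ge_at_top)
  ultimately have "eventually (\<lambda>n. \<delta> * (real n * log 2 (real n)) \<le> real (f n)) at_top"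
  proof eventually_elim
    case (elim n)
    show ?case
    proof (rule ccontr)
      assume "\<not> ?thesis"
      then have less: "real (f n) \<le> \<delta> * (real n * log 2 (real n))" by simp
      have n2: "real n \<ge> 2" using elim(2) by simp
      have ln: "log 2 (real n) \<ge> 0" using n2 by simp
      obtain \<omega> where w: "\<omega> \<ge> (real n - 1) / t"
        "\<omega> / 2 \<le> (1 + sqrt (2 * real (f n))) * t powr (4 * real (f n) / \<omega>)" using f elim(2) by blast
      have wn: "\<omega> \<ge> real n / (2 * t)"
      proof -
        have "real n / (2 * t) \<le> (real n - 1) / t" using n2 t by (simp add: field_simps)
        then show ?thesis using w(1) by linarith
      qed
      moreover have "real n / (2 * t) > 0" using n2 t by simp
      ultimately have w0: "\<omega> > 0" by linarith
      have "4 * real (f n) / \<omega> \<le> 4 * (\<delta> * (real n * log 2 (real n))) / (real n / (2 * t))"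
        using less wn n2 t by (intro frac_le) auto
      also have "\<dots> = 8 * t * \<delta> * log 2 (real n)" using n2 t by (simp add: field_simps)
      also have "\<dots> = (1/8) * (log 2 (real n) / log 2 t)" unfolding \<delta>_def using t lt by (simp add: field_simps)
      also have "log 2 (real n) / log 2 t = log t (real n)" using t n2 log_base_change[of 2 t "real n"] by simp
      finally have "t powr (4 * real (f n) / \<omega>) \<le> t powr ((1/8) * log t (real n))"
        using t by (intro powr_mono) auto
      also have "\<dots> = (t powr log t (real n)) powr (1/8)" by (simp add: powr_powr mult.commute)
      also have "\<dots> = real n powr (1/8)" using t n2 by simp
      finally have 1: "t powr (4 * real (f n) / \<omega>) \<le> real n powr (1/8)" .
      have "real (f n) \<le> 1 * (real n * log 2 (real n))"
        using less d0 ln mult_right_mono[of \<delta> 1 "real n * log 2 (real n)"] by simp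
      then have "1 + sqrt (2 * real (f n)) \<le> 1 + sqrt (2 * (real n * log 2 (real n)))" by simp
      then have "(1 + sqrt (2 * real (f n))) * t powr (4 * real (f n) / \<omega>) \<le>
        (1 + sqrt (2 * (real n * log 2 (real n)))) * real n powr (1/8)"
        using 1 ln by (intro mult_mono) auto
      then show False using w elim(1) by linarith
    qed
  qed
  moreover have "eventually (\<lambda>n. n \<ge> 2) (at_top :: nat filter)" by (rule eventually_ge_at_top)
  ultimately have "eventually (\<lambda>n. norm (real (f n)) \<ge> \<delta> * norm (real n * log 2 (real n))) at_top"
    by eventually_elim auto
  then show ?thesis by (rule landau_omega.bigI[OF d0(1)])
qed

lemma connected_graph_card_edges:
  assumes H: "simple_graph H" "connected_graph H" "card (verts H) \<ge> 3"
  shows "card (edges H) \<ge> 2"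
proof -
  obtain a where a: "a \<in> verts H" using H(2) unfolding connected_graph_def by blast
  have c2: "card (verts H) \<ge> 2" using H(3) by simp
  obtain b where b: "{a, b} \<in> edges H" using connected_graph_edge_ex[OF H(1,2) c2 a] .
  note ab = simple_graph_edgeD[OF H(1) b]
  have "card {a, b} < card (verts H)" using H(3) ab(1) by simp
  then have "{a, b} \<noteq> verts H" by auto
  then obtain a' d where d: "a' \<in> {a, b}" "d \<in> verts H - {a, b}" "{a', d} \<in> edges H"
    using connected_graph_neighbour[OF H(1,2), of "{a, b}"] ab by auto
  then have "{a', d} \<noteq> {a, b}" by auto
  then have "card {{a', d}, {a, b}} = 2" by simp
  moreover have "{{a', d}, {a, b}} \<subseteq> edges H" using b d by simp
  ultimately show ?thesis using card_mono[OF simple_graph_finite_edges[OF H(1)]] by metis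
qed

lemma is_star_no_triangle:
  assumes "simple_graph H" "is_star H"
  shows "\<not> in_triangle H e"
proof
  assume tri: "in_triangle H e"
  obtain x where x: "\<And>e. e \<in> edges H \<Longrightarrow> x \<in> e" using assms(2) unfolding is_star_def by auto
  have "e \<in> edges H" using tri unfolding in_triangle_def by blast
  then obtain a b where ab: "e = {a, b}" "a \<noteq> b" using simple_graph_edgeE[OF assms(1)] by metis
  then obtain d where "{a, b} \<in> edges H" "{a, d} \<in> edges H" "{b, d} \<in> edges H"
    using tri in_triangle_iff[OF assms(1)] by blast
  then show False using x[of "{a, b}"] x[of "{a, d}"] x[of "{b, d}"] ab(2)
    simple_graph_edgeD[OF assms(1)] by blast
qed

lemma is_star_conical:
  assumes "is_star H"
  shows "\<exists>x. conical H x"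
proof -
  obtain x L where xL: "finite L" "x \<notin> L" "verts H = insert x L" "edges H = {{x, y} | y. y \<in> L}"
    using assms unfolding is_star_def by blast
  have "{e \<in> edges H. x \<in> e} = (\<lambda>y. {x, y}) ` L" using xL by auto
  moreover have "inj_on (\<lambda>y. {x, y}) L" by (auto simp: inj_on_def doubleton_eq_iff)
  ultimately have "degree H x = card L" unfolding degree_def by (simp add: card_image)
  then show ?thesis unfolding conical_def using xL by auto
qed

text \<open>Every vertex except at most one isolated vertex sees one of the \<open>t\<close>
  colours, so some colour \<open>j\<close> is seen by at least the average number of
  vertices.\<close>

lemma saturated_common_colour_class:
  assumes H: "simple_graph H" "connected_graph H" "card (verts H) \<ge> 3"
    and G: "rainbow_saturated t H (V, E) c" and t: "t \<ge> 1"
  obtains W j where "W \<subseteq> V" "card V - 1 \<le> t * card W"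
    "\<And>v. v \<in> W \<Longrightarrow> \<exists>z. {v, z} \<in> E \<and> c {v, z} = j"
proof -
  have sG: "simple_graph (V, E)" and c: "\<And>e. e \<in> E \<Longrightarrow> c e \<in> {1..t}"
    using G unfolding rainbow_saturated_def edge_coloured_def by auto
  have finV: "finite V" using sG unfolding simple_graph_def by simp
  define W where "W = (\<lambda>j. {v\<in>V. \<exists>z. {v, z} \<in> E \<and> c {v, z} = j})"
  define I where "I = {v\<in>V. \<nexists>z. {v, z} \<in> E}"
  have finW: "finite (W j)" for j unfolding W_def using finV by simp
  have "card I \<le> Suc 0"
  proof (subst card_le_Suc0_iff_eq)
    show "finite I" unfolding I_def using finV by simp
    show "\<forall>u\<in>I. \<forall>v\<in>I. u = v"
      using saturated_not_both_isolated[OF H G t] unfolding I_def by blast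
  qed
  moreover have "card V - card I \<le> card (V - I)" by (rule diff_card_le_card_Diff) (simp add: I_def finV)
  moreover have "V - I \<subseteq> (\<Union>j\<in>{1..t}. W j)" unfolding I_def W_def using c by blast
  then have "card (V - I) \<le> card (\<Union>j\<in>{1..t}. W j)" using finW by (intro card_mono) auto
  moreover have "card (\<Union>j\<in>{1..t}. W j) \<le> (\<Sum>j\<in>{1..t}. card (W j))" by (rule card_UN_le) simp
  ultimately have *: "card V - 1 \<le> (\<Sum>j\<in>{1..t}. card (W j))" by linarith
  have "\<exists>j. card V - 1 \<le> t * card (W j)"
  proof (rule ccontr)
    assume "\<not> ?thesis"
    then have "\<And>j. t * card (W j) < card V - 1" by (simp add: not_le)
    then have "(\<Sum>j\<in>{1..t}. t * card (W j)) < (\<Sum>j\<in>{1..t}. card V - 1)"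
      using t by (intro sum_strict_mono) auto
    then have "t * (\<Sum>j\<in>{1..t}. card (W j)) < t * (card V - 1)" by (simp add: sum_distrib_left)
    then show False using * by (meson leD mult_le_mono2)
  qed
  then obtain j where "card V - 1 \<le> t * card (W j)" by blast
  then show thesis by (intro that[of "W j" j]) (auto simp: W_def)
qed

section \<open>Lower bounds for the saturation number, and the order n^2 for stars\<close>

context
  fixes H :: "'a graph" and t :: nat
  assumes H: "simple_graph H" "connected_graph H" "card (verts H) \<ge> 3"
    and t: "t \<ge> card (edges H)"
begin

lemma colours_ge_2: "t \<ge> 2"
  using connected_graph_card_edges[OF H] t by linarith

lemma edges_nonempty: "edges H \<noteq> {}"
  using connected_graph_card_edges[OF H] by auto

lemma sat_extremalE:
  obtains E c where "rainbow_saturated t H ({..<n}, E) c" "card E = rainbow_sat t n H"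
    "simple_graph ({..<n}, E)" "\<And>e. e \<in> E \<Longrightarrow> c e \<in> {1..t}"
proof -
  obtain E c where Ec: "rainbow_saturated t H ({..<n}, E) c" "card E = rainbow_sat t n H"
    using rainbow_satE[OF H(1) edges_nonempty] by blast
  then show thesis using that unfolding rainbow_saturated_def edge_coloured_def by auto
qed

text \<open>Besides being the upper bound for stars, this covers those \<open>n\<close> that are too
  small to hold all gadgets.\<close>

lemma rainbow_sat_le_square: "rainbow_sat t n H \<le> n ^ 2"
proof -
  obtain E where Ec: "card E = rainbow_sat t n H" "simple_graph ({..<n}, E)"
    using sat_extremalE by metis
  then have "card E \<le> n choose 2" using card_mono[of "nsets {..<n} 2" E]
    by (simp add: simple_graph_def finite_imp_finite_nsets)
  also have "\<dots> \<le> n ^ 2"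
    unfolding choose_two power2_eq_square by (meson diff_le_self div_le_dividend le_trans mult_le_mono2)
  finally show ?thesis using Ec(1) by simp
qed

lemma rainbow_sat_linear_lower: "(\<lambda>n. real (rainbow_sat t n H)) \<in> \<Omega>(\<lambda>n. real n)"
proof -
  have lin: "real n - 1 \<le> 2 * real (rainbow_sat t n H)" for n
  proof -
    obtain E c where Ec: "rainbow_saturated t H ({..<n}, E) c" "card E = rainbow_sat t n H"
      "simple_graph ({..<n}, E)" using sat_extremalE by blast
    define I where "I = {v\<in>{..<n}. \<nexists>z. {v, z} \<in> E}"
    have "card I \<le> Suc 0"
    proof (subst card_le_Suc0_iff_eq)
      show "finite I" unfolding I_def by simp
      show "\<forall>u\<in>I. \<forall>v\<in>I. u = v"
        using saturated_not_both_isolated[OF H Ec(1)] colours_ge_2 unfolding I_def by fastforce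
    qed
    moreover have "n - card I \<le> card ({..<n} - I)"
      using diff_card_le_card_Diff[of I "{..<n}"] by (simp add: I_def)
    moreover have "card ({..<n} - I) = (\<Sum>v\<in>{..<n} - I. 1)" by simp
    moreover have "\<dots> \<le> (\<Sum>v\<in>{..<n} - I. card {w\<in>{..<n}. {v, w} \<in> E})"
    proof (rule sum_mono)
      fix v assume "v \<in> {..<n} - I"
      then obtain w where "{v, w} \<in> E" unfolding I_def by auto
      then have "{w\<in>{..<n}. {v, w} \<in> E} \<noteq> {}" using simple_graph_edgeD[OF Ec(3)] by fastforce
      then show "1 \<le> card {w\<in>{..<n}. {v, w} \<in> E}" by (simp add: Suc_le_eq card_gt_0_iff)
    qed
    moreover have "\<dots> \<le> (\<Sum>v\<in>{..<n}. card {w\<in>{..<n}. {v, w} \<in> E})" by (rule sum_mono2) auto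
    moreover have "\<dots> \<le> 2 * card E" by (rule sum_neighbours_le[OF Ec(3)])
    ultimately have "n \<le> Suc (2 * card E)" by linarith
    then show ?thesis using Ec(2) by linarith
  qed
  have *: "norm (real (rainbow_sat t n H)) \<ge> 1/4 * norm (real n)" if "n \<ge> 2" for n
  proof -
    have "real n \<ge> 2" using that by simp
    then show ?thesis using lin[of n] by simp
  qed
  have "eventually (\<lambda>n. n \<ge> 2) (at_top :: nat filter)" by (rule eventually_ge_at_top)
  then have "eventually (\<lambda>n. norm (real (rainbow_sat t n H)) \<ge> 1/4 * norm (real n)) at_top"
    by eventually_elim (rule *)
  then show ?thesis by (intro landau_omega.bigI[of "1/4"]) auto
qed

text \<open>Whichever edge of a copy is the new one, it lies in a triangle. So all non-adjacent
  pairs are joined by rainbow paths, and the averaging applies to the whole vertex set.\<close>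

lemma rainbow_sat_triangle_lower:
  assumes "\<forall>e\<in>edges H. in_triangle H e"
  shows "(\<lambda>n. real (rainbow_sat t n H)) \<in> \<Omega>(\<lambda>n. real n * log 2 (real n))"
proof (rule nlogn_lower_asymptotics[of "real t"])
  fix n :: nat assume n: "n \<ge> 2"
  obtain E c where Ec: "rainbow_saturated t H ({..<n}, E) c" "card E = rainbow_sat t n H"
    "simple_graph ({..<n}, E)" "\<And>e. e \<in> E \<Longrightarrow> c e \<in> {1..t}" using sat_extremalE by blast
  have t1: "t \<ge> 1" using colours_ge_2 by simp
  have "real (card {..<n}) / 2 \<le> (1 + sqrt (2 * real (card E))) * real t powr (4 * real (card E) / real (card {..<n}))"
    using n all_triangle_rainbow_path[OF H(1) assms Ec(1) t1]
    by (intro rainbow_path_edge_bound[OF Ec(3,4) subset_refl _ _ t1]) (auto simp: lessThan_empty_iff)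
  moreover have "real n - 1 \<le> real n * real t" using t1 mult_left_mono[of 1 "real t" "real n"] by simp
  then have "(real n - 1) / real t \<le> real n" using colours_ge_2 by (simp add: divide_le_eq)
  ultimately show "\<exists>\<omega>\<ge>(real n - 1) / real t. \<omega> / 2 \<le> (1 + sqrt (2 * real (rainbow_sat t n H))) *
      real t powr (4 * real (rainbow_sat t n H) / \<omega>)"
    unfolding Ec(2) by auto
qed (use colours_ge_2 in simp)

text \<open>The averaging applies to the at least (n - 1) / t vertices that see a common colour
  \<open>j\<close>.\<close>

lemma rainbow_sat_conical_lower:
  assumes x: "conical H x"
  shows "(\<lambda>n. real (rainbow_sat t n H)) \<in> \<Omega>(\<lambda>n. real n * log 2 (real n))"
proof (rule nlogn_lower_asymptotics[of "real t"])
  fix n :: nat assume n: "n \<ge> 2"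
  obtain E c where Ec: "rainbow_saturated t H ({..<n}, E) c" "card E = rainbow_sat t n H"
    "simple_graph ({..<n}, E)" "\<And>e. e \<in> E \<Longrightarrow> c e \<in> {1..t}" using sat_extremalE by blast
  have t1: "t \<ge> 1" using colours_ge_2 by simp
  obtain W j where W: "W \<subseteq> {..<n}" "n - 1 \<le> t * card W"
    "\<And>v. v \<in> W \<Longrightarrow> \<exists>z. {v, z} \<in> E \<and> c {v, z} = j"
    using saturated_common_colour_class[OF H Ec(1) t1] by auto
  have "real (n - 1) \<le> real (t * card W)" using W(2) by (rule of_nat_mono)
  then have w: "(real n - 1) / real t \<le> real (card W)" using n t1 by (simp add: divide_le_eq of_nat_diff mult.commute)
  have ne: "W \<noteq> {}" using W(2) n by auto
  have "\<exists>w. {u, w} \<in> E \<and> {v, w} \<in> E \<and> c {u, w} \<noteq> c {v, w}"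
    if uv: "u \<in> W" "v \<in> W" "u \<noteq> v" "{u, v} \<notin> E" for u v
  proof -
    obtain z1 z2 where "{u, z1} \<in> E" "{v, z2} \<in> E" "c {u, z1} = j" "c {v, z2} = j" using W(3) uv by metis
    then show ?thesis using conical_common_colour[OF H(1) x Ec(1) _ _ uv(3,4)] W(1) uv by blast
  qed
  then have "real (card W) / 2 \<le> (1 + sqrt (2 * real (card E))) * real t powr (4 * real (card E) / real (card W))"
    by (intro rainbow_path_edge_bound[OF Ec(3,4) W(1) ne _ t1])
  then show "\<exists>\<omega>\<ge>(real n - 1) / real t. \<omega> / 2 \<le> (1 + sqrt (2 * real (rainbow_sat t n H))) *
      real t powr (4 * real (rainbow_sat t n H) / \<omega>)"
    unfolding Ec(2) using w by blast
qed (use colours_ge_2 in simp)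

lemma rainbow_sat_star:
  assumes star: "is_star H"
  shows "(\<lambda>n. real (rainbow_sat t n H)) \<in> \<Theta>(\<lambda>n. real n ^ 2)"
proof (rule bigthetaI)
  have "norm (real (rainbow_sat t n H)) \<le> 1 * norm (real n ^ 2)" for n
    using of_nat_mono[OF rainbow_sat_le_square[of n], where 'a = real] by simp
  then show "(\<lambda>n. real (rainbow_sat t n H)) \<in> O(\<lambda>n. real n ^ 2)" by (intro bigoI[of _ 1]) auto
next
  obtain x where x: "conical H x" using is_star_conical[OF star] by blast
  have t1: "t \<ge> 1" using colours_ge_2 by simp
  \<comment> \<open>The condition on \<open>n\<close> is equivalent to (n - 1) / t - 1 \<ge> n / (2
    t). A clique of size at least 1 + n / (2 t) then yields half the square of n / (2 t), which is
    the constant.\<close>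
  have *: "norm (real (rainbow_sat t n H)) \<ge> (1 / (8 * real t ^ 2)) * norm (real n ^ 2)" if n: "n \<ge> 2 + 2 * t" for n
  proof -
    obtain E c where Ec: "rainbow_saturated t H ({..<n}, E) c" "card E = rainbow_sat t n H"
      "simple_graph ({..<n}, E)" using sat_extremalE by blast
    obtain W j where W: "W \<subseteq> {..<n}" "n - 1 \<le> t * card W"
      "\<And>v. v \<in> W \<Longrightarrow> \<exists>z. {v, z} \<in> E \<and> c {v, z} = j"
      using saturated_common_colour_class[OF H Ec(1) t1] by auto
    have "real (n - 1) \<le> real (t * card W)" using W(2) by (rule of_nat_mono)
    then have w: "(real n - 1) / real t \<le> real (card W)" using n t1 by (simp add: divide_le_eq of_nat_diff mult.commute)
    have "nsets W 2 \<subseteq> E"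
    proof
      fix e assume "e \<in> nsets W 2"
      then obtain u v where uv: "e = {u, v}" "u \<noteq> v" "u \<in> W" "v \<in> W" by (rule nsets_2E)
      obtain z1 z2 where "{u, z1} \<in> E" "{v, z2} \<in> E" "c {u, z1} = j" "c {v, z2} = j" using W(3) uv by metis
      then show "e \<in> E" using conical_common_colour[OF H(1) x Ec(1) _ _ uv(2)] W(1) uv
        is_star_no_triangle[OF H(1) star] by blast
    qed
    then have "real (card W) \<le> 1 + sqrt (2 * real (card E))"
      using clique_size_bound[of E W] simple_graph_finite_edges[OF Ec(3)] W(1) finite_subset by auto
    moreover have "real n / (2 * real t) \<le> (real n - 1) / real t - 1"
    proof -
      have "real n \<ge> 2 + 2 * real t" using n by linarith
      then show ?thesis using t1 by (simp add: field_simps)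
    qed
    ultimately have "real n / (2 * real t) \<le> sqrt (2 * real (card E))" using w by linarith
    then have "(real n / (2 * real t))\<^sup>2 \<le> 2 * real (card E)"
      by (metis abs_of_nonneg divide_nonneg_nonneg mult_nonneg_nonneg of_nat_0_le_iff power_mono real_sqrt_abs real_sqrt_le_iff sqrt_ge_absD zero_le_numeral)
    then show ?thesis using t1 Ec(2) by (simp add: field_simps power2_eq_square)
  qed
  have "eventually (\<lambda>n. n \<ge> 2 + 2 * t) (at_top :: nat filter)" by (rule eventually_ge_at_top)
  then have "eventually (\<lambda>n. norm (real (rainbow_sat t n H)) \<ge> (1 / (8 * real t ^ 2)) * norm (real n ^ 2)) at_top"
    by eventually_elim (rule *)
  then show "(\<lambda>n. real (rainbow_sat t n H)) \<in> \<Omega>(\<lambda>n. real n ^ 2)"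
    by (rule landau_omega.bigI[rotated]) (use t1 in auto)
qed

end

section \<open>Gadget constructions\<close>

text \<open>The vertices outside \<open>U\<close> form copies of \<open>H - {x, y}\<close>, the gadgets: \<open>gad p\<close> is the gadget of \<open>p\<close>
  and \<open>lab p\<close> the vertex of \<open>H\<close> it represents. A vertex \<open>u \<in> U\<close> is attached to gadget \<open>g\<close> in the roles
  \<open>\<rho> u g \<subseteq> {x, y}\<close>. Gadgets \<open>(i, b)\<close> avoid colour \<open>i\<close>: there, the edge with \<open>\<sigma>\<close>-colour \<open>i\<close> gets the
  colour \<open>1\<close>, which is not a value of \<open>\<sigma>\<close>.\<close>

locale gadget_graph =
  fixes H :: "'a graph" and x y :: 'a and \<sigma> :: "'a set \<Rightarrow> nat" and V U :: "'v set"
    and gad :: "'v \<Rightarrow> nat \<times> nat" and lab :: "'v \<Rightarrow> 'a" and \<rho> :: "'v \<Rightarrow> nat \<times> nat \<Rightarrow> 'a set"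
  assumes H: "simple_graph H"
    and xy: "{x, y} \<in> edges H"
    and x_nbr: "\<exists>a. a \<noteq> y \<and> {x, a} \<in> edges H"
    and y_nbr: "\<exists>a. a \<noteq> x \<and> {y, a} \<in> edges H"
    and no_isolated: "\<And>a. a \<in> verts H \<Longrightarrow> \<exists>b. {a, b} \<in> edges H"
    and \<sigma>: "bij_betw \<sigma> (edges H - {{x, y}}) {2..card (edges H)}"
    and UV: "U \<subseteq> V"
    and lab: "\<And>p. p \<in> V - U \<Longrightarrow> lab p \<in> verts H - {x, y}"
    and gad_lab_inj: "\<And>p q. p \<in> V - U \<Longrightarrow> q \<in> V - U \<Longrightarrow> gad p = gad q \<Longrightarrow> lab p = lab q \<Longrightarrow> p = q"
    and \<rho>: "\<And>u g. \<rho> u g \<subseteq> {x, y}"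
    and excl: "\<And>u g a. {x, y} \<subseteq> \<rho> u g \<Longrightarrow> {x, a} \<in> edges H \<Longrightarrow> {y, a} \<notin> edges H"
begin

text \<open>Edges of the gadget graph, with their gadget and the edge of \<open>H - xy\<close> they
  represent. It is a relation, since an edge can be written in several ways;
  \<open>lift_unique\<close> shows that it is functional. No edge joins two gadgets or two vertices
  of \<open>U\<close>.\<close>

definition lift :: "'v set \<Rightarrow> nat \<times> nat \<Rightarrow> 'a set \<Rightarrow> bool" where
  "lift e g f \<longleftrightarrow>
     (\<exists>p q. p \<in> V - U \<and> q \<in> V - U \<and> e = {p, q} \<and> gad p = g \<and> gad q = g \<and> f = {lab p, lab q} \<and> f \<in> edges H) \<or>
     (\<exists>u p r. u \<in> U \<and> p \<in> V - U \<and> e = {u, p} \<and> gad p = g \<and> r \<in> \<rho> u g \<and> f = {r, lab p} \<and> f \<in> edges H)"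

text \<open>For \<open>fst g = 1\<close> nothing is recoloured, and colour 1 is then the one that
  the gadget avoids.\<close>

definition gcol :: "nat \<times> nat \<Rightarrow> 'a set \<Rightarrow> nat" where
  "gcol g f = (if \<sigma> f = fst g then 1 else \<sigma> f)"

definition gedges :: "'v set set" where
  "gedges = {e. \<exists>g f. lift e g f}"

definition gcolour :: "'v set \<Rightarrow> nat" where
  "gcolour e = (SOME i. \<exists>g f. lift e g f \<and> i = gcol g f)"

lemma liftE:
  assumes "lift e g f"
  obtains p q where "p \<in> V - U" "q \<in> V - U" "e = {p, q}" "gad p = g" "gad q = g"
      "f = {lab p, lab q}" "f \<in> edges H"
    | u p r where "u \<in> U" "p \<in> V - U" "e = {u, p}" "gad p = g" "r \<in> \<rho> u g"
      "f = {r, lab p}" "f \<in> edges H"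
  using assms unfolding lift_def
proof (elim disjE exE conjE)
  fix p q assume "p \<in> V - U" "q \<in> V - U" "e = {p, q}" "gad p = g" "gad q = g" "f = {lab p, lab q}" "f \<in> edges H"
  then show thesis by (rule that(1))
next
  fix u p r assume "u \<in> U" "p \<in> V - U" "e = {u, p}" "gad p = g" "r \<in> \<rho> u g" "f = {r, lab p}" "f \<in> edges H"
  then show thesis by (rule that(2))
qed

lemma xy_ne: "x \<noteq> y" and xy_verts: "x \<in> verts H" "y \<in> verts H"
  using simple_graph_edgeD[OF H xy] by auto

lemma lift_edge: "lift e g f \<Longrightarrow> f \<in> edges H - {{x, y}}"
  unfolding lift_def using lab by (force simp: doubleton_eq_iff)

lemma lift_interior_vertex:
  assumes "lift e g f" "q \<in> f" "q \<notin> {x, y}"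
  shows "\<exists>p\<in>e. p \<in> V - U \<and> lab p = q \<and> gad p = g"
  using assms \<rho> unfolding lift_def by blast

lemma lift_boundary_vertex:
  assumes "lift e g f" "x \<in> f \<or> y \<in> f"
  shows "\<exists>p\<in>e. p \<in> U"
  using assms lab unfolding lift_def by blast

lemma lift_boundary_vertex_conv:
  assumes "lift e g f" "p \<in> e" "p \<in> U"
  shows "x \<in> f \<or> y \<in> f"
  using assms \<rho> unfolding lift_def by blast

lemma lift_label:
  assumes "lift e g f" "p \<in> e" "p \<notin> U"
  shows "lab p \<in> f" "gad p = g" "p \<in> V - U"
  using assms unfolding lift_def by blast+

text \<open>Inside a gadget, the labels determine the edge of \<open>H\<close>. At a vertex of
  \<open>U\<close>, it could be ambiguous only if the vertex has both roles and \<open>lab p\<close>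
  is a common neighbour of \<open>x\<close> and \<open>y\<close>, which \<open>excl\<close>
  forbids.\<close>

lemma lift_unique:
  assumes "lift e g f" "lift e g' f'"
  shows "g = g'" "f = f'"
proof -
  obtain p where p: "p \<in> e" "p \<in> V - U" using assms(1) unfolding lift_def by blast
  then show g: "g = g'" using lift_label(2)[OF assms(1)] lift_label(2)[OF assms(2)] by blast
  show "f = f'"
  proof (cases rule: liftE[OF assms(1)])
    case (1 p q)
    show ?thesis
    proof (cases rule: liftE[OF assms(2)])
      case (1 p' q')
      then have "{p, q} = {p', q'}" using \<open>e = {p, q}\<close> by simp
      then show ?thesis using \<open>f = {lab p, lab q}\<close> 1 by (auto simp: doubleton_eq_iff)
    next
      case (2 u' p' r')
      then show ?thesis using \<open>e = {p, q}\<close> \<open>p \<in> V - U\<close> \<open>q \<in> V - U\<close> by (auto simp: doubleton_eq_iff)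
    qed
  next
    case bd: (2 u p r)
    show ?thesis
    proof (cases rule: liftE[OF assms(2)])
      case (1 p' q')
      then show ?thesis using bd by (auto simp: doubleton_eq_iff)
    next
      case (2 u' p' r')
      then have e: "u' = u" "p' = p" using bd by (auto simp: doubleton_eq_iff)
      have "r = r'"
      proof (rule ccontr)
        assume ne: "r \<noteq> r'"
        have rr: "r \<in> \<rho> u g" "r' \<in> \<rho> u g" using bd 2 e g by auto
        then have rs: "r = x \<and> r' = y \<or> r = y \<and> r' = x" using \<rho>[of u g] ne by blast
        then have "{x, y} \<subseteq> \<rho> u g" using rr by auto
        moreover have "{r, lab p} \<in> edges H" "{r', lab p} \<in> edges H" using bd 2 e by simp_all
        then have "{x, lab p} \<in> edges H" "{y, lab p} \<in> edges H" using rs by auto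
        ultimately show False using excl by blast
      qed
      then show ?thesis using bd 2 e by simp
    qed
  qed
qed

lemma gcolour_lift: "lift e g f \<Longrightarrow> gcolour e = gcol g f"
  unfolding gcolour_def by (rule some_equality) (use lift_unique in blast)+

lemma gedges_subset: "gedges \<subseteq> nsets V 2"
proof
  fix e assume "e \<in> gedges"
  then obtain g f where "lift e g f" unfolding gedges_def by blast
  then show "e \<in> nsets V 2"
  proof (cases rule: liftE)
    case (1 p q)
    then have "p \<noteq> q" using simple_graph_edgeD[OF H] by blast
    then show ?thesis using 1 by (simp add: in_nsets_2_iff)
  qed (use UV in \<open>auto simp: in_nsets_2_iff\<close>)
qed

lemma gedges_meet: "e \<in> gedges \<Longrightarrow> \<not> e \<subseteq> U"
  unfolding gedges_def lift_def by blast

lemma \<sigma>_range: "f \<in> edges H - {{x, y}} \<Longrightarrow> \<sigma> f \<in> {2..card (edges H)}"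
  using \<sigma> by (rule bij_betwE[rule_format])

lemma \<sigma>_inj: "f \<in> edges H - {{x, y}} \<Longrightarrow> f' \<in> edges H - {{x, y}} \<Longrightarrow> \<sigma> f = \<sigma> f' \<Longrightarrow> f = f'"
  using bij_betw_imp_inj_on[OF \<sigma>] by (rule inj_onD)

lemma gcol_range:
  assumes "f \<in> edges H - {{x, y}}" shows "gcol g f \<in> {1..card (edges H)}"
  using \<sigma>_range[OF assms] unfolding gcol_def by auto

lemma gcolour_range:
  assumes "e \<in> gedges" shows "gcolour e \<in> {1..card (edges H)}"
proof -
  obtain g f where l: "lift e g f" using assms unfolding gedges_def by blast
  show ?thesis unfolding gcolour_lift[OF l] by (rule gcol_range[OF lift_edge[OF l]])
qed

end

text \<open>The shape of a hypothetical rainbow copy \<open>\<psi>\<close>, to be refuted.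
  \<open>G e\<close> and \<open>P e\<close> are the gadget and the edge of \<open>H - xy\<close> to
  which the copy of \<open>e\<close> projects. Seen from the copy, \<open>x\<close> and
  \<open>y\<close> are merged into the single vertex \<open>u0\<close>, while \<open>w\<close> is
  split into \<open>w1\<close> and \<open>w2\<close> in different gadgets; the only two edges with
  the same projection are those from \<open>u0\<close> to \<open>w1\<close> and
  \<open>w2\<close>.\<close>

locale gadget_copy = gadget_graph +
  fixes \<psi> G P u0 w1 w2 w r
  assumes copy_lift: "\<And>e. e \<in> edges H \<Longrightarrow> lift (\<psi> ` e) (G e) (P e)"
    and u0: "u0 \<in> verts H" "\<psi> u0 \<in> U"
    and interior: "\<And>v. v \<in> verts H \<Longrightarrow> v \<noteq> u0 \<Longrightarrow> \<psi> v \<in> V - U"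
    and w12: "w1 \<in> verts H - {u0}" "w2 \<in> verts H - {u0}" "w1 \<noteq> w2" "lab (\<psi> w1) = w" "lab (\<psi> w2) = w"
      "gad (\<psi> w1) \<noteq> gad (\<psi> w2)"
    and collision: "\<And>v v'. v \<in> verts H - {u0} \<Longrightarrow> v' \<in> verts H - {u0} \<Longrightarrow> lab (\<psi> v) = lab (\<psi> v') \<Longrightarrow>
      v \<noteq> v' \<Longrightarrow> {v, v'} = {w1, w2}"
    and u0w: "{u0, w1} \<in> edges H" "{u0, w2} \<in> edges H" "P {u0, w1} = {r, w}" "P {u0, w2} = {r, w}"
    and P_bij: "bij_betw P (edges H - {{u0, w1}}) (edges H - {{x, y}})"

context gadget_graph
begin

text \<open>A rainbow copy uses every colour in \<open>{1..e(H)}\<close>, colour \<open>1\<close> on the edge \<open>e1\<close> only. The other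
  edges project bijectively to \<open>H - xy\<close>, so exactly one edge of \<open>H - xy\<close> is hit twice, and by different
  gadgets. Counting vertices, only one vertex \<open>u0\<close> of the copy is in \<open>U\<close>, and exactly one vertex \<open>w\<close>
  of \<open>H - {x, y}\<close> is represented twice.\<close>
lemma rainbow_copy_structure:
  assumes emb: "rainbow_emb H (V, gedges) gcolour \<psi>"
  shows "\<exists>G P u0 w1 w2 w r. gadget_copy H x y \<sigma> V U gad lab \<rho> \<psi> G P u0 w1 w2 w r"
proof -
  let ?E = "edges H"
  have inj: "inj_on \<psi> (verts H)" and img: "\<psi> ` verts H \<subseteq> V" and rb: "inj_on (\<lambda>e. gcolour (\<psi> ` e)) ?E"
    using emb unfolding rainbow_emb_def by auto
  have finE: "finite ?E" and finV: "finite (verts H)" using H simple_graph_finite_edges[OF H]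
    unfolding simple_graph_def by auto
  have sub: "e \<subseteq> verts H" if "e \<in> ?E" for e using H that unfolding simple_graph_def nsets_def by auto
  have "\<forall>e\<in>?E. \<exists>g f. lift (\<psi> ` e) g f" using emb unfolding rainbow_emb_def gedges_def by auto
  then obtain G P where L: "\<And>e. e \<in> ?E \<Longrightarrow> lift (\<psi> ` e) (G e) (P e)" by metis
  define K where "K = (\<lambda>e. gcolour (\<psi> ` e))"
  have K: "K e = gcol (G e) (P e)" if "e \<in> ?E" for e unfolding K_def using gcolour_lift[OF L[OF that]] .
  have P: "P e \<in> ?E - {{x, y}}" if "e \<in> ?E" for e using lift_edge[OF L[OF that]] .
  have Kinj: "inj_on K ?E" using rb unfolding K_def .
  have "K ` ?E \<subseteq> {1..card ?E}"
  proof
    fix i assume "i \<in> K ` ?E"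
    then obtain e where e: "e \<in> ?E" "i = K e" by blast
    show "i \<in> {1..card ?E}" using gcol_range[OF P[OF e(1)], of "G e"] K[OF e(1)] e(2) by simp
  qed
  then have Kim: "K ` ?E = {1..card ?E}" using card_image[OF Kinj] by (intro card_subset_eq) auto
  have "card ?E \<noteq> 0" using xy finE by auto
  then have "1 \<in> K ` ?E" unfolding Kim by simp
  then obtain e1 where e1: "e1 \<in> ?E" "K e1 = 1" by fastforce
  have Ks: "K e = \<sigma> (P e)" if "e \<in> ?E - {e1}" for e
  proof -
    have "K e \<noteq> 1" using that e1 Kinj by (metis DiffD1 DiffD2 inj_onD singletonI)
    then show ?thesis using K that unfolding gcol_def by (metis DiffD1)
  qed
  have Pinj: "inj_on P (?E - {e1})"
    using Ks Kinj by (metis (no_types, lifting) DiffD1 inj_onI inj_onD)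
  have Pbij: "bij_betw P (?E - {e1}) (?E - {{x, y}})"
    unfolding bij_betw_def
  proof (intro conjI Pinj card_subset_eq)
    show "card (P ` (?E - {e1})) = card (?E - {{x, y}})" using card_image[OF Pinj] e1 xy finE by simp
  qed (use finE P in auto)
  have Psurj: "\<exists>e\<in>?E - {e1}. P e = f" if "f \<in> ?E - {{x, y}}" for f
    using Pbij that unfolding bij_betw_def by (metis imageE)
  define f1 where "f1 = P e1"
  have f1: "f1 \<in> ?E - {{x, y}}" using P e1 unfolding f1_def by blast
  obtain e2 where e2: "e2 \<in> ?E - {e1}" "P e2 = f1" using Psurj[OF f1] by blast
  \<comment> \<open>In the same gadget, the same edge of \<open>H\<close> would give both edges the
    same colour.\<close>
  have G12: "G e1 \<noteq> G e2"
  proof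
    assume "G e1 = G e2"
    then have "K e1 = K e2" using K e1 e2 unfolding f1_def by simp
    then show False using Kinj e1 e2 by (metis DiffD1 DiffD2 inj_onD singletonI)
  qed
  define I where "I = {v\<in>verts H. \<psi> v \<notin> U}"
  define Lab where "Lab = lab \<circ> \<psi>"
  have finI: "finite I" unfolding I_def using finV by simp
  let ?Q = "verts H - {x, y}"
  have over: "\<exists>v\<in>e. v \<in> I \<and> Lab v = q \<and> gad (\<psi> v) = G e" if "e \<in> ?E" "q \<in> P e" "q \<notin> {x, y}" for e q
    using lift_interior_vertex[OF L[OF that(1)] that(2,3)] sub[OF that(1)] unfolding I_def Lab_def by auto
  have overU: "\<exists>v\<in>e. v \<in> verts H - I" if "e \<in> ?E" "x \<in> P e \<or> y \<in> P e" for e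
    using lift_boundary_vertex[OF L[OF that(1)] that(2)] sub[OF that(1)] unfolding I_def by auto
  \<comment> \<open>Each vertex of \<open>H\<close> outside {x, y} lies on an edge other than
    \<open>xy\<close>, and all of these are projections.\<close>
  have LabQ: "Lab ` I = ?Q"
  proof
    show "Lab ` I \<subseteq> ?Q" unfolding Lab_def I_def using lab img by auto
    show "?Q \<subseteq> Lab ` I"
    proof
      fix q assume q: "q \<in> ?Q"
      obtain b where b: "{q, b} \<in> ?E" using no_isolated q by blast
      then have "{q, b} \<in> ?E - {{x, y}}" using q by (auto simp: doubleton_eq_iff)
      then obtain e where "e \<in> ?E" "P e = {q, b}" using Psurj by blast
      then show "q \<in> Lab ` I" using over[of e q] q by auto
    qed
  qed
  have "\<exists>u0. u0 \<in> verts H - I"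
  proof -
    obtain a where "a \<noteq> y" "{x, a} \<in> ?E" using x_nbr by blast
    then have "{x, a} \<in> ?E - {{x, y}}" by (auto simp: doubleton_eq_iff)
    then obtain e where "e \<in> ?E" "P e = {x, a}" using Psurj by blast
    then show ?thesis using overU[of e] by auto
  qed
  then obtain u0 where u0: "u0 \<in> verts H" "u0 \<notin> I" by blast
  have "\<exists>q r. f1 = {r, q} \<and> q \<in> ?Q"
  proof -
    obtain a b where ab: "f1 = {a, b}" "a \<noteq> b" "a \<in> verts H" "b \<in> verts H"
      using simple_graph_edgeE[OF H, of f1] f1 by blast
    then have "\<not> (a \<in> {x, y} \<and> b \<in> {x, y})" using f1 by auto
    then have "b \<in> ?Q \<or> a \<in> ?Q" using ab by blast
    moreover have "f1 = {b, a}" using ab by auto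
    ultimately show ?thesis using ab by blast
  qed
  then obtain w r where w: "f1 = {r, w}" "w \<in> ?Q" by blast
  have "w \<in> P e1" "w \<in> P e2" "e2 \<in> ?E" using w e2 unfolding f1_def by auto
  then obtain w1 w2 where w1: "w1 \<in> e1" "w1 \<in> I" "Lab w1 = w" "gad (\<psi> w1) = G e1"
    and w2: "w2 \<in> e2" "w2 \<in> I" "Lab w2 = w" "gad (\<psi> w2) = G e2"
    using over[OF e1(1), of w] over[of e2 w] w(2) by blast
  have ww: "w1 \<noteq> w2" using w1 w2 G12 by auto
  have cQ: "card ?Q = card (verts H) - 2" using xy_ne xy_verts finV by simp
  have ch: "card (verts H) \<ge> 2" using card_mono[OF finV, of "{x, y}"] xy_ne xy_verts by simp
  have drop1: "Lab ` (I - {v}) = ?Q" if v: "v \<in> I" "v' \<in> I" "v \<noteq> v'" "Lab v = Lab v'" for v v'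
  proof -
    have "Lab ` I = insert (Lab v) (Lab ` (I - {v}))" using v(1) by blast
    moreover have "Lab v \<in> Lab ` (I - {v})" unfolding v(4) using v(2,3) by blast
    ultimately show ?thesis using LabQ by blast
  qed
  have ge: "Lab ` (I - {w1}) = ?Q" "Lab ` (I - {w2}) = ?Q"
    using drop1[of w1 w2] drop1[of w2 w1] w1 w2 ww by simp_all
  have sI: "I \<subseteq> verts H - {u0}" using u0 unfolding I_def by auto
  have cI1: "card I \<le> card (verts H) - 1" using card_mono[OF _ sI] finV u0 by simp
  have cI2: "card ?Q \<le> card I - 1" using card_image_le[of "I - {w1}" Lab] ge(1) finI w1(2) by simp
  \<comment> \<open>\<open>I\<close> misses \<open>u0\<close>, yet even without \<open>w1\<close> it
    covers all card (verts H) - 2 labels. So both bounds on its size are attained, and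
    \<open>Lab\<close> is injective after the removal of \<open>w1\<close> or of
    \<open>w2\<close>.\<close>
  have I: "I = verts H - {u0}"
  proof (rule card_subset_eq[OF _ sI])
    have "card I > 0" using w1(2) finI by (auto simp: card_gt_0_iff)
    then show "card I = card (verts H - {u0})" using cI1 cI2 cQ ch u0 finV by simp
  qed (use finV in simp)
  have cI: "card I - 1 = card ?Q" using cI2 cQ I finV u0 by simp
  have inj1: "inj_on Lab (I - {w1})"
    by (rule eq_card_imp_inj_on) (use ge cI finI w1(2) in simp_all)
  have inj2: "inj_on Lab (I - {w2})"
    by (rule eq_card_imp_inj_on) (use ge cI finI w2(2) in simp_all)
  have coll: "{v, v'} = {w1, w2}" if "v \<in> I" "v' \<in> I" "Lab v = Lab v'" "v \<noteq> v'" for v v'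
  proof -
    have "v \<in> {w1} \<or> v' \<in> {w1}" "v \<in> {w2} \<or> v' \<in> {w2}"
      using that inj1 inj2 unfolding inj_on_def by blast+
    then show ?thesis using ww by auto
  qed
  \<comment> \<open>Otherwise \<open>r\<close> too would be represented in both gadgets, but
    \<open>w\<close> is the only label that occurs twice.\<close>
  have rxy: "r \<in> {x, y}"
  proof (rule ccontr)
    assume r: "r \<notin> {x, y}"
    have "r \<in> P e1" "r \<in> P e2" "e2 \<in> ?E" using w e2 unfolding f1_def by auto
    then obtain r1 r2 where "r1 \<in> I" "Lab r1 = r" "gad (\<psi> r1) = G e1"
      "r2 \<in> I" "Lab r2 = r" "gad (\<psi> r2) = G e2"
      using over[OF e1(1), of r] over[of e2 r] r by blast
    moreover from this have "r1 \<noteq> r2" using G12 by auto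
    ultimately have "{r1, r2} = {w1, w2}" using coll[of r1 r2] by simp
    then have "r1 = w1 \<or> r1 = w2" by (auto simp: doubleton_eq_iff)
    then have "r = w" using \<open>Lab r1 = r\<close> w1 w2 by auto
    then show False using w f1 simple_graph_edgeD(1)[OF H, of r w] by simp
  qed
  have e_eq: "e = {u0, v}" if "e \<in> ?E" "v \<in> e" "v \<in> I" "x \<in> P e \<or> y \<in> P e" for e v
  proof -
    have "u0 \<in> e" using overU[OF that(1,4)] I by auto
    then show ?thesis using that I by (intro simple_graph_edge_eq[OF H]) auto
  qed
  have e1': "e1 = {u0, w1}" using e_eq[OF e1(1) w1(1,2)] rxy w unfolding f1_def by auto
  have e2': "e2 = {u0, w2}" using e_eq[of e2 w2] e2 w2 rxy w by auto
  have "gadget_copy H x y \<sigma> V U gad lab \<rho> \<psi> G P u0 w1 w2 w r"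
  proof unfold_locales
    show "\<And>e. e \<in> edges H \<Longrightarrow> lift (\<psi> ` e) (G e) (P e)" by (rule L)
    show "\<psi> u0 \<in> U" using u0 unfolding I_def by auto
    show "\<And>v. v \<in> verts H \<Longrightarrow> v \<noteq> u0 \<Longrightarrow> \<psi> v \<in> V - U" using I img unfolding I_def by blast
    show "gad (\<psi> w1) \<noteq> gad (\<psi> w2)" using w1 w2 G12 by simp
    show "bij_betw P (edges H - {{u0, w1}}) (edges H - {{x, y}})" using Pbij e1' by simp
    show "\<And>v v'. v \<in> verts H - {u0} \<Longrightarrow> v' \<in> verts H - {u0} \<Longrightarrow> lab (\<psi> v) = lab (\<psi> v') \<Longrightarrow> v \<noteq> v' \<Longrightarrow> {v, v'} = {w1, w2}"
      using coll I unfolding Lab_def by simp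
  qed (use u0 w1 w2 ww I e1 e2 e1' e2' w in \<open>auto simp: Lab_def f1_def\<close>)
  then show ?thesis by blast
qed

end

context gadget_copy
begin

lemma interior_lift:
  assumes "e \<in> edges H" "q \<in> P e" "q \<notin> {x, y}"
  shows "\<exists>v\<in>e. v \<in> verts H - {u0} \<and> lab (\<psi> v) = q"
proof -
  have "e \<subseteq> verts H" using H assms(1) unfolding simple_graph_def nsets_def by auto
  then show ?thesis using lift_interior_vertex[OF copy_lift[OF assms(1)] assms(2,3)] u0 by blast
qed

lemma boundary_lift:
  assumes "e \<in> edges H" shows "u0 \<in> e \<longleftrightarrow> x \<in> P e \<or> y \<in> P e"
proof
  assume "u0 \<in> e"
  then show "x \<in> P e \<or> y \<in> P e" using lift_boundary_vertex_conv[OF copy_lift[OF assms]] u0 by blast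
next
  assume a: "x \<in> P e \<or> y \<in> P e"
  have "e \<subseteq> verts H" using H assms unfolding simple_graph_def nsets_def by auto
  then show "u0 \<in> e" using lift_boundary_vertex[OF copy_lift[OF assms] a] interior by blast
qed

lemma P_surj:
  assumes "f \<in> edges H - {{x, y}}" obtains e where "e \<in> edges H - {{u0, w1}}" "P e = f"
  using P_bij assms unfolding bij_betw_def by (metis imageE)

end

section \<open>Excluding rainbow copies when \<open>xy\<close> lies in a triangle\<close>

context gadget_graph
begin

text \<open>Both \<open>xa\<close> and \<open>ya\<close> have preimages at \<open>u0\<close> other
  than the edge to \<open>w1\<close>. Their other ends are different vertices over \<open>a\<close>,
  hence \<open>w1\<close> and \<open>w2\<close>, so one of the preimages is the excluded edge after
  all.\<close>

lemma no_rainbow_copy_triangle: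
  assumes a: "{x, a} \<in> edges H" "{y, a} \<in> edges H"
  shows "\<not> rainbow_emb H (V, gedges) gcolour \<psi>"
proof
  assume "rainbow_emb H (V, gedges) gcolour \<psi>"
  then obtain G P u0 w1 w2 w r where "gadget_copy H x y \<sigma> V U gad lab \<rho> \<psi> G P u0 w1 w2 w r"
    using rainbow_copy_structure by blast
  then interpret gadget_copy H x y \<sigma> V U gad lab \<rho> \<psi> G P u0 w1 w2 w r .
  have ax: "a \<notin> {x, y}" using simple_graph_edgeD[OF H a(1)] simple_graph_edgeD[OF H a(2)] by auto
  have ov: "\<exists>v. {u0, v} \<in> edges H - {{u0, w1}} \<and> P {u0, v} = {s, a} \<and> v \<in> verts H - {u0} \<and> lab (\<psi> v) = a"
    if s: "s \<in> {x, y}" for s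
  proof -
    have "{s, a} \<in> edges H - {{x, y}}" using s a ax by (auto simp: doubleton_eq_iff)
    then obtain e where e: "e \<in> edges H - {{u0, w1}}" "P e = {s, a}" by (rule P_surj)
    then have eE: "e \<in> edges H" by blast
    obtain v where v: "v \<in> e" "v \<in> verts H - {u0}" "lab (\<psi> v) = a"
      using interior_lift[OF eE, of a] e ax by auto
    have "u0 \<in> e" using boundary_lift[OF eE] e s by auto
    then have "e = {u0, v}" using v by (intro simple_graph_edge_eq[OF H eE]) auto
    then show ?thesis using e v by blast
  qed
  obtain vx where vx: "{u0, vx} \<in> edges H - {{u0, w1}}" "P {u0, vx} = {x, a}" "vx \<in> verts H - {u0}" "lab (\<psi> vx) = a"
    using ov[of x] by blast
  obtain vy where vy: "{u0, vy} \<in> edges H - {{u0, w1}}" "P {u0, vy} = {y, a}" "vy \<in> verts H - {u0}" "lab (\<psi> vy) = a"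
    using ov[of y] by blast
  have "{x, a} \<noteq> {y, a}" using xy_ne ax by (auto simp: doubleton_eq_iff)
  then have "vx \<noteq> vy" using vx vy by auto
  then have "{vx, vy} = {w1, w2}" using collision vx vy by metis
  then show False using vx vy by (auto simp: doubleton_eq_iff)
qed

end

definition bad_edge :: "'a graph \<Rightarrow> 'a set \<Rightarrow> bool" where
  "bad_edge H e \<longleftrightarrow> e \<in> edges H \<and> \<not> pendant H e \<and> \<not> in_triangle H e"

section \<open>Excluding rainbow copies when \<open>xy\<close> lies in no triangle\<close>

context gadget_copy
begin

text \<open>The projection on vertices. It is not a function because \<open>u0\<close> lies over
  both \<open>x\<close> and \<open>y\<close>.\<close>

definition over :: "'a \<Rightarrow> 'a \<Rightarrow> bool" where
  "over v a \<longleftrightarrow> (v = u0 \<and> a \<in> {x, y}) \<or> (v \<in> verts H - {u0} \<and> a \<notin> {x, y} \<and> lab (\<psi> v) = a)"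

lemma over_unique: "over v a \<Longrightarrow> over v' a \<Longrightarrow> v \<noteq> v' \<Longrightarrow> a = w \<and> {v, v'} = {w1, w2}"
  using collision[of v v'] w12(4,5) unfolding over_def by (auto simp: doubleton_eq_iff)

lemma over_lift:
  assumes e: "e \<in> edges H" and P: "P e = {a, b}"
  obtains v v' where "e = {v, v'}" "over v a" "over v' b"
proof -
  have f: "{a, b} \<in> edges H - {{x, y}}" using lift_edge[OF copy_lift[OF e]] P by simp
  then have ab: "a \<noteq> b" using simple_graph_edgeD[OF H] by blast
  have ex: "\<exists>v\<in>e. over v q" if q: "q \<in> {a, b}" for q
  proof (cases "q \<in> {x, y}")
    case True
    then have "u0 \<in> e" using boundary_lift[OF e] P q by auto
    then show ?thesis using True unfolding over_def by blast
  next
    case False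
    then show ?thesis using interior_lift[OF e _ False] P q unfolding over_def by auto
  qed
  then obtain v v' where v: "v \<in> e" "over v a" "v' \<in> e" "over v' b" by blast
  have "v \<noteq> v'"
  proof
    assume eq: "v = v'"
    then have "{a, b} = {x, y}" using v(2,4) ab unfolding over_def by auto
    then show False using f by blast
  qed
  then show thesis using v simple_graph_edge_eq[OF H e] by (intro that[of v v']) auto
qed

text \<open>A path of the copy can change the gadget only at \<open>u0\<close>, the one vertex of
  the copy outside the gadgets.\<close>

lemma over_gad:
  assumes "{v, v'} \<in> edges H" "v \<noteq> u0" "v' \<noteq> u0"
  shows "gad (\<psi> v) = gad (\<psi> v')"
proof -
  have "v \<in> verts H" "v' \<in> verts H" using simple_graph_edgeD[OF H assms(1)] by auto
  then have "\<psi> v \<notin> U" "\<psi> v' \<notin> U" using interior assms by auto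
  then show ?thesis using lift_label(2)[OF copy_lift[OF assms(1)]] by (metis image_eqI insertCI)
qed

lemma u0_w_edge: "v \<in> {w1, w2} \<Longrightarrow> {u0, v} \<in> edges H" "v \<in> {w1, w2} \<Longrightarrow> {v, u0} \<in> edges H"
  using u0w by (auto simp: insert_commute)

text \<open>The triangle at \<open>P e\<close> does not contain the edge \<open>xy\<close>, so its
  three edges have preimages. These form a triangle unless the preimages meeting over
  \<open>w\<close> end in \<open>w1\<close> and in \<open>w2\<close>. They then form a path between
  different gadgets, so one of its two inner vertices is \<open>u0\<close>; since \<open>u0\<close>
  is adjacent to both \<open>w1\<close> and \<open>w2\<close>, there is again a triangle. The
  exclusion of the edges from \<open>u0\<close> to \<open>w1\<close> and \<open>w2\<close> ensures
  that this triangle contains \<open>e\<close>.\<close>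

lemma in_triangle_lift:
  assumes no: "\<not> in_triangle H {x, y}"
    and e: "e \<in> edges H - {{u0, w1}, {u0, w2}}" and tri: "in_triangle H (P e)"
  shows "in_triangle H e"
proof -
  have eE: "e \<in> edges H" using e by blast
  have f: "P e \<in> edges H - {{x, y}}" using lift_edge[OF copy_lift[OF eE]] .
  obtain a b where ab: "P e = {a, b}" "a \<noteq> b" using simple_graph_edgeE[OF H, of "P e"] f by blast
  then obtain d where d: "{a, b} \<in> edges H" "{a, d} \<in> edges H" "{b, d} \<in> edges H"
    using tri in_triangle_iff[OF H ab(2)] ab(1) by auto
  have "{d, b} \<in> edges H" "{b, a} \<in> edges H" "{d, a} \<in> edges H" using d by (simp_all add: insert_commute)
  then have tri': "in_triangle H {a, d}" "in_triangle H {b, d}"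
    using d in_triangle_iff[OF H simple_graph_edgeD(1)[OF H d(2)]]
      in_triangle_iff[OF H simple_graph_edgeD(1)[OF H d(3)]] by blast+
  then have d': "{a, d} \<in> edges H - {{x, y}}" "{b, d} \<in> edges H - {{x, y}}" using d no by auto
  obtain e' where e': "e' \<in> edges H" "P e' = {a, d}" using P_surj[OF d'(1)] by blast
  obtain e'' where e'': "e'' \<in> edges H" "P e'' = {b, d}" using P_surj[OF d'(2)] by blast
  obtain va vb where v: "e = {va, vb}" "over va a" "over vb b" by (rule over_lift[OF eE ab(1)])
  obtain va' vd where v': "e' = {va', vd}" "over va' a" "over vd d" by (rule over_lift[OF e'])
  obtain vb' vd' where v'': "e'' = {vb', vd'}" "over vb' b" "over vd' d" by (rule over_lift[OF e''])
  have dab: "d \<noteq> a" "d \<noteq> b" using simple_graph_edgeD(1)[OF H d(2)] simple_graph_edgeD(1)[OF H d(3)] by auto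
  have E: "{va, vb} \<in> edges H" "{va', vd} \<in> edges H" "{vb', vd'} \<in> edges H" using eE e' e'' v v' v'' by auto
  have ne: "va \<noteq> vb" using simple_graph_edgeD[OF H E(1)] by blast
  have gw: "gad (\<psi> w1) \<noteq> gad (\<psi> w2)" by (rule w12)
  have wu: "w1 \<noteq> u0" "w2 \<noteq> u0" using w12 by auto
  have gw': "gad (\<psi> p) \<noteq> gad (\<psi> q) \<and> p \<noteq> u0 \<and> q \<noteq> u0" if "{p, q} = {w1, w2}" for p q
    using that gw wu by (auto simp: doubleton_eq_iff)
  have goal: "in_triangle H e" if "{va, z} \<in> edges H" "{vb, z} \<in> edges H" for z
    unfolding v(1) in_triangle_iff[OF H ne] using E(1) that by blast
  consider "va \<noteq> va'" | "vb \<noteq> vb'" | "va = va'" "vb = vb'" "vd \<noteq> vd'" | "va = va'" "vb = vb'" "vd = vd'" by blast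
  then show ?thesis
  proof cases
    case 1
    then have w: "a = w" "{va, va'} = {w1, w2}" using over_unique v v' by blast+
    then have eq: "vb = vb'" "vd = vd'" using over_unique v v' v'' ab dab by metis+
    have wa: "va \<in> {w1, w2}" using w by blast
    have "vb \<noteq> u0" using e v wa by (auto simp: insert_commute)
    have "vd = u0"
    proof (rule ccontr)
      assume n: "vd \<noteq> u0"
      have g: "gad (\<psi> va) \<noteq> gad (\<psi> va')" "va \<noteq> u0" "va' \<noteq> u0" using gw'[OF w(2)] by auto
      have "gad (\<psi> va) = gad (\<psi> vb)" "gad (\<psi> va') = gad (\<psi> vd)" "gad (\<psi> vb) = gad (\<psi> vd)"
        using over_gad[OF E(1)] over_gad[OF E(2)] over_gad[OF E(3)] eq n g \<open>vb \<noteq> u0\<close> by simp_all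
      then show False using g by simp
    qed
    then show ?thesis using goal[of u0] E(3) eq u0_w_edge(2)[OF wa] by simp
  next
    case 2
    then have w: "b = w" "{vb, vb'} = {w1, w2}" using over_unique v v'' by blast+
    then have eq: "va = va'" "vd = vd'" using over_unique v v' v'' ab dab by metis+
    have wb: "vb \<in> {w1, w2}" using w by blast
    have "va \<noteq> u0" using e v wb by auto
    have "vd = u0"
    proof (rule ccontr)
      assume n: "vd \<noteq> u0"
      have g: "gad (\<psi> vb) \<noteq> gad (\<psi> vb')" "vb \<noteq> u0" "vb' \<noteq> u0" using gw'[OF w(2)] by auto
      have "gad (\<psi> va) = gad (\<psi> vb)" "gad (\<psi> va') = gad (\<psi> vd)" "gad (\<psi> vb') = gad (\<psi> vd)"
        using over_gad[OF E(1)] over_gad[OF E(2)] over_gad[OF E(3)] eq n g \<open>va \<noteq> u0\<close> by simp_all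
      then show False using g eq by simp
    qed
    then show ?thesis using goal[of u0] E(2) eq u0_w_edge(2)[OF wb] by simp
  next
    case 3
    then have w: "{vd, vd'} = {w1, w2}" using over_unique v' v'' by blast
    then have wd: "vd \<in> {w1, w2}" "vd' \<in> {w1, w2}" by blast+
    have g: "gad (\<psi> vd) \<noteq> gad (\<psi> vd')" "vd \<noteq> u0" "vd' \<noteq> u0" using gw'[OF w] by auto
    have "va = u0 \<or> vb = u0"
    proof (rule ccontr)
      assume n: "\<not> ?thesis"
      have "gad (\<psi> va) = gad (\<psi> vb)" "gad (\<psi> va) = gad (\<psi> vd)" "gad (\<psi> vb) = gad (\<psi> vd')"
        using over_gad[OF E(1)] over_gad[OF E(2)] over_gad[OF E(3)] 3 n g by simp_all
      then show False using g by simp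
    qed
    then show ?thesis using goal[of vd'] goal[of vd] E 3 u0_w_edge(1)[OF wd(1)] u0_w_edge(1)[OF wd(2)] by auto
  next
    case 4
    then show ?thesis using goal[of vd] E by simp
  qed
qed

text \<open>The leaf \<open>a\<close> of \<open>P e\<close> is neither \<open>x\<close> nor
  \<open>y\<close>, by their degrees, so some vertex \<open>v\<close> of \<open>e\<close> lies over
  it. Every edge at \<open>v\<close> projects to the only edge at \<open>a\<close>, and
  \<open>e\<close> shares its projection with no other edge.\<close>

lemma pendant_lift:
  assumes deg: "degree H x \<ge> 2" "degree H y \<ge> 2"
    and e: "e \<in> edges H - {{u0, w1}, {u0, w2}}" and pend: "pendant H (P e)"
  shows "pendant H e"
proof -
  have eE: "e \<in> edges H" using e by blast
  obtain a where a: "a \<in> P e" "degree H a = 1" "P e \<in> edges H" using pend unfolding pendant_def by blast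
  have axy: "a \<notin> {x, y}" using a deg by auto
  obtain v where v: "v \<in> e" "v \<in> verts H - {u0}" "lab (\<psi> v) = a" using interior_lift[OF eE a(1) axy] by blast
  have "{e' \<in> edges H. v \<in> e'} = {e}"
  proof (intro equalityI subsetI)
    fix e' assume "e' \<in> {e' \<in> edges H. v \<in> e'}"
    then have e': "e' \<in> edges H" "v \<in> e'" by auto
    have "a \<in> P e'" using lift_label(1)[OF copy_lift[OF e'(1)], of "\<psi> v"] e' v interior by auto
    moreover have "P e' \<in> edges H" using lift_edge[OF copy_lift[OF e'(1)]] by blast
    ultimately have "P e' \<in> {f \<in> edges H. a \<in> f}" "P e \<in> {f \<in> edges H. a \<in> f}" using a by auto
    moreover have "card {f \<in> edges H. a \<in> f} = 1" using a(2) unfolding degree_def .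
    ultimately have PP: "P e' = P e" by (metis card_1_singletonE singletonD)
    show "e' \<in> {e}"
    proof (cases "e' = {u0, w1}")
      case True
      then have "P e = P {u0, w2}" using PP u0w by simp
      moreover have "{u0, w2} \<in> edges H - {{u0, w1}}" using u0w w12 by (auto simp: doubleton_eq_iff)
      ultimately have "e = {u0, w2}" using P_bij e unfolding bij_betw_def inj_on_def by blast
      then show ?thesis using e by blast
    next
      case False
      then show ?thesis using PP P_bij e e' unfolding bij_betw_def inj_on_def by blast
    qed
  qed (use eE v in auto)
  then have "degree H v = 1" unfolding degree_def by simp
  then show ?thesis using eE v unfolding pendant_def by blast
qed

text \<open>Apart from the edge to \<open>w1\<close>, the edges at \<open>u0\<close> correspond to
  the edges other than \<open>xy\<close> that meet {x, y}; there are deg x + deg y - 2 of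
  them.\<close>

lemma degree_u0: "degree H u0 + 1 = degree H x + degree H y"
proof -
  have fin: "finite (edges H)" by (rule simple_graph_finite_edges[OF H])
  let ?e1 = "{u0, w1}"
  define B where "B = {f \<in> edges H - {{x, y}}. x \<in> f \<or> y \<in> f}"
  have "P ` {e \<in> edges H - {?e1}. u0 \<in> e} = B"
  proof (intro equalityI subsetI)
    fix f assume "f \<in> P ` {e \<in> edges H - {?e1}. u0 \<in> e}"
    then show "f \<in> B" unfolding B_def using boundary_lift lift_edge[OF copy_lift] by auto
  next
    fix f assume f: "f \<in> B"
    then obtain e where "e \<in> edges H - {?e1}" "P e = f" using P_surj[of f] unfolding B_def by blast
    then show "f \<in> P ` {e \<in> edges H - {?e1}. u0 \<in> e}" using f boundary_lift unfolding B_def by auto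
  qed
  moreover have "inj_on P {e \<in> edges H - {?e1}. u0 \<in> e}"
    using P_bij unfolding bij_betw_def by (rule_tac inj_on_subset) auto
  ultimately have cB: "card {e \<in> edges H - {?e1}. u0 \<in> e} = card B" using card_image by metis
  have "{e \<in> edges H. u0 \<in> e} = insert ?e1 {e \<in> edges H - {?e1}. u0 \<in> e}" using u0w by auto
  then have "degree H u0 = card B + 1" unfolding degree_def cB[symmetric] using fin by simp
  moreover have "card B + 2 = degree H x + degree H y"
  proof -
    let ?X = "{f \<in> edges H. x \<in> f}" and ?Y = "{f \<in> edges H. y \<in> f}"
    have "f = {x, y}" if "f \<in> ?X" "f \<in> ?Y" for f
      using that simple_graph_edge_eq[OF H _ _ _ xy_ne] by blast
    then have "card ((?X - {{x, y}}) \<union> (?Y - {{x, y}})) = card (?X - {{x, y}}) + card (?Y - {{x, y}})"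
      using fin by (intro card_Un_disjoint) auto
    moreover have BXY: "(?X - {{x, y}}) \<union> (?Y - {{x, y}}) = B" unfolding B_def by auto
    moreover have mem: "{x, y} \<in> ?X" "{x, y} \<in> ?Y" and finXY: "finite ?X" "finite ?Y" using xy fin by auto
    note card_Suc_Diff1[OF finXY(1) mem(1)] card_Suc_Diff1[OF finXY(2) mem(2)]
    ultimately show ?thesis unfolding degree_def BXY by linarith
  qed
  ultimately show ?thesis by simp
qed

end

context gadget_graph
begin

text \<open>If \<open>xy\<close> has maximum degree sum among the bad edges, the two edges of a copy that project to the
  same edge cannot be bad, as their degree sum is too large. Since all other good edges lift to good
  edges, the copy would have more good edges than \<open>H\<close>.\<close>
lemma no_rainbow_copy_bad_edge:
  assumes bad: "bad_edge H {x, y}"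
    and max: "\<And>a b. bad_edge H {a, b} \<Longrightarrow> degree H a + degree H b \<le> degree H x + degree H y"
    and deg: "degree H x \<ge> 2" "degree H y \<ge> 2"
  shows "\<not> rainbow_emb H (V, gedges) gcolour \<psi>"
proof
  assume "rainbow_emb H (V, gedges) gcolour \<psi>"
  then obtain G P u0 w1 w2 w r where "gadget_copy H x y \<sigma> V U gad lab \<rho> \<psi> G P u0 w1 w2 w r"
    using rainbow_copy_structure by blast
  then interpret gadget_copy H x y \<sigma> V U gad lab \<rho> \<psi> G P u0 w1 w2 w r .
  have fin: "finite (edges H)" by (rule simple_graph_finite_edges[OF H])
  define Good where "Good = {e \<in> edges H. pendant H e \<or> in_triangle H e}"
  have finG: "finite Good" unfolding Good_def using fin by simp
  \<comment> \<open>If the edge from \<open>u0\<close> to \<open>v\<close> were bad,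
    \<open>v\<close> would have degree at least 2, and the degree sum would be at least deg x + deg
    y - 1 + 2, above the maximum.\<close>
  have good_w: "{u0, v} \<in> Good" if v: "v \<in> {w1, w2}" for v
  proof (rule ccontr)
    have e: "{u0, v} \<in> edges H" by (rule u0_w_edge(1)[OF v])
    assume "{u0, v} \<notin> Good"
    then have b: "bad_edge H {u0, v}" using e unfolding Good_def bad_edge_def by blast
    then have "degree H v \<noteq> 1" unfolding bad_edge_def pendant_def by blast
    moreover have "degree H v \<noteq> 0" unfolding degree_def using e fin by auto
    ultimately have "degree H v \<ge> 2" by simp
    then show False using max[OF b] degree_u0 by simp
  qed
  have no: "\<not> in_triangle H {x, y}" using bad unfolding bad_edge_def by blast
  let ?e1 = "{u0, w1}" and ?e2 = "{u0, w2}"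
  have e12: "?e1 \<noteq> ?e2" using w12 by (auto simp: doubleton_eq_iff)
  \<comment> \<open>Good edges outside \<open>P ?e1\<close> have good preimages other than the two
    edges to \<open>w1\<close> and \<open>w2\<close>, which are good as well. So card Good - 1 \<le>
    card Good - 2.\<close>
  have "Good - {P ?e1} \<subseteq> P ` (Good - {?e1, ?e2})"
  proof
    fix f assume f: "f \<in> Good - {P ?e1}"
    then have "f \<in> edges H - {{x, y}}" using bad unfolding Good_def bad_edge_def by auto
    then obtain e where e: "e \<in> edges H - {?e1}" "P e = f" by (rule P_surj)
    have "e \<noteq> ?e2" using e f u0w by auto
    then have e': "e \<in> edges H - {?e1, ?e2}" using e by blast
    then have "e \<in> Good" using f e(2) pendant_lift[OF deg e'] in_triangle_lift[OF no e'] unfolding Good_def by auto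
    then show "f \<in> P ` (Good - {?e1, ?e2})" using e e' by blast
  qed
  then have "card (Good - {P ?e1}) \<le> card (Good - {?e1, ?e2})"
    using surj_card_le[of "Good - {?e1, ?e2}"] finG by blast
  moreover have "card Good - 1 \<le> card (Good - {P ?e1})" using finG by (simp add: card_Diff_singleton_if)
  moreover have "card (Good - {?e1, ?e2}) = card Good - 2"
    using good_w[of w1] good_w[of w2] e12 by (subst card_Diff_subset) auto
  moreover have "card Good \<ge> 2" using card_mono[OF finG, of "{?e1, ?e2}"] good_w[of w1] good_w[of w2] e12 by simp
  ultimately show False by simp
qed

text \<open>The gadget \<open>g\<close> avoids colour \<open>i\<close>; with \<open>u\<close> as
  \<open>x\<close> and \<open>v\<close> as \<open>y\<close>, it lacks only the edge
  \<open>xy\<close>. If \<open>i\<close> exceeds e(H), no edge of the gadget graph has colour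
  \<open>i\<close>, and the gadgets avoiding 1 are taken by default.\<close>

lemma new_edge_rainbow_copy:
  assumes uv: "u \<in> U" "v \<in> U" "u \<noteq> v" and i: "i \<ge> 1"
    and g: "fst g = (if i \<le> card (edges H) then i else 1)"
    and \<kappa>: "\<And>q. q \<in> verts H - {x, y} \<Longrightarrow> \<exists>p\<in>V - U. gad p = g \<and> lab p = q"
    and roles: "x \<in> \<rho> u g" "y \<in> \<rho> v g"
  shows "\<exists>\<psi>. rainbow_emb H (V, insert {u, v} gedges) (gcolour({u, v} := i)) \<psi>"
proof -
  obtain \<kappa> where k: "\<And>q. q \<in> verts H - {x, y} \<Longrightarrow> \<kappa> q \<in> V - U \<and> gad (\<kappa> q) = g \<and> lab (\<kappa> q) = q"
    using \<kappa> by metis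
  define \<psi> where "\<psi> = (\<lambda>z. if z = x then u else if z = y then v else \<kappa> z)"
  have inj: "inj_on \<psi> (verts H)"
  proof (rule inj_onI)
    fix a b assume ab: "a \<in> verts H" "b \<in> verts H" "\<psi> a = \<psi> b"
    have "\<kappa> q \<noteq> u \<and> \<kappa> q \<noteq> v" if "q \<in> verts H - {x, y}" for q using k[OF that] uv by auto
    moreover have "a = b" if "a \<in> verts H - {x, y}" "b \<in> verts H - {x, y}" "\<kappa> a = \<kappa> b" using k that by metis
    ultimately show "a = b" using ab uv(3) unfolding \<psi>_def by (auto split: if_splits)
  qed
  have img: "\<psi> ` verts H \<subseteq> V" using k uv UV unfolding \<psi>_def by auto
  have xy_img: "\<psi> ` {x, y} = {u, v}" unfolding \<psi>_def using xy_ne by auto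
  have l: "lift (\<psi> ` e) g e" if e: "e \<in> edges H - {{x, y}}" for e
  proof -
    obtain a b where ab: "e = {a, b}" "a \<in> verts H" "b \<in> verts H" "a \<noteq> b" "b \<notin> {x, y}"
    proof -
      obtain a b where ab: "e = {a, b}" "a \<in> verts H" "b \<in> verts H" "a \<noteq> b"
        using simple_graph_edgeE[OF H, of e] e by blast
      then have "a \<notin> {x, y} \<or> b \<notin> {x, y}" using e by auto
      then show thesis using ab that[of a b] that[of b a] by (auto simp: insert_commute)
    qed
    have b: "\<psi> b = \<kappa> b" "b \<in> verts H - {x, y}" using ab unfolding \<psi>_def by auto
    have im: "\<psi> ` e = {\<psi> a, \<kappa> b}" using ab b by auto
    have eE: "e \<in> edges H" using e by blast
    consider "a = x" | "a = y" | "a \<in> verts H - {x, y}" using ab by blast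
    then show ?thesis
    proof cases
      case 1
      then have "\<psi> a = u" unfolding \<psi>_def by simp
      then have "u \<in> U \<and> \<kappa> b \<in> V - U \<and> \<psi> ` e = {u, \<kappa> b} \<and> gad (\<kappa> b) = g \<and> x \<in> \<rho> u g \<and> e = {x, lab (\<kappa> b)} \<and> e \<in> edges H"
        using im uv roles k[OF b(2)] 1 ab eE by simp
      then show ?thesis unfolding lift_def by blast
    next
      case 2
      then have "\<psi> a = v" unfolding \<psi>_def using xy_ne by simp
      then have "v \<in> U \<and> \<kappa> b \<in> V - U \<and> \<psi> ` e = {v, \<kappa> b} \<and> gad (\<kappa> b) = g \<and> y \<in> \<rho> v g \<and> e = {y, lab (\<kappa> b)} \<and> e \<in> edges H"
        using im uv roles k[OF b(2)] 2 ab eE by simp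
      then show ?thesis unfolding lift_def by blast
    next
      case 3
      then have "\<psi> a = \<kappa> a" unfolding \<psi>_def by auto
      then have "\<kappa> a \<in> V - U \<and> \<kappa> b \<in> V - U \<and> \<psi> ` e = {\<kappa> a, \<kappa> b} \<and> gad (\<kappa> a) = g \<and> gad (\<kappa> b) = g \<and>
          e = {lab (\<kappa> a), lab (\<kappa> b)} \<and> e \<in> edges H"
        using im k[OF 3] k[OF b(2)] ab eE by simp
      then show ?thesis unfolding lift_def by blast
    qed
  qed
  have ge: "\<psi> ` e \<in> gedges" if "e \<in> edges H - {{x, y}}" for e using l[OF that] unfolding gedges_def by blast
  have uvn: "{u, v} \<notin> gedges" using gedges_meet uv by blast
  define d where "d = gcolour({u, v} := i)"
  have dxy: "d (\<psi> ` {x, y}) = i" unfolding xy_img d_def by simp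
  have de: "d (\<psi> ` e) = gcol g e" if e: "e \<in> edges H - {{x, y}}" for e
    using ge[OF e] uvn gcolour_lift[OF l[OF e]] unfolding d_def by auto
  have ci: "gcol g e \<noteq> i" if e: "e \<in> edges H - {{x, y}}" for e
    using \<sigma>_range[OF e] g i gcol_range[OF e, of g] unfolding gcol_def by (auto split: if_splits)
  have cinj: "e = e'" if e: "e \<in> edges H - {{x, y}}" "e' \<in> edges H - {{x, y}}" "gcol g e = gcol g e'" for e e'
    using \<sigma>_range[OF e(1)] \<sigma>_range[OF e(2)] e(3) \<sigma>_inj[OF e(1,2)] unfolding gcol_def by (auto split: if_splits)
  have "inj_on (\<lambda>e. d (\<psi> ` e)) (edges H)"
  proof (rule inj_onI)
    fix e e' assume e: "e \<in> edges H" "e' \<in> edges H" "d (\<psi> ` e) = d (\<psi> ` e')"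
    show "e = e'"
    proof (cases "e = {x, y}"; cases "e' = {x, y}")
      assume "e = {x, y}" "e' \<noteq> {x, y}"
      then show ?thesis using ci[of e'] de[of e'] dxy e by auto
    next
      assume "e \<noteq> {x, y}" "e' = {x, y}"
      then show ?thesis using ci[of e] de[of e] dxy e by auto
    next
      assume "e \<noteq> {x, y}" "e' \<noteq> {x, y}"
      then show ?thesis using cinj[of e e'] de[of e] de[of e'] e by auto
    qed simp
  qed
  moreover have "\<psi> ` e \<in> insert {u, v} gedges" if "e \<in> edges H" for e
    using xy_img ge[of e] that by (cases "e = {x, y}") auto
  ultimately have "rainbow_emb H (V, insert {u, v} gedges) d \<psi>" unfolding rainbow_emb_def using inj img by auto
  then show ?thesis unfolding d_def by blast
qed

end

section \<open>Placing the gadgets on an initial segment, and the resulting upper bounds\<close>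

lemma gadget_graph_exists:
  assumes H: "simple_graph H" "connected_graph H"
    and xy: "{x, y} \<in> edges H" "\<exists>a. a \<noteq> y \<and> {x, a} \<in> edges H" "\<exists>a. a \<noteq> x \<and> {y, a} \<in> edges H"
    and \<rho>: "\<And>u g. \<rho> u g \<subseteq> {x, y}"
    and excl: "\<And>u g a. {x, y} \<subseteq> \<rho> u g \<Longrightarrow> {x, a} \<in> edges H \<Longrightarrow> {y, a} \<notin> edges H"
    and n: "card (edges H) * B * (card (verts H) - 2) \<le> n"
  obtains \<sigma> U gad lab where "gadget_graph H x y \<sigma> {..<n::nat} U gad lab \<rho>"
    "card ({..<n} - U) = card (edges H) * B * (card (verts H) - 2)"
    "\<And>i b q. i \<in> {1..card (edges H)} \<Longrightarrow> b < B \<Longrightarrow> q \<in> verts H - {x, y} \<Longrightarrow>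
       \<exists>p\<in>{..<n} - U. gad p = (i, b) \<and> lab p = q"
proof -
  let ?E = "edges H"
  have fin: "finite ?E" "finite (verts H)" using simple_graph_finite_edges[OF H(1)] H(1) unfolding simple_graph_def by auto
  have v: "x \<noteq> y" "x \<in> verts H" "y \<in> verts H" using simple_graph_edgeD[OF H(1) xy(1)] by auto
  have "card (?E - {{x, y}}) = card {2..card ?E}" using fin xy by simp
  then obtain \<sigma> where s: "bij_betw \<sigma> (?E - {{x, y}}) {2..card ?E}"
    using finite_same_card_bij[of "?E - {{x, y}}" "{2..card ?E}"] fin by auto
  \<comment> \<open>One vertex for each avoided colour, each of \<open>B\<close> gadgets per colour,
    and each label; \<open>\<beta>\<close> enumerates them by the first \<open>M\<close>
    numbers.\<close>
  define T where "T = ({1..card ?E} \<times> {..<B}) \<times> (verts H - {x, y})"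
  define M where "M = card ?E * B * (card (verts H) - 2)"
  have "card (verts H - {x, y}) = card (verts H) - card {x, y}" using v by (intro card_Diff_subset) auto
  then have "card (verts H - {x, y}) = card (verts H) - 2" using v(1) by simp
  then have "card T = M" unfolding T_def M_def by (simp add: card_cartesian_product)
  moreover have "finite T" unfolding T_def using fin by auto
  ultimately obtain \<beta> where \<beta>: "bij_betw \<beta> {..<M} T"
    using ex_bij_betw_nat_finite[of T] by (auto simp: atLeast0LessThan)
  define U where "U = {M..<n}"
  have VU: "{..<n} - U = {..<M}" unfolding U_def using n M_def by auto
  have c2: "card (verts H) \<ge> 2" using card_mono[OF fin(2), of "{x, y}"] v by simp
  have \<beta>T: "\<beta> p \<in> T" if "p < M" for p using \<beta> that unfolding bij_betw_def by blast
  have "gadget_graph H x y \<sigma> {..<n} U (fst \<circ> \<beta>) (snd \<circ> \<beta>) \<rho>"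
  proof
    show "\<And>a. a \<in> verts H \<Longrightarrow> \<exists>b. {a, b} \<in> edges H" using connected_graph_edge_ex[OF H c2] by blast
    show "U \<subseteq> {..<n}" unfolding U_def by auto
    show "(snd \<circ> \<beta>) p \<in> verts H - {x, y}" if "p \<in> {..<n} - U" for p
      using that \<beta>T[of p] unfolding VU T_def by auto
    show "p = q" if "p \<in> {..<n} - U" "q \<in> {..<n} - U" "(fst \<circ> \<beta>) p = (fst \<circ> \<beta>) q" "(snd \<circ> \<beta>) p = (snd \<circ> \<beta>) q" for p q
    proof -
      have "\<beta> p = \<beta> q" using that(3,4) by (simp add: prod_eq_iff)
      then show ?thesis using \<beta> that(1,2) unfolding VU bij_betw_def inj_on_def by blast
    qed
  qed (fact H xy s \<rho> excl)+
  then show thesis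
  proof (rule that)
    show "card ({..<n} - U) = card (edges H) * B * (card (verts H) - 2)" unfolding VU M_def by simp
    fix i b q assume "i \<in> {1..card (edges H)}" "b < B" "q \<in> verts H - {x, y}"
    then have "((i, b), q) \<in> T" unfolding T_def by auto
    then obtain p where "p < M" "\<beta> p = ((i, b), q)" using \<beta> unfolding bij_betw_def by (metis imageE lessThan_iff)
    then show "\<exists>p\<in>{..<n} - U. (fst \<circ> \<beta>) p = (i, b) \<and> (snd \<circ> \<beta>) p = q"
      unfolding VU by (intro bexI[of _ p]) auto
  qed
qed

text \<open>If every pair in \<open>U\<close> meets some complete gadget of every avoided colour in
  opposite roles, all pairs inside \<open>U\<close> are saturated. Only pairs meeting a gadget can
  then be edges of a maximal extension.\<close>

lemma gadget_graph_bound: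
  assumes gg: "gadget_graph H x y \<sigma> {..<n::nat} U gad lab \<rho>" and t: "t \<ge> card (edges H)"
    and free: "\<And>\<psi>. \<not> rainbow_emb H ({..<n}, gadget_graph.gedges H {..<n} U gad lab \<rho>)
      (gadget_graph.gcolour H \<sigma> {..<n} U gad lab \<rho>) \<psi>"
    and pairs: "\<And>u v i. u \<in> U \<Longrightarrow> v \<in> U \<Longrightarrow> u \<noteq> v \<Longrightarrow> i \<in> {1..card (edges H)} \<Longrightarrow>
      \<exists>g. fst g = i \<and> (\<forall>q\<in>verts H - {x, y}. \<exists>p\<in>{..<n} - U. gad p = g \<and> lab p = q) \<and>
        (x \<in> \<rho> u g \<and> y \<in> \<rho> v g \<or> x \<in> \<rho> v g \<and> y \<in> \<rho> u g)"
  shows "rainbow_sat t n H \<le> card ({..<n} - U) * n"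
proof -
  interpret gadget_graph H x y \<sigma> "{..<n}" U gad lab \<rho> by (rule gg)
  define S where "S = {e \<in> nsets {..<n} 2. \<not> e \<subseteq> U}"
  have "rainbow_sat t n H \<le> card S"
  proof (rule rainbow_sat_le[OF H, of S n gedges gcolour])
    show "S \<subseteq> nsets {..<n} 2" unfolding S_def by blast
    show "gedges \<subseteq> S" using gedges_subset gedges_meet unfolding S_def by blast
    show "\<And>e. e \<in> gedges \<Longrightarrow> gcolour e \<in> {1..t}" using gcolour_range t by fastforce
    show "\<nexists>\<psi>. rainbow_emb H ({..<n}, gedges) gcolour \<psi>" using free by blast
    fix e i assume e: "e \<in> nsets {..<n} 2" "e \<notin> S" and i: "i \<in> {1..t}"
    obtain u v where uv: "e = {u, v}" "u \<noteq> v" using e(1) by (rule nsets_2E)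
    have U: "u \<in> U" "v \<in> U" using e uv unfolding S_def by auto
    have "finite (edges H)" by (rule simple_graph_finite_edges[OF H])
    then have "card (edges H) \<ge> 1" using xy by (metis One_nat_def Suc_leI card_gt_0_iff empty_iff)
    then have "(if i \<le> card (edges H) then i else 1) \<in> {1..card (edges H)}" using i by auto
    then obtain g where g: "fst g = (if i \<le> card (edges H) then i else 1)"
      "\<And>q. q \<in> verts H - {x, y} \<Longrightarrow> \<exists>p\<in>{..<n} - U. gad p = g \<and> lab p = q"
      "x \<in> \<rho> u g \<and> y \<in> \<rho> v g \<or> x \<in> \<rho> v g \<and> y \<in> \<rho> u g"
      using pairs[OF U uv(2)] by blast
    have i1: "i \<ge> 1" using i by simp
    from g(3) show "\<exists>\<psi>. rainbow_emb H ({..<n}, insert e gedges) (gcolour(e := i)) \<psi>"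
    proof
      assume "x \<in> \<rho> u g \<and> y \<in> \<rho> v g"
      then show ?thesis unfolding uv(1) using new_edge_rainbow_copy[OF U uv(2) i1 g(1,2)] by blast
    next
      assume "x \<in> \<rho> v g \<and> y \<in> \<rho> u g"
      moreover have "e = {v, u}" using uv by auto
      ultimately show ?thesis using new_edge_rainbow_copy[OF U(2,1) uv(2)[symmetric] i1 g(1,2)] by blast
    qed
  qed
  also have "S \<subseteq> (\<lambda>(p, q). {p, q}) ` (({..<n} - U) \<times> {..<n})"
  proof
    fix e assume e: "e \<in> S"
    then have "e \<in> nsets {..<n} 2" unfolding S_def by blast
    then obtain u v where uv: "e = {u, v}" "u \<in> {..<n}" "v \<in> {..<n}" by (rule nsets_2E)
    then have "u \<notin> U \<or> v \<notin> U" using e unfolding S_def by blast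
    then have "(u, v) \<in> ({..<n} - U) \<times> {..<n} \<or> (v, u) \<in> ({..<n} - U) \<times> {..<n}" using uv by blast
    moreover have "e = (\<lambda>(p, q). {p, q}) (u, v)" "e = (\<lambda>(p, q). {p, q}) (v, u)" using uv by auto
    ultimately show "e \<in> (\<lambda>(p, q). {p, q}) ` (({..<n} - U) \<times> {..<n})" by blast
  qed
  then have "card S \<le> card (({..<n} - U) \<times> {..<n})"
    by (rule surj_card_le[rotated]) auto
  also have "\<dots> = card ({..<n} - U) * n" by (simp add: card_cartesian_product)
  finally show ?thesis .
qed

lemma ex_bit_neq:
  fixes u v :: nat
  assumes "u < 2 ^ B" "v < 2 ^ B" "u \<noteq> v"
  shows "\<exists>b<B. bit u b \<noteq> bit v b"
proof (rule ccontr)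
  assume "\<not> ?thesis"
  then have "take_bit B u = take_bit B v" by (auto intro!: bit_eqI simp: bit_take_bit_iff)
  then show False using assms by (simp add: take_bit_nat_eq_self)
qed

context
  fixes H :: "'a graph" and t :: nat
  assumes H: "simple_graph H" "connected_graph H" "card (verts H) \<ge> 3"
    and t: "t \<ge> card (edges H)"
begin

text \<open>In a gadget (i, b), a vertex has the role \<open>x\<close> or \<open>y\<close> according
  to its bit b. Different vertices below 2^B differ in some bit and so have opposite roles in some
  gadget for each colour.\<close>

lemma rainbow_sat_triangle_edge_le:
  assumes e: "e \<in> edges H" "in_triangle H e" and n: "n \<le> 2 ^ B"
  shows "rainbow_sat t n H \<le> card (edges H) * B * (card (verts H) - 2) * n"
proof (cases "card (edges H) * B * (card (verts H) - 2) \<le> n")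
  case True
  obtain x y where xy: "e = {x, y}" "x \<noteq> y" using simple_graph_edgeE[OF H(1) e(1)] by metis
  obtain a where a: "{x, y} \<in> edges H" "{x, a} \<in> edges H" "{y, a} \<in> edges H"
    using e in_triangle_iff[OF H(1) xy(2)] xy(1) by auto
  have na: "a \<noteq> y" "a \<noteq> x" using simple_graph_edgeD(1)[OF H(1) a(2)] simple_graph_edgeD(1)[OF H(1) a(3)] by auto
  define \<rho> where "\<rho> = (\<lambda>(u :: nat) (g :: nat \<times> nat). {if bit u (snd g) then y else x})"
  obtain \<sigma> U gad lab where gg: "gadget_graph H x y \<sigma> {..<n} U gad lab \<rho>"
    and M: "card ({..<n} - U) = card (edges H) * B * (card (verts H) - 2)"
    and full: "\<And>i b q. i \<in> {1..card (edges H)} \<Longrightarrow> b < B \<Longrightarrow> q \<in> verts H - {x, y} \<Longrightarrow>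
       \<exists>p\<in>{..<n} - U. gad p = (i, b) \<and> lab p = q"
    by (rule gadget_graph_exists[OF H(1,2) a(1), of \<rho> B n]) (use a na xy(2) True in \<open>auto simp: \<rho>_def\<close>)
  interpret gadget_graph H x y \<sigma> "{..<n}" U gad lab \<rho> by (rule gg)
  have "rainbow_sat t n H \<le> card ({..<n} - U) * n"
  proof (rule gadget_graph_bound[OF gg t])
    show "\<And>\<psi>. \<not> rainbow_emb H ({..<n}, gedges) gcolour \<psi>" using no_rainbow_copy_triangle[OF a(2,3)] .
    fix u v i assume uv: "u \<in> U" "v \<in> U" "u \<noteq> v" and i: "i \<in> {1..card (edges H)}"
    have "u < n" "v < n" using uv UV by auto
    then have "u < 2 ^ B" "v < 2 ^ B" using n by auto
    then obtain b where b: "b < B" "bit u b \<noteq> bit v b" using ex_bit_neq uv(3) by blast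
    show "\<exists>g. fst g = i \<and> (\<forall>q\<in>verts H - {x, y}. \<exists>p\<in>{..<n} - U. gad p = g \<and> lab p = q) \<and>
        (x \<in> \<rho> u g \<and> y \<in> \<rho> v g \<or> x \<in> \<rho> v g \<and> y \<in> \<rho> u g)"
      using full[OF i b(1)] b(2) by (intro exI[of _ "(i, b)"]) (auto simp: \<rho>_def)
  qed
  then show ?thesis unfolding M .
next
  case False
  \<comment> \<open>The gadgets do not fit into n vertices, but then the claimed bound exceeds
    n^2.\<close>
  have "rainbow_sat t n H \<le> n * n" using rainbow_sat_le_square[OF H t, of n] by (simp add: power2_eq_square)
  also have "\<dots> \<le> card (edges H) * B * (card (verts H) - 2) * n" using False by (intro mult_le_mono1) simp
  finally show ?thesis .
qed

lemma rainbow_sat_triangle_edge_upper: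
  assumes e: "e \<in> edges H" "in_triangle H e"
  shows "(\<lambda>n. real (rainbow_sat t n H)) \<in> O(\<lambda>n. real n * log 2 (real n))"
proof -
  define C where "C = real (card (edges H) * (card (verts H) - 2))"
  have *: "norm (real (rainbow_sat t n H)) \<le> (2 * C) * norm (real n * log 2 (real n))" if n: "n \<ge> 2" for n
  proof -
    have l1: "log 2 (real n) \<ge> 1" using n by (simp add: le_log_iff)
    define B where "B = nat \<lceil>log 2 (real n)\<rceil>"
    have B: "log 2 (real n) \<le> real B" "real B \<le> 2 * log 2 (real n)" unfolding B_def using l1 by linarith+
    have "real n = 2 powr (log 2 (real n))" using n by simp
    also have "\<dots> \<le> 2 powr (real B)" using B by (intro powr_mono) auto
    also have "\<dots> = real (2 ^ B)" by (simp add: powr_realpow)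
    finally have "n \<le> 2 ^ B" by (simp only: of_nat_le_iff)
    then have "real (rainbow_sat t n H) \<le> real (card (edges H) * B * (card (verts H) - 2) * n)"
      by (intro of_nat_mono rainbow_sat_triangle_edge_le[OF e])
    also have "\<dots> = C * real B * real n" unfolding C_def by simp
    also have "\<dots> \<le> C * (2 * log 2 (real n)) * real n" using B unfolding C_def by (intro mult_right_mono mult_left_mono) auto
    finally show ?thesis using l1 by (simp add: mult_ac)
  qed
  have "eventually (\<lambda>n. n \<ge> 2) (at_top :: nat filter)" by (rule eventually_ge_at_top)
  then have "eventually (\<lambda>n. norm (real (rainbow_sat t n H)) \<le> (2 * C) * norm (real n * log 2 (real n))) at_top"
    by eventually_elim (rule *)
  then show ?thesis by (rule bigoI)
qed

lemma degree_ge_2: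
  assumes "bad_edge H {x, y}" shows "degree H x \<ge> 2" "\<exists>a. a \<noteq> y \<and> {x, a} \<in> edges H"
proof -
  have fin: "finite (edges H)" by (rule simple_graph_finite_edges[OF H(1)])
  have e: "{x, y} \<in> edges H" using assms unfolding bad_edge_def by blast
  have "degree H x \<noteq> 1" using assms unfolding bad_edge_def pendant_def by blast
  moreover have "degree H x \<noteq> 0" unfolding degree_def using e fin by auto
  ultimately show d: "degree H x \<ge> 2" by simp
  have "\<not> {e \<in> edges H. x \<in> e} \<subseteq> {{x, y}}"
    using d card_mono[of "{{x, y}}" "{e \<in> edges H. x \<in> e}"] unfolding degree_def by auto
  then obtain f where f: "f \<in> edges H" "x \<in> f" "f \<noteq> {x, y}" by blast
  then obtain a b where ab: "f = {a, b}" using simple_graph_edgeE[OF H(1) f(1)] by metis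
  then have "f = {x, if a = x then b else a}" using f(2) by auto
  then show "\<exists>a. a \<noteq> y \<and> {x, a} \<in> edges H" using f by metis
qed

lemma rainbow_sat_bad_edge_upper:
  assumes e: "bad_edge H e"
  shows "(\<lambda>n. real (rainbow_sat t n H)) \<in> O(\<lambda>n. real n)"
proof -
  define M where "M = card (edges H) * 1 * (card (verts H) - 2)"
  have "finite {e. bad_edge H e}"
    by (rule finite_subset[OF _ simple_graph_finite_edges[OF H(1)]]) (auto simp: bad_edge_def)
  then have "finite (sum (degree H) ` {e. bad_edge H e})" "sum (degree H) ` {e. bad_edge H e} \<noteq> {}" using e by auto
  then have "Max (sum (degree H) ` {e. bad_edge H e}) \<in> sum (degree H) ` {e. bad_edge H e}"
    and mx: "\<And>f. bad_edge H f \<Longrightarrow> sum (degree H) f \<le> Max (sum (degree H) ` {e. bad_edge H e})"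
    by (rule Max_in) (simp add: \<open>finite (sum (degree H) ` {e. bad_edge H e})\<close>)
  \<comment> \<open>Maximality of the degree sum is required by
    \<open>no_rainbow_copy_bad_edge\<close>; the given edge \<open>e\<close> only ensures that there
    is something to choose from.\<close>
  then obtain e0 where e0: "bad_edge H e0" "\<And>f. bad_edge H f \<Longrightarrow> sum (degree H) f \<le> sum (degree H) e0"
    by (metis imageE mem_Collect_eq)
  then have "e0 \<in> edges H" unfolding bad_edge_def by blast
  then obtain x y where xy: "e0 = {x, y}" "x \<noteq> y" using simple_graph_edgeE[OF H(1)] by metis
  have b: "bad_edge H {x, y}" "bad_edge H {y, x}" using e0(1) xy(1) by (auto simp: insert_commute)
  have xyE: "{x, y} \<in> edges H" using b unfolding bad_edge_def by blast
  have max: "degree H a + degree H b \<le> degree H x + degree H y" if "bad_edge H {a, b}" for a b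
  proof -
    have "a \<noteq> b" using that simple_graph_edgeD[OF H(1)] unfolding bad_edge_def by blast
    then show ?thesis using e0(2)[OF that] xy by simp
  qed
  have excl: "{y, a} \<notin> edges H" if "{x, a} \<in> edges H" for a
    using b(1) that in_triangle_iff[OF H(1) xy(2)] unfolding bad_edge_def by blast
  have le: "rainbow_sat t n H \<le> M * n" for n
  proof (cases "M \<le> n")
    case True
    \<comment> \<open>All vertices take both roles in all gadgets, allowed because \<open>x\<close>
      and \<open>y\<close> have no common neighbour. So one gadget per avoided colour serves all
      pairs.\<close>
    define \<rho> where "\<rho> = (\<lambda>(u :: nat) (g :: nat \<times> nat). {x, y})"
    obtain \<sigma> U gad lab where gg: "gadget_graph H x y \<sigma> {..<n} U gad lab \<rho>"
      and M: "card ({..<n} - U) = M"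
      and full: "\<And>i b q. i \<in> {1..card (edges H)} \<Longrightarrow> b < 1 \<Longrightarrow> q \<in> verts H - {x, y} \<Longrightarrow>
         \<exists>p\<in>{..<n} - U. gad p = (i, b) \<and> lab p = q"
      unfolding M_def
      by (rule gadget_graph_exists[OF H(1,2) xyE degree_ge_2(2)[OF b(1)] degree_ge_2(2)[OF b(2)], of \<rho> 1 n])
         (use excl True in \<open>auto simp: \<rho>_def M_def\<close>)
    interpret gadget_graph H x y \<sigma> "{..<n}" U gad lab \<rho> by (rule gg)
    have "rainbow_sat t n H \<le> card ({..<n} - U) * n"
    proof (rule gadget_graph_bound[OF gg t])
      show "\<And>\<psi>. \<not> rainbow_emb H ({..<n}, gedges) gcolour \<psi>"
        using no_rainbow_copy_bad_edge[OF b(1) max degree_ge_2(1)[OF b(1)] degree_ge_2(1)[OF b(2)]] .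
      fix u v i assume "i \<in> {1..card (edges H)}"
      then show "\<exists>g. fst g = i \<and> (\<forall>q\<in>verts H - {x, y}. \<exists>p\<in>{..<n} - U. gad p = g \<and> lab p = q) \<and>
          (x \<in> \<rho> u g \<and> y \<in> \<rho> v g \<or> x \<in> \<rho> v g \<and> y \<in> \<rho> u g)"
        using full[of i 0] by (intro exI[of _ "(i, 0)"]) (auto simp: \<rho>_def)
    qed
    then show ?thesis unfolding M .
  next
    case False
    have "rainbow_sat t n H \<le> n * n" using rainbow_sat_le_square[OF H t, of n] by (simp add: power2_eq_square)
    also have "\<dots> \<le> M * n" using False by (intro mult_le_mono1) simp
    finally show ?thesis .
  qed
  have "norm (real (rainbow_sat t n H)) \<le> real M * norm (real n)" for n
    using of_nat_mono[OF le[of n], where 'a = real] by simp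
  then show ?thesis by (intro bigoI[of _ "real M"]) auto
qed

end

section \<open>Cliques with a rotated edge\<close>

lemma add_mod_inj:
  fixes a b b' q :: nat
  assumes "b < q" "b' < q" "(a + b) mod q = (a + b') mod q"
  shows "b = b'"
  using assms
proof (induction b b' rule: linorder_wlog)
  case (le b b')
  then have "q dvd (a + b') - (a + b)" using mod_eq_dvd_iff_nat[of "a + b" "a + b'" q] by simp
  then show ?case using le by (auto dest: dvd_imp_le)
qed simp

lemma double_mod_inj:
  fixes b b' q :: nat
  assumes "odd q" "b < q" "b' < q" "(2 * b) mod q = (2 * b') mod q"
  shows "b = b'"
  using assms(2-)
proof (induction b b' rule: linorder_wlog)
  case (le b b')
  then have "q dvd 2 * b' - 2 * b" using mod_eq_dvd_iff_nat[of "2 * b" "2 * b'" q] by simp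
  then have "q dvd 2 * (b' - b)" by (simp add: diff_mult_distrib2)
  then have "q dvd b' - b" using assms(1) by (metis coprime_dvd_mult_right_iff coprime_commute coprime_left_2_iff_odd)
  then show ?case using le by (auto dest: dvd_imp_le)
qed simp

text \<open>The circle construction: \<open>r - 1\<close> is the centre, the other vertices lie on a circle of odd length.\<close>
definition circle_colour :: "nat \<Rightarrow> nat \<Rightarrow> nat \<Rightarrow> nat" where
  "circle_colour r a b = (if a = r - 1 then 2 * b else if b = r - 1 then 2 * a else a + b) mod (r - 1)"

lemma circle_colour_commute: "circle_colour r a b = circle_colour r b a" if "a \<noteq> b"
  using that unfolding circle_colour_def by (auto simp: add.commute)

lemma circle_colour_inj:
  assumes r: "even r" "r \<ge> 2" and lt: "a < r" "b < r" "b' < r" and ne: "a \<noteq> b" "a \<noteq> b'"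
    and eq: "circle_colour r a b = circle_colour r a b'"
  shows "b = b'"
proof (cases "a = r - 1")
  case True
  then have "b < r - 1" "b' < r - 1" using lt ne by auto
  moreover have "odd (r - 1)" using r by auto
  ultimately show ?thesis using double_mod_inj[of "r - 1" b b'] eq True unfolding circle_colour_def by simp
next
  case False
  then have a: "a < r - 1" using lt by auto
  \<comment> \<open>The edge from \<open>a\<close> to the centre has colour 2 a = a + a, so at
    \<open>a\<close> the centre behaves like the vertex \<open>a\<close> itself, which is not its
    own neighbour.\<close>
  define z where "z = (\<lambda>b. if b = r - 1 then a else b)"
  have c: "circle_colour r a b = (a + z b) mod (r - 1)" for b
    using False unfolding circle_colour_def z_def by (simp add: mult_2)
  have "z b < r - 1" "z b' < r - 1" using lt a unfolding z_def by auto
  then have "z b = z b'" using add_mod_inj eq unfolding c by blast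
  then show ?thesis using ne unfolding z_def by (auto split: if_splits)
qed

text \<open>For \<open>r\<close> even, \<open>r / 2\<close> rainbow colourings \<open>\<chi> k\<close> of \<open>K\<^sub>r\<close> with the same \<open>r (r - 1) / 2\<close> colours such
  that at every vertex the stars of the different colourings have disjoint colour sets. The colours
  are pairs of a factor of a one-factorization and a position in it, and \<open>\<chi> k\<close> shifts the positions
  by \<open>k\<close>.\<close>
lemma shifted_clique_colourings:
  assumes r: "even r" "r \<ge> 2"
  obtains \<chi> :: "nat \<Rightarrow> nat set \<Rightarrow> nat" where
    "\<And>k e. e \<in> nsets {..<r} 2 \<Longrightarrow> k < r div 2 \<Longrightarrow> \<chi> k e \<in> {1..(r - 1) * (r div 2)}"
    "\<And>k. k < r div 2 \<Longrightarrow> inj_on (\<chi> k) (nsets {..<r} 2)"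
    "\<And>a b b' k l. a < r \<Longrightarrow> b < r \<Longrightarrow> b' < r \<Longrightarrow> a \<noteq> b \<Longrightarrow> a \<noteq> b' \<Longrightarrow> k < r div 2 \<Longrightarrow> l < r div 2 \<Longrightarrow>
       \<chi> k {a, b} = \<chi> l {a, b'} \<Longrightarrow> k = l \<and> b = b'"
proof -
  define m where "m = r div 2"
  have m: "r = 2 * m" "m \<ge> 1" using r unfolding m_def by auto
  define kap where "kap = (\<lambda>e :: nat set. circle_colour r (Min e) (Max e))"
  have kap: "kap {a, b} = circle_colour r a b" if "a \<noteq> b" for a b
    using that circle_colour_commute[of a b r] unfolding kap_def by (cases "a < b") (auto simp: min_def max_def)
  define F where "F = (\<lambda>j. {e \<in> nsets {..<r} 2. kap e = j})"
  have same: "e = e'" if e: "e \<in> F j" "e' \<in> F j" "a \<in> e" "a \<in> e'" for e e' j a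
  proof -
    have ex: "\<exists>b. e = {a, b} \<and> a \<noteq> b \<and> a < r \<and> b < r" if "e \<in> nsets {..<r} 2" "a \<in> e" for e
      using that by (elim nsets_2E) auto
    obtain b where b: "e = {a, b}" "a \<noteq> b" "a < r" "b < r" using ex[of e] e unfolding F_def by auto
    obtain b' where b': "e' = {a, b'}" "a \<noteq> b'" "b' < r" using ex[of e'] e unfolding F_def by auto
    have "kap e = kap e'" using e unfolding F_def by simp
    then have "b = b'" using circle_colour_inj[OF r b(3,4) b'(3) b(2) b'(2)] kap b b' by simp
    then show ?thesis using b b' by simp
  qed
  have finF: "finite (F j)" for j unfolding F_def by (simp add: finite_imp_finite_nsets)
  \<comment> \<open>Edges of equal circle colour are disjoint, so each class has at most r / 2 edges
    and \<open>m\<close> positions suffice to number it.\<close>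
  have cF: "card (F j) \<le> m" for j
  proof -
    have "pairwise disjnt (F j)" using same unfolding pairwise_def disjnt_def by blast
    then have "card (\<Union>(F j)) = sum card (F j)"
      by (rule card_Union_disjoint) (auto simp: F_def nsets_def)
    also have "\<dots> = (\<Sum>e\<in>F j. 2)" by (rule sum.cong) (auto simp: F_def nsets_def)
    finally have "2 * card (F j) = card (\<Union>(F j))" by simp
    also have "\<dots> \<le> card {..<r}" by (rule card_mono) (auto simp: F_def nsets_def)
    finally show ?thesis using m by simp
  qed
  have "\<exists>f. f ` F j \<subseteq> {..<m} \<and> inj_on f (F j)" for j
    using card_le_inj[of "F j" "{..<m}"] finF cF by simp
  then obtain idx where idx: "\<And>j. idx j ` F j \<subseteq> {..<m}" "\<And>j. inj_on (idx j) (F j)" by metis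
  \<comment> \<open>The pair of factor and shifted position, encoded in base \<open>m\<close>; the 1
    is added because colours start at 1.\<close>
  define \<chi> where "\<chi> = (\<lambda>k e. 1 + (kap e * m + (idx (kap e) e + k) mod m))"
  have dec: "kap e = kap e' \<and> (idx (kap e) e + k) mod m = (idx (kap e') e' + l) mod m"
    if "\<chi> k e = \<chi> l e'" for k l e e'
  proof -
    have eq: "kap e * m + (idx (kap e) e + k) mod m = kap e' * m + (idx (kap e') e' + l) mod m"
      using that unfolding \<chi>_def by simp
    have div: "(x * m + y mod m) div m = x" "(x * m + y mod m) mod m = y mod m" for x y
      using m(2) by simp_all
    show ?thesis using eq div by metis
  qed
  have idxm: "idx (kap e) e < m" if "e \<in> nsets {..<r} 2" for e
    using idx(1)[of "kap e"] that unfolding F_def by auto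
  show thesis
  proof (rule that[of \<chi>])
    fix k e assume e: "e \<in> nsets {..<r} 2"
    have "kap e < r - 1" unfolding kap_def circle_colour_def using r by (intro mod_less_divisor) auto
    then have "kap e * m + m \<le> (r - 1) * m" by (metis Suc_leI add.commute mult_Suc mult_le_mono1)
    moreover have "(idx (kap e) e + k) mod m < m" using m by simp
    ultimately show "\<chi> k e \<in> {1..(r - 1) * (r div 2)}" unfolding \<chi>_def m_def[symmetric] by simp
  next
    fix k assume k: "k < r div 2"
    show "inj_on (\<chi> k) (nsets {..<r} 2)"
    proof (rule inj_onI)
      fix e e' assume e: "e \<in> nsets {..<r} 2" "e' \<in> nsets {..<r} 2" "\<chi> k e = \<chi> k e'"
      have kk: "kap e = kap e'" using dec[OF e(3)] by blast
      have "(k + idx (kap e) e) mod m = (k + idx (kap e) e') mod m" using dec[OF e(3)] kk by (simp add: add.commute)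
      then have "idx (kap e) e = idx (kap e) e'" using add_mod_inj idxm e(1,2) kk by metis
      moreover have "e \<in> F (kap e)" "e' \<in> F (kap e)" using e kk unfolding F_def by auto
      ultimately show "e = e'" using idx(2) by (metis inj_onD)
    qed
  next
    fix a b b' k l assume lt: "a < r" "b < r" "b' < r" and ne: "a \<noteq> b" "a \<noteq> b'"
      and kl: "k < r div 2" "l < r div 2" and eq: "\<chi> k {a, b} = \<chi> l {a, b'}"
    have "circle_colour r a b = circle_colour r a b'" using dec[OF eq] kap ne by simp
    then have "b = b'" using circle_colour_inj[OF r lt ne] by blast
    moreover from this have "(idx (kap {a, b}) {a, b} + k) mod m = (idx (kap {a, b}) {a, b} + l) mod m"
      using dec[OF eq] by simp
    then have "k = l" using add_mod_inj kl unfolding m_def by blast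
    ultimately show "k = l \<and> b = b'" by blast
  qed
qed

text \<open>Disjoint copies of the Hamming graph on \<open>[r]\<^sup>m\<close> whose lines are rainbow copies of \<open>K\<^sub>r\<close>:
  \<open>comp\<close> is the number of the copy and \<open>pt\<close> the point. The vertices outside \<open>Fu\<close>, a remainder too
  small for a copy, are isolated. On a line in direction \<open>k\<close>, the sum \<open>role\<close> of the coordinates
  takes every value once and identifies the line with \<open>K\<^sub>r\<close>, coloured by \<open>\<chi> k\<close>.\<close>
locale hamming_graph =
  fixes r m T :: nat and \<chi> :: "nat \<Rightarrow> nat set \<Rightarrow> nat" and V Fu :: "'v set"
    and comp :: "'v \<Rightarrow> nat" and pt :: "'v \<Rightarrow> nat \<Rightarrow> nat"
  assumes rm: "r = 2 * m" "r \<ge> 4" and T: "T = (r - 1) * m"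
    and \<chi>_range: "\<And>k e. e \<in> nsets {..<r} 2 \<Longrightarrow> k < m \<Longrightarrow> \<chi> k e \<in> {1..T}"
    and \<chi>_inj: "\<And>k. k < m \<Longrightarrow> inj_on (\<chi> k) (nsets {..<r} 2)"
    and \<chi>_star: "\<And>a b b' k l. a < r \<Longrightarrow> b < r \<Longrightarrow> b' < r \<Longrightarrow> a \<noteq> b \<Longrightarrow> a \<noteq> b' \<Longrightarrow> k < m \<Longrightarrow> l < m \<Longrightarrow>
       \<chi> k {a, b} = \<chi> l {a, b'} \<Longrightarrow> k = l \<and> b = b'"
    and Fu: "Fu \<subseteq> V"
    and pt: "\<And>p l. p \<in> Fu \<Longrightarrow> l < m \<Longrightarrow> pt p l < r"
    and pt_inj: "\<And>p q. p \<in> Fu \<Longrightarrow> q \<in> Fu \<Longrightarrow> comp p = comp q \<Longrightarrow> (\<And>l. l < m \<Longrightarrow> pt p l = pt q l) \<Longrightarrow> p = q"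
    and pt_surj: "\<And>p a. p \<in> Fu \<Longrightarrow> (\<And>l. l < m \<Longrightarrow> a l < r) \<Longrightarrow>
      \<exists>q\<in>Fu. comp q = comp p \<and> (\<forall>l<m. pt q l = a l)"
begin

definition adj :: "nat \<Rightarrow> 'v \<Rightarrow> 'v \<Rightarrow> bool" where
  "adj k p q \<longleftrightarrow> p \<in> Fu \<and> q \<in> Fu \<and> comp p = comp q \<and> k < m \<and> pt p k \<noteq> pt q k \<and>
     (\<forall>l<m. l \<noteq> k \<longrightarrow> pt p l = pt q l)"

definition role :: "'v \<Rightarrow> nat" where
  "role p = (\<Sum>l<m. pt p l) mod r"

definition hedges :: "'v set set" where
  "hedges = {{p, q} | p q. \<exists>k. adj k p q}"

definition hcolour :: "'v set \<Rightarrow> nat" where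
  "hcolour e = (SOME i. \<exists>k p q. adj k p q \<and> e = {p, q} \<and> i = \<chi> k {role p, role q})"

lemma role_less: "role p < r"
  unfolding role_def using rm by simp

lemma adj_sym: "adj k p q \<Longrightarrow> adj k q p"
  unfolding adj_def by auto

lemma adj_ne: "adj k p q \<Longrightarrow> p \<noteq> q"
  unfolding adj_def by auto

lemma adj_unique: "adj k p q \<Longrightarrow> adj l p q \<Longrightarrow> k = l"
  unfolding adj_def by blast

lemma role_split: "k < m \<Longrightarrow> role p = ((\<Sum>l\<in>{..<m} - {k}. pt p l) + pt p k) mod r"
  unfolding role_def by (subst sum.remove[of _ k]) (auto simp: add.commute)

lemma adj_role_ne:
  assumes "adj k p q" shows "role p \<noteq> role q"
proof
  have k: "k < m" using assms unfolding adj_def by blast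
  have sums: "(\<Sum>l\<in>{..<m} - {k}. pt p l) = (\<Sum>l\<in>{..<m} - {k}. pt q l)"
    using assms unfolding adj_def by (intro sum.cong) auto
  have less: "pt p k < r" "pt q k < r" using assms pt k unfolding adj_def by auto
  assume "role p = role q"
  then have "((\<Sum>l\<in>{..<m} - {k}. pt q l) + pt p k) mod r = ((\<Sum>l\<in>{..<m} - {k}. pt q l) + pt q k) mod r"
    unfolding role_split[OF k, of p] role_split[OF k, of q] sums .
  then have "pt p k = pt q k" by (rule add_mod_inj[OF less])
  then show False using assms unfolding adj_def by blast
qed

lemma adj_line:
  assumes "adj k p q" "adj k p q'" "q \<noteq> q'" shows "adj k q q'"
proof -
  have "pt q k \<noteq> pt q' k"
  proof
    assume "pt q k = pt q' k"
    then have "q = q'" using assms(1,2) unfolding adj_def by (intro pt_inj) metis+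
    then show False using assms(3) by blast
  qed
  then show ?thesis using assms unfolding adj_def by auto
qed

text \<open>If \<open>q\<close> and \<open>s\<close> differ from \<open>p\<close> in different
  coordinates, they differ from each other in two and are not adjacent. So triangles lie in
  lines.\<close>

lemma adj_triangle:
  assumes "adj k p q" "adj k1 p s" "adj k2 q s"
  shows "k1 = k \<and> k2 = k"
proof -
  have "k1 = k"
  proof (rule ccontr)
    assume ne: "k1 \<noteq> k"
    have 1: "pt q k \<noteq> pt s k" using assms(1,2) ne unfolding adj_def by metis
    have 2: "pt q k1 \<noteq> pt s k1" using assms(1,2) ne unfolding adj_def by metis
    show False using 1 2 ne assms unfolding adj_def by metis
  qed
  then show ?thesis using adj_line[OF assms(1)] assms adj_ne adj_unique by blast
qed

lemma line_ex:
  assumes p: "p \<in> Fu" and k: "k < m" and j: "j < r"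
  shows "\<exists>q\<in>Fu. (q = p \<or> adj k p q) \<and> role q = j"
proof -
  define A where "A = (\<Sum>l\<in>{..<m} - {k}. pt p l)"
  have "inj_on (\<lambda>s. (A + s) mod r) {..<r}" by (rule inj_onI) (use add_mod_inj in auto)
  then have "card ((\<lambda>s. (A + s) mod r) ` {..<r}) = card {..<r}" by (rule card_image)
  then have "(\<lambda>s. (A + s) mod r) ` {..<r} = {..<r}" using rm by (intro card_subset_eq) auto
  then have "j \<in> (\<lambda>s. (A + s) mod r) ` {..<r}" using j by simp
  then obtain s where s: "s < r" "(A + s) mod r = j" by blast
  have "\<exists>q\<in>Fu. comp q = comp p \<and> (\<forall>l<m. pt q l = ((pt p)(k := s)) l)"
    using pt_surj[OF p, of "(pt p)(k := s)"] pt[OF p] s by auto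
  then obtain q where q: "q \<in> Fu" "comp q = comp p" "\<And>l. l < m \<Longrightarrow> pt q l = ((pt p)(k := s)) l" by blast
  have "(\<Sum>l\<in>{..<m} - {k}. pt q l) = A" unfolding A_def by (intro sum.cong) (auto simp: q)
  then have "role q = j" unfolding role_split[OF k, of q] using s q(3)[OF k] by simp
  moreover have "q = p \<or> adj k p q"
  proof (cases "s = pt p k")
    case True
    then have "q = p" using q p by (intro pt_inj) auto
    then show ?thesis by blast
  qed (use q p k in \<open>auto simp: adj_def\<close>)
  ultimately show ?thesis using q(1) by blast
qed

lemma hcolour_adj: "adj k p q \<Longrightarrow> hcolour {p, q} = \<chi> k {role p, role q}"
  unfolding hcolour_def
proof (rule some_equality)
  assume a: "adj k p q"
  then show "\<exists>k' p' q'. adj k' p' q' \<and> {p, q} = {p', q'} \<and> \<chi> k {role p, role q} = \<chi> k' {role p', role q'}" by blast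
  fix i assume "\<exists>k' p' q'. adj k' p' q' \<and> {p, q} = {p', q'} \<and> i = \<chi> k' {role p', role q'}"
  then obtain k' p' q' where b: "adj k' p' q'" "{p, q} = {p', q'}" "i = \<chi> k' {role p', role q'}" by blast
  then have "p = p' \<and> q = q' \<or> p = q' \<and> q = p'" by (auto simp: doubleton_eq_iff)
  then show "i = \<chi> k {role p, role q}"
  proof
    assume "p = p' \<and> q = q'"
    then show ?thesis using b a adj_unique by blast
  next
    assume "p = q' \<and> q = p'"
    then show ?thesis using b a adj_unique[OF adj_sym[OF b(1)]] by (simp add: insert_commute)
  qed
qed

lemma adj_role_edge: "adj k p q \<Longrightarrow> {role p, role q} \<in> nsets {..<r} 2"
  using adj_role_ne role_less by (simp add: in_nsets_2_iff)

lemma hcolour_range: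
  assumes "e \<in> hedges" shows "hcolour e \<in> {1..T}"
proof -
  obtain k p q where a: "adj k p q" "e = {p, q}" using assms unfolding hedges_def by blast
  then have "k < m" unfolding adj_def by blast
  then show ?thesis using \<chi>_range[OF adj_role_edge[OF a(1)]] hcolour_adj[OF a(1)] a(2) by simp
qed

lemma card_pairs: "card (nsets {..<r} 2) = T"
proof -
  have "card (nsets {..<r} 2) = r * (r - 1) div 2" by (simp add: choose_two)
  also have "\<dots> = T" unfolding T rm(1) by (simp add: mult.assoc mult.commute)
  finally show ?thesis .
qed

text \<open>As many colours as pairs: a line of the Hamming graph shows every colour exactly
  once.\<close>

lemma \<chi>_image: "k < m \<Longrightarrow> \<chi> k ` nsets {..<r} 2 = {1..T}"
  using \<chi>_range card_image[OF \<chi>_inj] card_pairs by (intro card_subset_eq) auto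

text \<open>There are \<open>m (r - 1) = T\<close> edges at \<open>a\<close> in all directions, of different colours.\<close>
lemma \<chi>_star_surj:
  assumes a: "a < r" and i: "i \<in> {1..T}"
  shows "\<exists>k<m. \<exists>b<r. b \<noteq> a \<and> \<chi> k {a, b} = i"
proof -
  let ?D = "{..<m} \<times> ({..<r} - {a})"
  have "inj_on (\<lambda>(k, b). \<chi> k {a, b}) ?D"
    using \<chi>_star[OF a] by (auto simp: inj_on_def)
  then have "card ((\<lambda>(k, b). \<chi> k {a, b}) ` ?D) = card ?D" by (rule card_image)
  also have "\<dots> = T" unfolding T using a by (simp add: card_cartesian_product mult.commute)
  finally have c: "card ((\<lambda>(k, b). \<chi> k {a, b}) ` ?D) = T" .
  have "\<chi> k {a, b} \<in> {1..T}" if "k < m" "b < r" "b \<noteq> a" for k b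
    by (rule \<chi>_range[OF _ that(1)]) (use that a in \<open>simp add: in_nsets_2_iff\<close>)
  then have "(\<lambda>(k, b). \<chi> k {a, b}) ` ?D \<subseteq> {1..T}" by force
  then have "(\<lambda>(k, b). \<chi> k {a, b}) ` ?D = {1..T}"
    using c by (intro card_subset_eq) auto
  then have "i \<in> (\<lambda>(k, b). \<chi> k {a, b}) ` ?D" using i by simp
  then show ?thesis by auto
qed

context
  fixes H :: "'a graph" and K :: "'a set" and u v w :: 'a
  assumes K: "finite K" "card K = r" and uvw: "u \<in> K" "v \<in> K" "u \<noteq> v" "w \<notin> K"
    and vH: "verts H = insert w K" and eH: "edges H = insert {u, w} (nsets K 2 - {{u, v}})"
begin

lemma clique_edge: "a \<in> K \<Longrightarrow> b \<in> K \<Longrightarrow> a \<noteq> b \<Longrightarrow> {a, b} \<noteq> {u, v} \<Longrightarrow> {a, b} \<in> edges H"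
  unfolding eH by (simp add: in_nsets_2_iff)

text \<open>Since r \<ge> 4, two vertices of \<open>K\<close> avoid \<open>u\<close> and
  \<open>v\<close>. They are adjacent to each other and to the rest of \<open>K\<close>, and
  triangles lie in lines, so the image of \<open>K\<close> fills a line. The edge \<open>uw\<close>
  leaves this line, but its colour also occurs on it, at a pair not containing the image of
  \<open>u\<close>. That pair is not the image of the missing \<open>uv\<close>, so the copy repeats
  the colour.\<close>

lemma hamming_no_rainbow_copy: "\<not> rainbow_emb H (V, hedges) hcolour \<psi>"
proof
  assume emb: "rainbow_emb H (V, hedges) hcolour \<psi>"
  have inj: "inj_on \<psi> (verts H)" and rb: "inj_on (\<lambda>e. hcolour (\<psi> ` e)) (edges H)"
    using emb unfolding rainbow_emb_def by auto
  have ad: "\<exists>k. adj k (\<psi> a) (\<psi> b)" if "{a, b} \<in> edges H" for a b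
  proof -
    have "\<psi> ` {a, b} \<in> hedges" using emb that unfolding rainbow_emb_def by auto
    then obtain k p q where pq: "adj k p q" "{\<psi> a, \<psi> b} = {p, q}" unfolding hedges_def by auto
    then have "\<psi> a = p \<and> \<psi> b = q \<or> \<psi> a = q \<and> \<psi> b = p" by (auto simp: doubleton_eq_iff)
    then show ?thesis using pq adj_sym by blast
  qed
  have "card (K - {u, v}) = card K - card {u, v}" using uvw by (intro card_Diff_subset) auto
  then have "card (K - {u, v}) \<ge> 2" using K rm uvw by simp
  then obtain s1 s2 where s: "s1 \<in> K - {u, v}" "s2 \<in> K - {u, v}" "s1 \<noteq> s2"
    by (metis card_le_Suc0_iff_eq K(1) finite_Diff not_less_eq_eq numeral_2_eq_2)
  then have "{s1, s2} \<in> edges H" by (intro clique_edge) auto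
  then obtain k where k: "adj k (\<psi> s1) (\<psi> s2)" using ad by blast
  have km: "k < m" using k unfolding adj_def by blast
  have s1a: "adj k (\<psi> s1) (\<psi> a)" if a: "a \<in> K" "a \<noteq> s1" for a
  proof (cases "a = s2")
    case False
    have "{s1, a} \<in> edges H" by (rule clique_edge) (use s a in \<open>auto simp: doubleton_eq_iff\<close>)
    moreover have "{s2, a} \<in> edges H" by (rule clique_edge) (use s a False in \<open>auto simp: doubleton_eq_iff\<close>)
    ultimately obtain k1 k2 where "adj k1 (\<psi> s1) (\<psi> a)" "adj k2 (\<psi> s2) (\<psi> a)" using ad by blast
    then show ?thesis using adj_triangle[OF k] by blast
  qed (use k in simp)
  have line: "adj k (\<psi> a) (\<psi> b)" if ab: "a \<in> K" "b \<in> K" "a \<noteq> b" for a b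
  proof -
    have "\<psi> a \<noteq> \<psi> b" using inj ab vH by (auto simp: inj_on_def)
    then show ?thesis using s1a[of a] s1a[of b] ab adj_line adj_sym by blast
  qed
  have rinj: "inj_on (role \<circ> \<psi>) K" using adj_role_ne[OF line] by (auto simp: inj_on_def)
  then have "card ((role \<circ> \<psi>) ` K) = r" using K card_image by metis
  then have rim: "(role \<circ> \<psi>) ` K = {..<r}" using role_less by (intro card_subset_eq) auto
  have uw: "{u, w} \<in> edges H" unfolding eH by simp
  then obtain l where l: "adj l (\<psi> u) (\<psi> w)" using ad by blast
  have lm: "l < m" using l unfolding adj_def by blast
  \<comment> \<open>In direction \<open>k\<close>, \<open>w\<close> would be a further vertex on the
    line, but all \<open>r\<close> roles of the line are taken by \<open>K\<close>.\<close>
  have "l \<noteq> k"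
  proof
    assume lk: "l = k"
    have "role (\<psi> w) \<in> (role \<circ> \<psi>) ` K" unfolding rim using role_less by simp
    then obtain a where a: "a \<in> K" "role (\<psi> a) = role (\<psi> w)" by auto
    have ne: "\<psi> a \<noteq> \<psi> w" using inj a uvw vH by (auto simp: inj_on_def)
    have "a \<noteq> u" using a adj_role_ne[OF l] by auto
    then have "adj k (\<psi> a) (\<psi> w)" using line[OF uvw(1) a(1)] l lk adj_line ne by blast
    then show False using adj_role_ne a by blast
  qed
  have "\<chi> l {role (\<psi> u), role (\<psi> w)} \<in> \<chi> k ` nsets {..<r} 2"
    unfolding \<chi>_image[OF km] by (rule \<chi>_range[OF adj_role_edge[OF l] lm])
  then obtain e where e: "e \<in> nsets {..<r} 2" "\<chi> l {role (\<psi> u), role (\<psi> w)} = \<chi> k e" by blast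
  obtain x y where xy: "e = {x, y}" "x \<noteq> y" "x \<in> {..<r}" "y \<in> {..<r}" using e(1) by (rule nsets_2E)
  have "x \<in> (role \<circ> \<psi>) ` K" "y \<in> (role \<circ> \<psi>) ` K" using xy rim by simp_all
  then obtain a b where ab: "a \<in> K" "b \<in> K" "x = role (\<psi> a)" "y = role (\<psi> b)" by auto
  have col: "\<chi> l {role (\<psi> u), role (\<psi> w)} = \<chi> k {role (\<psi> a), role (\<psi> b)}" using e xy ab by simp
  \<comment> \<open>By \<open>\<chi>_star\<close>, edges at one vertex in different directions have
    different colours.\<close>
  have nu: "b' \<noteq> u" if "\<chi> l {role (\<psi> u), role (\<psi> w)} = \<chi> k {role (\<psi> b'), role (\<psi> a')}"
    "role (\<psi> a') \<noteq> role (\<psi> b')" for a' b'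
    using \<chi>_star[of "role (\<psi> u)" "role (\<psi> w)" "role (\<psi> a')" l k] that adj_role_ne[OF l] role_less lm km \<open>l \<noteq> k\<close> by auto
  have "a \<noteq> u" using nu[OF col] xy ab by auto
  moreover have "b \<noteq> u" using nu[of b a] col xy ab by (auto simp: insert_commute)
  moreover have anb: "a \<noteq> b" using xy ab by auto
  ultimately have abE: "{a, b} \<in> edges H" using ab by (intro clique_edge) (auto simp: doubleton_eq_iff)
  have "hcolour (\<psi> ` {a, b}) = hcolour (\<psi> ` {u, w})"
    using hcolour_adj[OF l] hcolour_adj[OF line[OF ab(1,2) anb]] col by simp
  then have "{a, b} = {u, w}" by (rule inj_onD[OF rb _ abE uw])
  then show False using \<open>a \<noteq> u\<close> \<open>b \<noteq> u\<close> by (auto simp: doubleton_eq_iff)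
qed

text \<open>\<open>K\<close> is placed on a line through \<open>p\<close> such that the missing pair
  \<open>uv\<close> falls on the edge of colour \<open>i\<close> at \<open>p\<close>, with
  \<open>u\<close> at \<open>p\<close>; the new edge replaces it as \<open>uw\<close>. Only the
  component of \<open>q\<close> matters, so \<open>q\<close> may also be one of the isolated
  vertices.\<close>

lemma hamming_new_edge:
  assumes p: "p \<in> Fu" and q: "q \<in> V" "comp q \<noteq> comp p" and i: "i \<ge> 1"
  shows "\<exists>\<psi>. rainbow_emb H (V, insert {p, q} hedges) (hcolour({p, q} := i)) \<psi>"
proof -
  \<comment> \<open>A colour above \<open>T\<close> occurs on no line, so any direction and any
    other role will do.\<close>
  have "\<exists>k<m. \<exists>b<r. b \<noteq> role p \<and> (i \<le> T \<longrightarrow> \<chi> k {role p, b} = i)"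
  proof (cases "i \<le> T")
    case True
    then show ?thesis using \<chi>_star_surj[OF role_less[of p], of i] i by auto
  next
    case False
    have "(if role p = 0 then 1 else 0) \<noteq> role p" "(if role p = 0 then 1 else 0) < r" "0 < m" using rm by auto
    then show ?thesis using False by blast
  qed
  then obtain k b where k: "k < m" and b: "b < r" "b \<noteq> role p" and ki: "i \<le> T \<Longrightarrow> \<chi> k {role p, b} = i" by blast
  have "card (K - {u, v}) = card K - card {u, v}" using uvw by (intro card_Diff_subset) auto
  moreover have "card ({..<r} - {role p, b}) = card {..<r} - card {role p, b}" using b role_less by (intro card_Diff_subset) auto
  ultimately have "card (K - {u, v}) = card ({..<r} - {role p, b})" using K uvw b by simp
  then obtain h where h: "bij_betw h (K - {u, v}) ({..<r} - {role p, b})"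
    using finite_same_card_bij[of "K - {u, v}" "{..<r} - {role p, b}"] K by auto
  define \<theta> where "\<theta> = (\<lambda>a. if a = u then role p else if a = v then b else h a)"
  have hK: "h a \<in> {..<r} - {role p, b}" if "a \<in> K - {u, v}" for a using h that by (rule bij_betwE[rule_format])
  have \<theta>_less: "\<theta> a < r" if "a \<in> K" for a using hK[of a] that b role_less unfolding \<theta>_def by auto
  have \<theta>_inj: "inj_on \<theta> K"
  proof (rule inj_onI)
    fix a a' assume a: "a \<in> K" "a' \<in> K" "\<theta> a = \<theta> a'"
    have "a = a'" if "a \<in> K - {u, v}" "a' \<in> K - {u, v}" "h a = h a'"
      using that bij_betw_imp_inj_on[OF h] by (auto dest: inj_onD)
    then show "a = a'" using a hK[of a] hK[of a'] b uvw unfolding \<theta>_def by (auto split: if_splits)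
  qed
  have \<theta>u: "\<theta> u = role p" and \<theta>v: "\<theta> v = b" unfolding \<theta>_def using uvw by auto
  have "\<forall>j. \<exists>z. j < r \<longrightarrow> z \<in> Fu \<and> (z = p \<or> adj k p z) \<and> role z = j" using line_ex[OF p k] by blast
  then obtain z where z: "\<And>j. j < r \<Longrightarrow> z j \<in> Fu \<and> (z j = p \<or> adj k p (z j)) \<and> role (z j) = j" by metis
  have zp: "z (role p) = p" using z[OF role_less[of p]] adj_role_ne by metis
  have zc: "comp (z j) = comp p" if "j < r" for j using z[OF that] unfolding adj_def by auto
  have zadj: "adj k (z j) (z j')" if "j < r" "j' < r" "j \<noteq> j'" for j j'
    using z[OF that(1)] z[OF that(2)] that(3) adj_line adj_sym by metis
  define \<psi> where "\<psi> = (\<lambda>a. if a = w then q else z (\<theta> a))"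
  have \<psi>K: "\<psi> a = z (\<theta> a)" if "a \<in> K" for a using that uvw unfolding \<psi>_def by auto
  have \<psi>w: "\<psi> w = q" and \<psi>u: "\<psi> u = p" unfolding \<psi>_def using uvw \<theta>u zp by auto
  have inj: "inj_on \<psi> (verts H)"
  proof -
    have "inj_on \<psi> K"
    proof (rule inj_onI)
      fix a a' assume a: "a \<in> K" "a' \<in> K" "\<psi> a = \<psi> a'"
      then have "\<theta> a = \<theta> a'" using \<psi>K z[OF \<theta>_less] by metis
      then show "a = a'" using \<theta>_inj a by (auto dest: inj_onD)
    qed
    moreover have "\<psi> a \<noteq> q" if "a \<in> K" for a using zc[OF \<theta>_less[OF that]] \<psi>K[OF that] q by auto
    ultimately show ?thesis unfolding vH by (auto simp: \<psi>w inj_on_insert)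
  qed
  have img: "\<psi> ` verts H \<subseteq> V" using \<psi>K z \<theta>_less Fu q \<psi>w unfolding vH by auto
  define d where "d = hcolour({p, q} := i)"
  have pq: "{p, q} \<notin> hedges"
  proof
    assume "{p, q} \<in> hedges"
    then obtain k' p' q' where "adj k' p' q'" "{p, q} = {p', q'}" unfolding hedges_def by blast
    then show False using q unfolding adj_def by (auto simp: doubleton_eq_iff)
  qed
  have uw_img: "\<psi> ` {u, w} = {p, q}" using \<psi>u \<psi>w by simp
  have cl: "\<psi> ` e \<in> hedges \<and> d (\<psi> ` e) = \<chi> k (\<theta> ` e) \<and> \<theta> ` e \<in> nsets {..<r} 2" if e: "e \<in> nsets K 2" for e
  proof -
    obtain a a' where a: "e = {a, a'}" "a \<noteq> a'" "a \<in> K" "a' \<in> K" using e by (rule nsets_2E)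
    have "\<theta> a \<noteq> \<theta> a'" using \<theta>_inj a by (auto dest: inj_onD)
    then have ad: "adj k (\<psi> a) (\<psi> a')" using zadj \<theta>_less a \<psi>K by simp
    then have "\<psi> ` e \<in> hedges" unfolding hedges_def a(1) by auto
    moreover from this have "d (\<psi> ` e) = hcolour (\<psi> ` e)" using pq unfolding d_def by auto
    moreover have "role (\<psi> a) = \<theta> a" "role (\<psi> a') = \<theta> a'" using z \<theta>_less a \<psi>K by auto
    ultimately show ?thesis using hcolour_adj[OF ad] \<open>\<theta> a \<noteq> \<theta> a'\<close> \<theta>_less a by (simp add: in_nsets_2_iff)
  qed
  have sub: "e \<subseteq> K" if "e \<in> nsets K 2" for e using that unfolding nsets_def by blast
  have \<theta>_img_inj: "e = e'" if "e \<in> nsets K 2" "e' \<in> nsets K 2" "\<theta> ` e = \<theta> ` e'" for e e'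
    using inj_on_image_eq_iff[OF \<theta>_inj sub[OF that(1)] sub[OF that(2)]] that(3) by blast
  have uvK: "{u, v} \<in> nsets K 2" using uvw by (simp add: in_nsets_2_iff)
  have ci: "d (\<psi> ` e) \<noteq> i" if e: "e \<in> nsets K 2 - {{u, v}}" for e
  proof
    assume di: "d (\<psi> ` e) = i"
    have eK: "e \<in> nsets K 2" using e by blast
    have "i \<le> T" using di cl[OF eK] \<chi>_range[of "\<theta> ` e" k] k by auto
    then have "\<chi> k {role p, b} = \<chi> k (\<theta> ` e)" using ki di cl[OF eK] by simp
    moreover have "{role p, b} = \<theta> ` {u, v}" using \<theta>u \<theta>v by simp
    ultimately have "\<theta> ` {u, v} = \<theta> ` e" using inj_onD[OF \<chi>_inj[OF k]] cl[OF eK] cl[OF uvK] by metis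
    then show False using \<theta>_img_inj[OF uvK eK] e by blast
  qed
  have "inj_on (\<lambda>e. d (\<psi> ` e)) (edges H)"
    unfolding eH inj_on_insert
  proof
    show "inj_on (\<lambda>e. d (\<psi> ` e)) (nsets K 2 - {{u, v}})"
    proof (rule inj_onI)
      fix e e' assume e: "e \<in> nsets K 2 - {{u, v}}" "e' \<in> nsets K 2 - {{u, v}}" "d (\<psi> ` e) = d (\<psi> ` e')"
      then have eK: "e \<in> nsets K 2" "e' \<in> nsets K 2" by auto
      have "\<theta> ` e = \<theta> ` e'" using inj_onD[OF \<chi>_inj[OF k]] cl[OF eK(1)] cl[OF eK(2)] e(3) by metis
      then show "e = e'" by (rule \<theta>_img_inj[OF eK])
    qed
    have di: "d (\<psi> ` {u, w}) = i" unfolding uw_img d_def by simp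
    show "d (\<psi> ` {u, w}) \<notin> (\<lambda>e. d (\<psi> ` e)) ` (nsets K 2 - {{u, v}} - {{u, w}})"
    proof
      assume "d (\<psi> ` {u, w}) \<in> (\<lambda>e. d (\<psi> ` e)) ` (nsets K 2 - {{u, v}} - {{u, w}})"
      then obtain e where e: "d (\<psi> ` {u, w}) = d (\<psi> ` e)" "e \<in> nsets K 2 - {{u, v}} - {{u, w}}" by (rule imageE)
      show False using ci[OF DiffD1[OF e(2)]] e(1) di by simp
    qed
  qed
  moreover have "\<psi> ` e \<in> insert {p, q} hedges" if "e \<in> edges H" for e
    using that cl uw_img unfolding eH by auto
  ultimately have "rainbow_emb H (V, insert {p, q} hedges) d \<psi>" unfolding rainbow_emb_def using inj img by auto
  then show ?thesis unfolding d_def by blast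
qed

end

end

section \<open>Cutting the vertex set into Hamming graphs, and the linear bound for rotated
  cliques\<close>

lemma hamming_graph_exists:
  assumes rm: "r = 2 * m" "r \<ge> 4"
    and chi: "\<And>k e. e \<in> nsets {..<r} 2 \<Longrightarrow> k < m \<Longrightarrow> \<chi> k e \<in> {1..(r - 1) * m}"
      "\<And>k. k < m \<Longrightarrow> inj_on (\<chi> k) (nsets {..<r} 2)"
      "\<And>a b b' k l. a < r \<Longrightarrow> b < r \<Longrightarrow> b' < r \<Longrightarrow> a \<noteq> b \<Longrightarrow> a \<noteq> b' \<Longrightarrow> k < m \<Longrightarrow> l < m \<Longrightarrow>
       \<chi> k {a, b} = \<chi> l {a, b'} \<Longrightarrow> k = l \<and> b = b'"
    and N: "N = r ^ m"
  obtains pt where "hamming_graph r m ((r - 1) * m) \<chi> {..<n} {p. p div N < n div N} (\<lambda>p. p div N) pt"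
proof -
  define X where "X = PiE {..<m} (\<lambda>_. {..<r})"
  have "card X = N" unfolding X_def N by (simp add: card_PiE)
  moreover have "finite X" unfolding X_def by (intro finite_PiE) auto
  ultimately obtain \<beta> where \<beta>: "bij_betw \<beta> {..<N} X"
    using ex_bij_betw_nat_finite[of X] by (auto simp: atLeast0LessThan)
  have N0: "N > 0" using rm N by simp
  \<comment> \<open>Blocks of \<open>N\<close> consecutive numbers are the copies: the quotient by
    \<open>N\<close> is the component, and the remainder encodes the point. The last, incomplete
    block has index \<open>n div N\<close>.\<close>
  define pt where "pt = (\<lambda>p :: nat. \<beta> (p mod N))"
  have ptX: "pt p \<in> X" for p unfolding pt_def using bij_betwE[OF \<beta>] N0 by simp
  have "hamming_graph r m ((r - 1) * m) \<chi> {..<n} {p. p div N < n div N} (\<lambda>p. p div N) pt"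
  proof
    show "{p. p div N < n div N} \<subseteq> {..<n}"
    proof
      fix p assume "p \<in> {p. p div N < n div N}"
      then have "p div N < n div N" by simp
      then have "\<not> n \<le> p" using div_le_mono[of n p N] by linarith
      then show "p \<in> {..<n}" by simp
    qed
    show "pt p l < r" if "l < m" for p l using ptX[of p] that unfolding X_def by (auto simp: PiE_iff)
    show "p = q" if "p div N = q div N" "\<And>l. l < m \<Longrightarrow> pt p l = pt q l" for p q
    proof -
      have "pt p = pt q" using ptX[of p] ptX[of q] that(2) unfolding X_def by (intro PiE_ext) auto
      then have "p mod N = q mod N" using \<beta> N0 unfolding pt_def bij_betw_def inj_on_def by simp
      then show ?thesis using that(1) by (metis div_mult_mod_eq)
    qed
    show "\<exists>q\<in>{p. p div N < n div N}. q div N = p div N \<and> (\<forall>l<m. pt q l = a l)"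
      if "p \<in> {p. p div N < n div N}" "\<And>l. l < m \<Longrightarrow> a l < r" for p a
    proof -
      have "restrict a {..<m} \<in> X" unfolding X_def using that(2) by (auto simp: PiE_iff)
      then have "restrict a {..<m} \<in> \<beta> ` {..<N}" using \<beta> unfolding bij_betw_def by simp
      then obtain s where s: "s < N" "\<beta> s = restrict a {..<m}" by auto
      let ?q = "p div N * N + s"
      have q: "?q div N = p div N" "?q mod N = s" using s by simp_all
      then have "\<forall>l<m. pt ?q l = a l" unfolding pt_def using s by simp
      then show ?thesis using q that(1) by (intro bexI[of _ ?q]) auto
    qed
  qed (fact rm chi refl)+
  then show thesis by (rule that)
qed

lemma rainbow_sat_rotated_edge_upper:
  assumes H: "simple_graph H" and rot: "is_clique_rotated_edge r H" and r: "even r" "r \<ge> 4"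
    and t: "t \<ge> card (edges H)"
  shows "(\<lambda>n. real (rainbow_sat t n H)) \<in> O(\<lambda>n. real n)"
proof -
  obtain K u v w where K: "finite K" "card K = r" and uvw: "u \<in> K" "v \<in> K" "u \<noteq> v" "w \<notin> K"
    and vH: "verts H = insert w K" and eH: "edges H = insert {u, w} (nsets K 2 - {{u, v}})"
    using rot unfolding is_clique_rotated_edge_def by blast
  define m where "m = r div 2"
  have rm: "r = 2 * m" "r \<ge> 4" "r \<ge> 2" using r unfolding m_def by auto
  obtain \<chi> :: "nat \<Rightarrow> nat set \<Rightarrow> nat" where
    chi: "\<And>k e. e \<in> nsets {..<r} 2 \<Longrightarrow> k < m \<Longrightarrow> \<chi> k e \<in> {1..(r - 1) * m}"
      "\<And>k. k < m \<Longrightarrow> inj_on (\<chi> k) (nsets {..<r} 2)"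
      "\<And>a b b' k l. a < r \<Longrightarrow> b < r \<Longrightarrow> b' < r \<Longrightarrow> a \<noteq> b \<Longrightarrow> a \<noteq> b' \<Longrightarrow> k < m \<Longrightarrow> l < m \<Longrightarrow>
       \<chi> k {a, b} = \<chi> l {a, b'} \<Longrightarrow> k = l \<and> b = b'"
    using shifted_clique_colourings[OF r(1) rm(3)] unfolding m_def by blast
  define N where "N = r ^ m"
  have N0: "N > 0" unfolding N_def using rm by simp
  have le: "rainbow_sat t n H \<le> n * N" for n
  proof -
    obtain pt where hg: "hamming_graph r m ((r - 1) * m) \<chi> {..<n} {p. p div N < n div N} (\<lambda>p. p div N) pt"
      by (rule hamming_graph_exists[OF rm(1,2) chi N_def])
    interpret hamming_graph r m "(r - 1) * m" \<chi> "{..<n}" "{p. p div N < n div N}" "\<lambda>p. p div N" pt by (rule hg)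
    have cE: "card (edges H) = (r - 1) * m"
    proof -
      have fin: "finite (nsets K 2)" using K by (simp add: finite_imp_finite_nsets)
      have uv: "{u, v} \<in> nsets K 2" using uvw by (simp add: in_nsets_2_iff)
      have "{u, w} \<notin> nsets K 2" using uvw by (simp add: in_nsets_2_iff)
      then have "card (edges H) = Suc (card (nsets K 2 - {{u, v}}))" unfolding eH using fin by simp
      also have "\<dots> = card (nsets K 2)" by (rule card_Suc_Diff1[OF fin uv])
      also have "\<dots> = card (nsets {..<r} 2)" using K by simp
      also have "\<dots> = (r - 1) * m" by (rule card_pairs)
      finally show ?thesis .
    qed
    \<comment> \<open>Pairs within the incomplete last block are included, as nothing is known about
      adding them; there are still at most \<open>N\<close> partners for each vertex.\<close>
    define S where "S = {e \<in> nsets {..<n} 2. \<exists>p q. e = {p, q} \<and> p div N = q div N}"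
    have "rainbow_sat t n H \<le> card S"
    proof (rule rainbow_sat_le[OF H, of S n hedges hcolour])
      show "S \<subseteq> nsets {..<n} 2" unfolding S_def by blast
      show "hedges \<subseteq> S"
      proof
        fix e assume "e \<in> hedges"
        then obtain k p q where a: "adj k p q" "e = {p, q}" unfolding hedges_def by blast
        then have "p \<in> {..<n}" "q \<in> {..<n}" "p div N = q div N" using Fu unfolding adj_def by blast+
        then show "e \<in> S" using a adj_ne[OF a(1)] unfolding S_def by (auto simp: in_nsets_2_iff)
      qed
      show "\<And>e. e \<in> hedges \<Longrightarrow> hcolour e \<in> {1..t}" using hcolour_range t cE by fastforce
      show "\<nexists>\<psi>. rainbow_emb H ({..<n}, hedges) hcolour \<psi>"
        using hamming_no_rainbow_copy[OF K uvw vH eH] by blast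
      fix e i assume e: "e \<in> nsets {..<n} 2" "e \<notin> S" and i: "i \<in> {1..t}"
      obtain p q where pq: "e = {p, q}" "p \<noteq> q" "p \<in> {..<n}" "q \<in> {..<n}" using e(1) by (rule nsets_2E)
      have ne: "p div N \<noteq> q div N" using e pq unfolding S_def by blast
      have i1: "i \<ge> 1" using i by simp
      have "p div N \<le> n div N" "q div N \<le> n div N" using pq by (auto intro!: div_le_mono)
      \<comment> \<open>Of two different blocks at most one is incomplete, and the new edge needs a
        complete one only at one end.\<close>
      then have "p div N < n div N \<or> q div N < n div N" using ne by linarith
      then show "\<exists>\<psi>. rainbow_emb H ({..<n}, insert e hedges) (hcolour(e := i)) \<psi>"
      proof
        assume "p div N < n div N"
        then show ?thesis using hamming_new_edge[OF K uvw vH eH, of p q i] pq ne i1 by simp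
      next
        assume "q div N < n div N"
        moreover have "e = {q, p}" using pq by auto
        ultimately show ?thesis using hamming_new_edge[OF K uvw vH eH, of q p i] pq ne i1 by simp
      qed
    qed
    also have "S \<subseteq> (\<lambda>(p, s). {p, p div N * N + s}) ` ({..<n} \<times> {..<N})"
    proof
      fix e assume e: "e \<in> S"
      then obtain p q where pq: "e = {p, q}" "p div N = q div N" unfolding S_def by blast
      have "p < n" using e pq unfolding S_def by (auto simp: in_nsets_2_iff)
      moreover have "q = p div N * N + q mod N" using pq by (metis div_mult_mod_eq)
      then have "e = (\<lambda>(p, s). {p, p div N * N + s}) (p, q mod N)" using pq by simp
      ultimately show "e \<in> (\<lambda>(p, s). {p, p div N * N + s}) ` ({..<n} \<times> {..<N})"
        using N0 by (intro image_eqI[of _ _ "(p, q mod N)"]) auto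
    qed
    then have "card S \<le> card ({..<n} \<times> {..<N})" by (rule surj_card_le[rotated]) auto
    also have "\<dots> = n * N" by (simp add: card_cartesian_product)
    finally show ?thesis .
  qed
  have "norm (real (rainbow_sat t n H)) \<le> real N * norm (real n)" for n
    using of_nat_mono[OF le[of n], where 'a = real] by (simp add: mult.commute)
  then show ?thesis by (intro bigoI[of _ "real N"]) auto
qed

text \<open>If all edges contained \<open>x\<close>, the graph would be a star. An edge avoiding
  \<open>x\<close> forms a triangle with it.\<close>

lemma conical_triangle_edge:
  assumes H: "simple_graph H" "card (verts H) \<ge> 3" and x: "conical H x" and ns: "\<not> is_star H"
  shows "\<exists>e\<in>edges H. in_triangle H e"
proof -
  have fin: "finite (verts H)" using H unfolding simple_graph_def by blast
  have xv: "x \<in> verts H" using x unfolding conical_def by blast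
  have "\<exists>e\<in>edges H. x \<notin> e"
  proof (rule ccontr)
    assume "\<not> ?thesis"
    then have all: "\<And>e. e \<in> edges H \<Longrightarrow> x \<in> e" by blast
    let ?L = "verts H - {x}"
    have "card ?L \<ge> 2" using H(2) xv fin by simp
    then have "?L \<noteq> {}" by (metis card.empty not_numeral_le_zero)
    moreover have "edges H = {{x, y} | y. y \<in> ?L}"
    proof (intro equalityI subsetI)
      fix e assume e: "e \<in> edges H"
      obtain a b where "e = {a, b}" "a \<noteq> b" "a \<in> verts H" "b \<in> verts H" by (rule simple_graph_edgeE[OF H(1) e])
      then show "e \<in> {{x, y} | y. y \<in> ?L}" using all[OF e] by auto
    next
      fix e assume "e \<in> {{x, y} | y. y \<in> ?L}"
      then show "e \<in> edges H" using conical_adjacent[OF H(1) x] by blast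
    qed
    ultimately have "is_star H" unfolding is_star_def using fin xv
      by (intro exI[of _ x] exI[of _ ?L]) auto
    then show False using ns by blast
  qed
  then obtain e where e: "e \<in> edges H" "x \<notin> e" by blast
  obtain a b where ab: "e = {a, b}" "a \<noteq> b" "a \<in> verts H" "b \<in> verts H" by (rule simple_graph_edgeE[OF H(1) e(1)])
  have "{x, a} \<in> edges H" "{x, b} \<in> edges H" using conical_adjacent[OF H(1) x] ab e by auto
  then have "{a, b} \<in> edges H \<and> {a, x} \<in> edges H \<and> {b, x} \<in> edges H" using e ab by (simp add: insert_commute)
  then have "in_triangle H e" using in_triangle_iff[OF H(1) ab(2)] ab(1) by blast
  then show ?thesis using e by blast
qed

theorem theorem1p3:
  fixes H :: "'a graph" and t :: nat
  assumes "simple_graph H" and "connected_graph H" and "card (verts H) \<ge> 3"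
    and "t \<ge> card (edges H)"
  shows "(is_star H \<longrightarrow>
            (\<lambda>n. real (rainbow_sat t n H)) \<in> \<Theta>(\<lambda>n. real n ^ 2)) \<and>
         ((\<exists>v. conical H v) \<and> \<not> is_star H \<longrightarrow>
            (\<lambda>n. real (rainbow_sat t n H)) \<in> \<Theta>(\<lambda>n. real n * log 2 (real n))) \<and>
         ((\<forall>e\<in>edges H. in_triangle H e) \<longrightarrow>
            (\<lambda>n. real (rainbow_sat t n H)) \<in> \<Theta>(\<lambda>n. real n * log 2 (real n))) \<and>
         ((\<exists>e\<in>edges H. \<not> pendant H e \<and> \<not> in_triangle H e) \<longrightarrow>
            (\<lambda>n. real (rainbow_sat t n H)) \<in> \<Theta>(\<lambda>n. real n)) \<and>
         ((\<exists>r\<ge>4. even r \<and> is_clique_rotated_edge r H) \<longrightarrow>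
            (\<lambda>n. real (rainbow_sat t n H)) \<in> \<Theta>(\<lambda>n. real n))"
proof (intro conjI impI)
  assume "is_star H"
  then show "(\<lambda>n. real (rainbow_sat t n H)) \<in> \<Theta>(\<lambda>n. real n ^ 2)" by (rule rainbow_sat_star[OF assms])
next
  assume "(\<exists>v. conical H v) \<and> \<not> is_star H"
  then obtain x where x: "conical H x" "\<not> is_star H" by blast
  then obtain e where "e \<in> edges H" "in_triangle H e" using conical_triangle_edge[OF assms(1,3) x] by blast
  then show "(\<lambda>n. real (rainbow_sat t n H)) \<in> \<Theta>(\<lambda>n. real n * log 2 (real n))"
    using rainbow_sat_triangle_edge_upper[OF assms] rainbow_sat_conical_lower[OF assms x(1)] by (intro bigthetaI)
next
  assume tri: "\<forall>e\<in>edges H. in_triangle H e"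
  then obtain e where "e \<in> edges H" "in_triangle H e" using edges_nonempty[OF assms] by blast
  then show "(\<lambda>n. real (rainbow_sat t n H)) \<in> \<Theta>(\<lambda>n. real n * log 2 (real n))"
    using rainbow_sat_triangle_edge_upper[OF assms] rainbow_sat_triangle_lower[OF assms tri] by (intro bigthetaI)
next
  assume "\<exists>e\<in>edges H. \<not> pendant H e \<and> \<not> in_triangle H e"
  then obtain e where "bad_edge H e" unfolding bad_edge_def by blast
  then show "(\<lambda>n. real (rainbow_sat t n H)) \<in> \<Theta>(\<lambda>n. real n)"
    using rainbow_sat_bad_edge_upper[OF assms] rainbow_sat_linear_lower[OF assms] by (intro bigthetaI)
next
  assume "\<exists>r\<ge>4. even r \<and> is_clique_rotated_edge r H"
  then obtain r where "r \<ge> 4" "even r" "is_clique_rotated_edge r H" by blast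
  then show "(\<lambda>n. real (rainbow_sat t n H)) \<in> \<Theta>(\<lambda>n. real n)"
    using rainbow_sat_rotated_edge_upper[OF assms(1) _ _ _ assms(4)] rainbow_sat_linear_lower[OF assms] by (intro bigthetaI)
qed

end
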